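(* Let $(\sigma_n)_{n\in\mathbb N}$ be positive real numbers and let $X=(\mathbb R^\infty,\tau^\infty,\ell_2,\gamma^\infty)$, where $\tau^\infty$ is the product topology on $\mathbb R^\infty=\mathbb R^{\mathbb N}$, $\ell_2(x,y)=\bigl(\sum_{n=1}^\infty(x_n-y_n)^2\bigr)^{1/2}\in[0,\infty]$, and $\gamma^\infty=\bigotimes_{n=1}^\infty\gamma_{\sigma_n^2}$ with $\gamma_{\sigma_n^2}$ the one-dimensional centred Gaussian measure with variance $\sigma_n^2$. Then: \begin{enumerate} \item $X\in\mathfrak X_{\rm conc}$ if and only if $\sigma_n\to0$ as $n\to\infty$; \item $X\in\partial\mathfrak X_{\rm conc}$ if and only if $\sigma_n\to0$ as $n\to\infty$ and $\sum_{n=1}^\infty\sigma_n^2=+\infty$. \end{enumerate} In particular, the abstract Wiener space $\mathbb W$ (with infinite-dimensional Cameron–Martin space), which is emm-isomorphic to the case $\sigma_n=1$ for all $n$, is not concentrated.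
   Context: An emm-space is a quadruple $(X,\tau,d,m)$ where $(X,\tau)$ is a Polish topological space; $d:X\times X\to[0,+\infty]$ is an extended distance (symmetric, triangle inequality, $d(x,y)=0$ iff $x=y$) that is complete and $\tau\times\tau$-lower semicontinuous; the topology induced by $d$ is finer than or equal to $\tau$; $m$ is a $\tau$-Borel probability measure. An mm-space is a complete separable metric space with a Borel probability measure, regarded as an emm-space with its metric topology. Two emm-spaces $X,Y$ are emm-isomorphic if there are an $m_X$-measurable map $F:X\to Y$ with $F_\#m_X=m_Y$ and an $m_X$-measurable set $A\subset X$ with $m_X(A)=1$ such that $d_Y(F(x),F(y))=d_X(x,y)$ for all $x,y\in A$. $L^0(X)$ is the space of $m_X$-classes of real measurable functions with the Ky Fan distance $d_{L^0}(f,g)=\inf\{\varepsilon>0: m_X(|f-g|>\varepsilon)\le\varepsilon\}$; $\mathrm{Lip}_1(X,m_X)\subset L^0(X)$ is the set of classes of functions $f$ for which there is $E$ with $m_X(E)=1$ and $|f(x)-f(y)|\le d_X(x,y)$ on $E\times E$; $\mathcal L_1(X)=\mathrm{Lip}_1(X,m_X)/\mathbb R$ is its quotient by addition of constants, with the quotient distance inherited from $L^0(X)/\mathbb R$. An emm-space is concentrated if $\mathcal L_1(X)$ is compact. $\mathfrak X_{\rm conc}$ is the set of emm-isomorphism classes of concentrated emm-spaces and $\partial\mathfrak X_{\rm conc}$ is the subset of classes of concentrated emm-spaces that are not emm-isomorphic to any mm-space. We write $X\in\mathfrak X_{\rm conc}$ if the class of $X$ belongs to it. An abstract Wiener space is a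 triple $(W,H,\mu)$: $H$ a separable real Hilbert space continuously and densely embedded in a separable real Banach space $W$, and $\mu$ the centred Gaussian measure on $W$ with Cameron–Martin space $H$. It is regarded as the emm-space $\mathbb W=(W,\tau_W,d_H,\mu)$, with $\tau_W$ the norm topology of $W$ and $d_H(w_1,w_2)=\|w_1-w_2\|_H$ if $w_1-w_2\in H$, $+\infty$ otherwise. *)

theory Defs
  imports "HOL-Probability.Probability"
begin

section \<open>Extended metric measure spaces\<close>

text \<open>
  The carrier is \<^term>\<open>topspace (emm_top X)\<close>, so the elements of a type that lie outside the
  carrier, and the values of the distance there, play no role.
\<close>

record 'a emm =
  emm_top :: "'a topology"
  emm_dist :: "'a \<Rightarrow> 'a \<Rightarrow> ennreal"
  emm_meas :: "'a measure"

definition borel_prob_on :: "'a topology \<Rightarrow> 'a measure \<Rightarrow> bool" where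
  "borel_prob_on T m \<longleftrightarrow>
     sets m = sigma_sets (topspace T) {U. openin T U} \<and> prob_space m"

definition ext_distance_on :: "'a set \<Rightarrow> ('a \<Rightarrow> 'a \<Rightarrow> ennreal) \<Rightarrow> bool" where
  "ext_distance_on S d \<longleftrightarrow>
     (\<forall>x\<in>S. \<forall>y\<in>S. d x y = d y x) \<and>
     (\<forall>x\<in>S. \<forall>y\<in>S. \<forall>z\<in>S. d x z \<le> d x y + d y z) \<and>
     (\<forall>x\<in>S. \<forall>y\<in>S. d x y = 0 \<longleftrightarrow> x = y)"

definition ext_complete_on :: "'a set \<Rightarrow> ('a \<Rightarrow> 'a \<Rightarrow> ennreal) \<Rightarrow> bool" where
  "ext_complete_on S d \<longleftrightarrow>
     (\<forall>s::nat \<Rightarrow> 'a. range s \<subseteq> S \<and> (\<forall>\<epsilon>>0. \<exists>N. \<forall>i\<ge>N. \<forall>j\<ge>N. d (s i) (s j) < \<epsilon>) \<longrightarrow>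
        (\<exists>x\<in>S. (\<lambda>n. d (s n) x) \<longlonglongrightarrow> 0))"

definition lsc_dist :: "'a topology \<Rightarrow> ('a \<Rightarrow> 'a \<Rightarrow> ennreal) \<Rightarrow> bool" where
  "lsc_dist T d \<longleftrightarrow>
     (\<forall>c. openin (prod_topology T T) {(x, y). x \<in> topspace T \<and> y \<in> topspace T \<and> c < d x y})"

text \<open>Every open set of \<open>T\<close> is open for the topology induced by the extended distance \<open>d\<close>.\<close>

definition dist_topology_finer :: "'a topology \<Rightarrow> ('a \<Rightarrow> 'a \<Rightarrow> ennreal) \<Rightarrow> bool" where
  "dist_topology_finer T d \<longleftrightarrow>
     (\<forall>U. openin T U \<longrightarrow> (\<forall>x\<in>U. \<exists>\<epsilon>>0. \<forall>y\<in>topspace T. d x y < \<epsilon> \<longrightarrow> y \<in> U))"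

definition emm_space :: "'a emm \<Rightarrow> bool" where
  "emm_space X \<longleftrightarrow>
     completely_metrizable_space (emm_top X) \<and> second_countable (emm_top X) \<and>
     ext_distance_on (topspace (emm_top X)) (emm_dist X) \<and>
     ext_complete_on (topspace (emm_top X)) (emm_dist X) \<and>
     lsc_dist (emm_top X) (emm_dist X) \<and>
     dist_topology_finer (emm_top X) (emm_dist X) \<and>
     borel_prob_on (emm_top X) (emm_meas X)"

definition mm_space :: "'a emm \<Rightarrow> bool" where
  "mm_space X \<longleftrightarrow>
     (\<exists>M d m. Metric_space M d \<and> Metric_space.mcomplete M d \<and>
        separable_space (Metric_space.mtopology M d) \<and>
        borel_prob_on (Metric_space.mtopology M d) m \<and>
        X = \<lparr>emm_top = Metric_space.mtopology M d,
             emm_dist = (\<lambda>x y. ennreal (d x y)), emm_meas = m\<rparr>)"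

text \<open>
  A set or a map is \<open>m\<^sub>X\<close>-measurable if it is measurable for the completion of \<open>m\<^sub>X\<close>.
\<close>

definition emm_iso :: "'a emm \<Rightarrow> 'b emm \<Rightarrow> bool" where
  "emm_iso X Y \<longleftrightarrow>
     (\<exists>F. F \<in> measurable (completion (emm_meas X)) (emm_meas Y) \<and>
        distr (completion (emm_meas X)) (emm_meas Y) F = emm_meas Y \<and>
        (\<exists>A\<in>sets (completion (emm_meas X)). emeasure (completion (emm_meas X)) A = 1 \<and>
           (\<forall>x\<in>A. \<forall>y\<in>A. emm_dist Y (F x) (F y) = emm_dist X x y)))"


section \<open>Classes of functions, the Ky Fan distance and concentration\<close>

definition ae_rel :: "'a measure \<Rightarrow> (('a \<Rightarrow> real) \<times> ('a \<Rightarrow> real)) set" where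
  "ae_rel m = {(f, g). f \<in> borel_measurable m \<and> g \<in> borel_measurable m \<and> (AE x in m. f x = g x)}"

definition L0 :: "'a measure \<Rightarrow> ('a \<Rightarrow> real) set set" where
  "L0 m = borel_measurable m // ae_rel m"

definition ky_fan :: "'a measure \<Rightarrow> ('a \<Rightarrow> real) \<Rightarrow> ('a \<Rightarrow> real) \<Rightarrow> real" where
  "ky_fan m f g = Inf {\<epsilon>. 0 < \<epsilon> \<and> measure m {x\<in>space m. \<epsilon> < \<bar>f x - g x\<bar>} \<le> \<epsilon>}"

text \<open>The value of \<^const>\<open>ky_fan\<close> does not depend on the representatives.\<close>

definition L0_dist :: "'a measure \<Rightarrow> ('a \<Rightarrow> real) set \<Rightarrow> ('a \<Rightarrow> real) set \<Rightarrow> real" where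
  "L0_dist m a b = ky_fan m (SOME f. f \<in> a) (SOME g. g \<in> b)"

definition shift_rel :: "'a measure \<Rightarrow> (('a \<Rightarrow> real) set \<times> ('a \<Rightarrow> real) set) set" where
  "shift_rel m = {(a, b). a \<in> L0 m \<and> b \<in> L0 m \<and> (\<exists>c::real. b = (\<lambda>f x. f x + c) ` a)}"

definition L0_mod_R :: "'a measure \<Rightarrow> ('a \<Rightarrow> real) set set set" where
  "L0_mod_R m = L0 m // shift_rel m"

text \<open>
  The conditional only fixes the value off \<^term>\<open>L0_mod_R m\<close>, where \<^locale>\<open>Metric_space\<close> still
  asks for symmetry and nonnegativity.
\<close>

definition L0_mod_R_dist ::
    "'a measure \<Rightarrow> ('a \<Rightarrow> real) set set \<Rightarrow> ('a \<Rightarrow> real) set set \<Rightarrow> real" where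
  "L0_mod_R_dist m A B =
     (if A \<in> L0_mod_R m \<and> B \<in> L0_mod_R m then Inf {L0_dist m a b |a b. a \<in> A \<and> b \<in> B} else 0)"

definition Lip1 :: "'a emm \<Rightarrow> ('a \<Rightarrow> real) set set" where
  "Lip1 X = {ae_rel (emm_meas X) `` {f} |f. f \<in> borel_measurable (emm_meas X) \<and>
     (\<exists>E\<in>sets (emm_meas X). emeasure (emm_meas X) E = 1 \<and>
        (\<forall>x\<in>E. \<forall>y\<in>E. ennreal \<bar>f x - f y\<bar> \<le> emm_dist X x y))}"

definition Lip1_mod_R :: "'a emm \<Rightarrow> ('a \<Rightarrow> real) set set set" where
  "Lip1_mod_R X = Lip1 X // shift_rel (emm_meas X)"

definition concentrated :: "'a emm \<Rightarrow> bool" where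
  "concentrated X \<longleftrightarrow>
     compactin (Metric_space.mtopology (L0_mod_R (emm_meas X)) (L0_mod_R_dist (emm_meas X)))
       (Lip1_mod_R X)"

definition in_X_conc :: "'a emm \<Rightarrow> bool" where
  "in_X_conc X \<longleftrightarrow> emm_space X \<and> concentrated X"

text \<open>
  Quantifying over mm-spaces whose points are real sequences is no restriction: see
  \<open>mm_space_on_sequences\<close> below.
\<close>

definition in_boundary_X_conc :: "'a emm \<Rightarrow> bool" where
  "in_boundary_X_conc X \<longleftrightarrow>
     in_X_conc X \<and> \<not> (\<exists>Y :: (nat \<Rightarrow> real) emm. mm_space Y \<and> emm_iso X Y)"


section \<open>Gaussian spaces\<close>

definition l2_dist :: "(nat \<Rightarrow> real) \<Rightarrow> (nat \<Rightarrow> real) \<Rightarrow> ennreal" where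
  "l2_dist x y =
     (if summable (\<lambda>n. (x n - y n)\<^sup>2) then ennreal (sqrt (\<Sum>n. (x n - y n)\<^sup>2)) else \<infinity>)"

text \<open>The second parameter of \<^const>\<open>normal_density\<close> is the standard deviation.\<close>

definition gaussian_R_infinity :: "(nat \<Rightarrow> real) \<Rightarrow> (nat \<Rightarrow> real) emm" where
  "gaussian_R_infinity \<sigma> =
     \<lparr>emm_top = product_topology (\<lambda>_. euclideanreal) UNIV,
      emm_dist = l2_dist,
      emm_meas = PiM UNIV (\<lambda>n. density lborel (\<lambda>x. ennreal (normal_density 0 (\<sigma> n) x)))\<rparr>"

definition centred_gaussian_law :: "real measure \<Rightarrow> bool" where
  "centred_gaussian_law \<nu> \<longleftrightarrow>
     \<nu> = return borel 0 \<or> (\<exists>s>0. \<nu> = density lborel (\<lambda>x. ennreal (normal_density 0 s x)))"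

definition centred_gaussian :: "'w::real_normed_vector measure \<Rightarrow> bool" where
  "centred_gaussian \<mu> \<longleftrightarrow> prob_space \<mu> \<and> sets \<mu> = sets borel \<and>
     (\<forall>l :: 'w \<Rightarrow> real. bounded_linear l \<longrightarrow> centred_gaussian_law (distr \<mu> borel l))"

text \<open>
  \<open>|h| = sup {l(h) : l \<in> W*, \<integral> l\<^sup>2 d\<mu> \<le> 1}\<close>; the Cameron--Martin space consists of the \<open>h\<close> with
  \<open>|h| < \<infinity>\<close> and carries this norm.
\<close>

definition cameron_martin_norm :: "'w::real_normed_vector measure \<Rightarrow> 'w \<Rightarrow> ereal" where
  "cameron_martin_norm \<mu> h =
     (SUP l\<in>{l :: 'w \<Rightarrow> real. bounded_linear l \<and> (LINT x|\<mu>. (l x)\<^sup>2) \<le> 1}. ereal (l h))"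

definition cameron_martin_space :: "'w::real_normed_vector measure \<Rightarrow> 'w set" where
  "cameron_martin_space \<mu> = {h. cameron_martin_norm \<mu> h < \<infinity>}"

text \<open>The embedding of \<open>H\<close> into \<open>W\<close> is the explicit map \<open>\<iota>\<close>.\<close>

definition abstract_wiener_space ::
    "('h::{real_inner,complete_space,second_countable_topology} \<Rightarrow>
      'w::{banach,second_countable_topology}) \<Rightarrow> 'w measure \<Rightarrow> bool" where
  "abstract_wiener_space \<iota> \<mu> \<longleftrightarrow>
     bounded_linear \<iota> \<and> inj \<iota> \<and> closure (range \<iota>) = UNIV \<and>
     centred_gaussian \<mu> \<and>
     cameron_martin_space \<mu> = range \<iota> \<and>
     (\<forall>h. cameron_martin_norm \<mu> (\<iota> h) = ereal (norm h))"

definition wiener_emm ::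
    "('h::{real_inner,complete_space,second_countable_topology} \<Rightarrow>
      'w::{banach,second_countable_topology}) \<Rightarrow> 'w measure \<Rightarrow> 'w emm" where
  "wiener_emm \<iota> \<mu> =
     \<lparr>emm_top = euclidean,
      emm_dist = (\<lambda>v w. if v - w \<in> range \<iota> then ennreal (norm (inv \<iota> (v - w))) else \<infinity>),
      emm_meas = \<mu>\<rparr>"


section \<open>Mm-spaces on real sequences\<close>

lemma mm_space_on_sequences:
  fixes X :: "'a emm" and Y :: "'b emm"
  assumes "mm_space Y" and "emm_iso X Y"
  shows "\<exists>Z :: (nat \<Rightarrow> real) emm. mm_space Z \<and> emm_iso X Z"
proof -
  obtain M d m where Md: "Metric_space M d" and compl: "Metric_space.mcomplete M d"
    and sep: "separable_space (Metric_space.mtopology M d)"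
    and m: "borel_prob_on (Metric_space.mtopology M d) m"
    and Y: "Y = \<lparr>emm_top = Metric_space.mtopology M d,
                emm_dist = (\<lambda>x y. ennreal (d x y)), emm_meas = m\<rparr>"
    using assms(1) unfolding mm_space_def by blast
  interpret M: Metric_space M d by (fact Md)
  interpret m: prob_space m using m by (simp add: borel_prob_on_def)
  have sets_m: "sets m = sigma_sets M {U. openin M.mtopology U}"
    using m by (simp add: borel_prob_on_def)
  have sub: "{U. openin M.mtopology U} \<subseteq> Pow M"
    using openin_subset by fastforce
  have space_m: "space m = M"
    using sets_eq_imp_space_eq[of m "sigma M {U. openin M.mtopology U}"] sets_m sub
    by (simp add: sets_measure_of space_measure_of)
  obtain D where D: "countable D" "D \<subseteq> M" "M.mtopology closure_of D = M"
    using sep unfolding separable_space_def by auto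
  have "D \<noteq> {}" using D(3) m.not_empty space_m by auto
  define q where "q = from_nat_into D"
  have rq: "range q = D" using D(1) \<open>D \<noteq> {}\<close> by (simp add: q_def range_from_nat_into)
  define \<phi> where "\<phi> x = (\<lambda>n. d x (q n))" for x
  have inj: "inj_on \<phi> M"
  proof (rule inj_onI, rule ccontr)
    fix x y assume xy: "x \<in> M" "y \<in> M" "\<phi> x = \<phi> y" "x \<noteq> y"
    then have pos: "d x y / 2 > 0" by simp
    have "x \<in> M.mtopology closure_of D" using xy D by simp
    then obtain z where z: "z \<in> D" "z \<in> M.mball x (d x y / 2)"
      using pos unfolding M.metric_closure_of by blast
    then obtain n where n: "z = q n" using rq by auto
    have "d x z = d y z" using xy(3) n unfolding \<phi>_def by metis
    then have "d x y \<le> d x z + d x z"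
      using M.triangle[of x z y] xy z D M.commute[of y z] by auto
    then show False using z by (auto simp: M.in_mball)
  qed
  define M' where "M' = \<phi> ` M"
  define \<psi> where "\<psi> = inv_into M \<phi>"
  define d' where "d' u v = d (\<psi> u) (\<psi> v)" for u v
  have \<psi>\<phi>: "\<psi> (\<phi> x) = x" if "x \<in> M" for x using inj that by (simp add: \<psi>_def)
  have \<psi>M: "\<psi> u \<in> M" "\<phi> (\<psi> u) = u" if "u \<in> M'" for u
    using that \<psi>\<phi> by (auto simp: M'_def)
  have M'd': "Metric_space M' d'"
  proof
    show "0 \<le> d' x y" "d' x y = d' y x" for x y by (auto simp: d'_def M.commute)
    show "(d' x y = 0) = (x = y)" if "x \<in> M'" "y \<in> M'" for x y
      using that \<psi>M by (metis d'_def M.zero)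
    show "d' x z \<le> d' x y + d' y z" if "x \<in> M'" "y \<in> M'" "z \<in> M'" for x y z
      using that \<psi>M by (simp add: d'_def M.triangle)
  qed
  interpret M': Metric_space M' d' by (fact M'd')
  have ball: "\<phi> x \<in> M'" "M'.mball (\<phi> x) r = \<phi> ` M.mball x r" if "x \<in> M" for x r
  proof -
    show x: "\<phi> x \<in> M'" using that by (simp add: M'_def)
    have "u \<in> M'.mball (\<phi> x) r \<longleftrightarrow> u \<in> \<phi> ` M.mball x r" for u
    proof
      assume "u \<in> M'.mball (\<phi> x) r"
      then have "\<psi> u \<in> M.mball x r" "u = \<phi> (\<psi> u)"
        using that \<psi>M by (auto simp: M'.in_mball M.in_mball d'_def \<psi>\<phi>)
      then show "u \<in> \<phi> ` M.mball x r" by blast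
    next
      assume "u \<in> \<phi> ` M.mball x r"
      then obtain y where "y \<in> M" "d x y < r" "u = \<phi> y" by (auto simp: M.in_mball)
      moreover from this have "\<phi> y \<in> M'" by (simp add: M'_def)
      ultimately show "u \<in> M'.mball (\<phi> x) r"
        using that x by (simp add: M'.in_mball d'_def \<psi>\<phi>)
    qed
    then show "M'.mball (\<phi> x) r = \<phi> ` M.mball x r" by blast
  qed
  have open_image: "openin M'.mtopology (\<phi> ` U)" if "openin M.mtopology U" for U
    unfolding M'.openin_mtopology
  proof (intro conjI allI impI)
    have UM: "U \<subseteq> M" using that openin_subset by fastforce
    then show "\<phi> ` U \<subseteq> M'" by (auto simp: M'_def)
    fix u assume "u \<in> \<phi> ` U"
    then obtain x where x: "x \<in> U" "u = \<phi> x" by auto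
    have "\<exists>r>0. M.mball x r \<subseteq> U"
      using that x(1) by (simp add: M.openin_mtopology)
    then obtain r where r: "r > 0" "M.mball x r \<subseteq> U" by (elim exE conjE)
    have "x \<in> M" using x UM by auto
    then have "M'.mball u r = \<phi> ` M.mball x r" using ball(2) x(2) by simp
    then show "\<exists>r>0. M'.mball u r \<subseteq> \<phi> ` U"
      using r by (metis image_mono)
  qed
  have open_pre: "openin M.mtopology (\<phi> -` U \<inter> M)" if U: "openin M'.mtopology U" for U
    unfolding M.openin_mtopology
  proof (intro conjI allI impI)
    fix x assume x: "x \<in> \<phi> -` U \<inter> M"
    then have "\<exists>r>0. M'.mball (\<phi> x) r \<subseteq> U"
      using U by (simp add: M'.openin_mtopology)
    then obtain r where r: "r > 0" "M'.mball (\<phi> x) r \<subseteq> U" by (elim exE conjE)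
    have "\<phi> ` M.mball x r \<subseteq> U" using x ball(2)[of x r] r(2) by simp
    moreover have "M.mball x r \<subseteq> M" by (rule M.mball_subset_mspace)
    ultimately have "M.mball x r \<subseteq> \<phi> -` U \<inter> M" by (simp add: image_subset_iff_subset_vimage)
    then show "\<exists>r>0. M.mball x r \<subseteq> \<phi> -` U \<inter> M" using r(1) by (intro exI[of _ r] conjI)
  qed auto
  have cont: "continuous_map M.mtopology M'.mtopology \<phi>"
    unfolding continuous_map_def
  proof (intro conjI allI impI)
    show "\<phi> \<in> topspace M.mtopology \<rightarrow> topspace M'.mtopology" using ball(1) by auto
    fix U assume "openin M'.mtopology U"
    moreover have "{x \<in> topspace M.mtopology. \<phi> x \<in> U} = \<phi> -` U \<inter> M" by auto
    ultimately show "openin M.mtopology {x \<in> topspace M.mtopology. \<phi> x \<in> U}"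
      using open_pre by simp
  qed
  have compl': "M'.mcomplete"
    unfolding M'.mcomplete_def
  proof (intro allI impI)
    fix s assume s: "M'.MCauchy s"
    then have rs: "range s \<subseteq> M'" by (auto simp: M'.MCauchy_def)
    have "M.MCauchy (\<psi> \<circ> s)"
      using s \<psi>M by (auto simp: M'.MCauchy_def M.MCauchy_def d'_def)
    then obtain x where x: "limitin M.mtopology (\<psi> \<circ> s) x sequentially"
      using compl by (auto simp: M.mcomplete_def)
    have "limitin M'.mtopology (\<phi> \<circ> (\<psi> \<circ> s)) (\<phi> x) sequentially"
      by (rule continuous_map_limit[OF cont x])
    moreover have "\<phi> \<circ> (\<psi> \<circ> s) = s"
    proof
      fix n
      have "s n \<in> M'" using rs by (auto simp: image_subset_iff)
      then show "(\<phi> \<circ> (\<psi> \<circ> s)) n = s n" using \<psi>M(2) by simp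
    qed
    ultimately show "\<exists>x. limitin M'.mtopology s x sequentially" by auto
  qed
  have sep': "separable_space M'.mtopology"
    by (rule separable_space_continuous_map_image[OF sep cont])
      (simp only: M.topspace_mtopology M'.topspace_mtopology M'_def[symmetric])
  define S' where "S' = sigma M' {U. openin M'.mtopology U}"
  have sub': "{U. openin M'.mtopology U} \<subseteq> Pow M'"
    using openin_subset by fastforce
  have meas: "\<phi> \<in> measurable m S'"
    unfolding S'_def
  proof (rule measurable_measure_of[OF sub'])
    show "\<phi> \<in> space m \<rightarrow> M'" using ball(1) space_m by auto
    show "\<phi> -` U \<inter> space m \<in> sets m" if "U \<in> {U. openin M'.mtopology U}" for U
      using that open_pre sets_m space_m by auto
  qed
  define m' where "m' = distr m S' \<phi>"
  have m': "borel_prob_on M'.mtopology m'"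
    unfolding borel_prob_on_def m'_def using m.prob_space_distr[OF meas] sub'
    by (simp add: S'_def sets_measure_of)
  define Z where "Z = \<lparr>emm_top = M'.mtopology, emm_dist = (\<lambda>x y. ennreal (d' x y)), emm_meas = m'\<rparr>"
  have "mm_space Z"
    unfolding mm_space_def Z_def using M'd' compl' sep' m' by blast
  moreover have "emm_iso X Z"
  proof -
    let ?C = "completion (emm_meas X)"
    obtain F A where F: "F \<in> measurable ?C m" "distr ?C m F = m" "A \<in> sets ?C" "emeasure ?C A = 1"
      "\<And>x y. x \<in> A \<Longrightarrow> y \<in> A \<Longrightarrow> ennreal (d (F x) (F y)) = emm_dist X x y"
      using assms(2) unfolding emm_iso_def Y emm.simps by (elim exE conjE bexE) blast
    have FM: "F x \<in> M" if "x \<in> A" for x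
      using that measurable_space[OF F(1)] sets.sets_into_space[OF F(3)] space_m by auto
    have meas': "\<phi> \<in> measurable m m'" using meas by (simp add: m'_def)
    have "\<phi> \<circ> F \<in> measurable ?C m'" using F(1) meas' by (rule measurable_comp)
    moreover have "distr ?C m' (\<phi> \<circ> F) = m'"
    proof -
      have "distr ?C m' (\<phi> \<circ> F) = distr m m' \<phi>" using distr_distr[OF meas' F(1)] F(2) by simp
      also have "\<dots> = m'" unfolding m'_def by (intro distr_cong) simp_all
      finally show ?thesis .
    qed
    moreover have "ennreal (d' ((\<phi> \<circ> F) x) ((\<phi> \<circ> F) y)) = emm_dist X x y"
      if "x \<in> A" "y \<in> A" for x y
      using that F(5) FM by (simp add: d'_def \<psi>\<phi>)
    ultimately show ?thesis
      unfolding emm_iso_def Z_def emm.simps using F(3,4) by (intro exI[of _ "\<phi> \<circ> F"] conjI bexI[of _ A] ballI)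
  qed
  ultimately show ?thesis by blast
qed

end

theory Submission
  imports Defs
begin

text \<open>
  If \<open>\<sigma>\<^sub>n\<close> does not tend to \<open>0\<close>, infinitely many coordinate functions are uniformly separated modulo
  constants, so the 1-Lipschitz functions modulo constants are not compact.

  If \<open>\<sigma>\<^sub>n \<rightarrow> 0\<close>, a 1-Lipschitz function is close in measure to a function of its first \<open>N\<close>
  coordinates, uniformly in the function. This is a dimension-free concentration inequality for the
  tail, which follows from Maurey's property tau: if
  \<open>F(x) G(y) \<le> exp(\<Sum>\<^sub>i (x\<^sub>i - y\<^sub>i)\<^sup>2 / 4 \<sigma>\<^sub>i\<^sup>2)\<close> then \<open>\<integral>F d\<gamma> \<cdot> \<integral>G d\<gamma> \<le> 1\<close>. That statement
  tensorises by Fubini, and in dimension one it is a Prekopa--Leindler inequality whose Brunn--Minkowski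
  step is trivial because the superlevel sets of a Gaussian are intervals. For fixed \<open>N\<close> the truncated
  functions are compact by a diagonal argument. Constants are eliminated by working with
  \<open>f(x) - f(x')\<close> on the product space and freezing a good \<open>x'\<close> at the end.

  An isomorphism with an mm-space makes \<open>\<Sum>\<^sub>n (x\<^sub>n - y\<^sub>n)\<^sup>2\<close> finite almost surely, while the expectation of
  \<open>exp(- \<Sum>\<^sub>n (x\<^sub>n - y\<^sub>n)\<^sup>2 / 2)\<close> is at most \<open>\<Prod>\<^sub>n (1 + \<sigma>\<^sub>n\<^sup>2)\<^sup>-\<^sup>1\<^sup>/\<^sup>2\<close>, which vanishes if
  \<open>\<Sum>\<^sub>n \<sigma>\<^sub>n\<^sup>2 = \<infinity>\<close>. If the sum is finite, almost every sequence lies in \<open>\<ell>\<^sub>2\<close>.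

  For a Wiener space, every continuous functional \<open>k\<close> is represented on the Cameron--Martin space by a
  vector whose norm is the \<open>L\<^sup>2\<close> norm of \<open>k\<close>; orthonormalising a countable separating family of
  functionals gives coordinates with independent standard normal laws that realise the distance.
\<close>

section \<open>The Ky Fan metric on classes of functions modulo constants\<close>

text \<open>When the variances are not summable, two independent samples are almost surely at
  distance \<open>\<infinity>\<close>, and the 1-Lipschitz condition says nothing about them: it
  only compares points whose difference is square-summable. Hence all comparisons go through
  \<open>splice\<close>. Resampling a set of coordinates preserves the law, and for a finite set the
  old and the new point are at finite distance. Resampling an infinite tail is reduced to a finite
  block \<open>{N..<M}\<close> after \<open>f\<close> has been replaced in probability by a function
  of the first \<open>M\<close> coordinates; since the Gaussian bound does not see the number of
  coordinates, \<open>M\<close> is harmless. The Lipschitz condition holds only on a set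
  \<open>E\<close> of full measure, and functions are never extended from it: property tau is
  applied to exponentials cut off by the indicator of \<open>E\<close>. In the Wiener part only the
  one-dimensional laws of functionals are given. Independence is extracted from one-dimensional Levy
  uniqueness by reweighting the measure, and the vector representing a functional is a limit of
  truncated Bochner integrals, so that no moment bound on the norm enters.\<close>

context prob_space
begin

lemma ky_fan_set_ne: "{\<epsilon>. 0 < \<epsilon> \<and> prob {x\<in>space M. \<epsilon> < \<bar>f x - g x\<bar>} \<le> \<epsilon>} \<noteq> {}"
  using prob_le_1 by (auto intro!: exI[of _ 1])

lemma ky_fan_set_bdd: "bdd_below {\<epsilon>. 0 < \<epsilon> \<and> prob {x\<in>space M. \<epsilon> < \<bar>f x - g x\<bar>} \<le> \<epsilon>}"
  by (rule bdd_belowI[of _ 0]) auto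

lemma ky_fan_nonneg: "0 \<le> ky_fan M f g"
  unfolding ky_fan_def by (rule cInf_greatest[OF ky_fan_set_ne]) auto

lemma ky_fan_le: "0 < \<epsilon> \<Longrightarrow> prob {x\<in>space M. \<epsilon> < \<bar>f x - g x\<bar>} \<le> \<epsilon> \<Longrightarrow> ky_fan M f g \<le> \<epsilon>"
  unfolding ky_fan_def by (rule cInf_lower[OF _ ky_fan_set_bdd]) auto

text \<open>The bound comes out strict because some admissible \<open>e\<close> lies strictly below
  \<open>\<epsilon>\<close>, and raising the threshold from \<open>e\<close> to
  \<open>\<epsilon>\<close> only shrinks the event.\<close>

lemma ky_fan_lessD:
  assumes [measurable]: "f \<in> borel_measurable M" "g \<in> borel_measurable M" and "ky_fan M f g < \<epsilon>"
  shows "prob {x\<in>space M. \<epsilon> < \<bar>f x - g x\<bar>} < \<epsilon>"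
proof -
  obtain e where e: "0 < e" "prob {x\<in>space M. e < \<bar>f x - g x\<bar>} \<le> e" "e < \<epsilon>"
    using assms(3) cInf_lessD[OF ky_fan_set_ne] unfolding ky_fan_def by blast
  have "prob {x\<in>space M. \<epsilon> < \<bar>f x - g x\<bar>} \<le> prob {x\<in>space M. e < \<bar>f x - g x\<bar>}"
    using e by (intro finite_measure_mono) auto
  then show ?thesis using e by linarith
qed

lemma ky_fan_commute: "ky_fan M f g = ky_fan M g f"
  unfolding ky_fan_def by (simp add: abs_minus_commute)

lemma ky_fan_cong:
  assumes [measurable]: "f \<in> borel_measurable M" "g \<in> borel_measurable M"
    "f' \<in> borel_measurable M" "g' \<in> borel_measurable M"
    and "AE x in M. f x = f' x" "AE x in M. g x = g' x"
  shows "ky_fan M f g = ky_fan M f' g'"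
proof -
  have "prob {x\<in>space M. \<epsilon> < \<bar>f x - g x\<bar>} = prob {x\<in>space M. \<epsilon> < \<bar>f' x - g' x\<bar>}" for \<epsilon>
    using assms(5,6) by (intro finite_measure_eq_AE) auto
  then show ?thesis unfolding ky_fan_def by simp
qed

lemma ky_fan_shift: "ky_fan M (\<lambda>x. f x + c) (\<lambda>x. g x + c) = ky_fan M f g"
  unfolding ky_fan_def by simp

text \<open>By the union bound, admissible thresholds \<open>a\<close> and \<open>b\<close> for the
  two legs add up to an admissible threshold for the whole. The slack \<open>e/2\<close> keeps each
  of them strictly above the infimum.\<close>

lemma ky_fan_triangle:
  assumes [measurable]: "f \<in> borel_measurable M" "g \<in> borel_measurable M" "h \<in> borel_measurable M"
  shows "ky_fan M f h \<le> ky_fan M f g + ky_fan M g h"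
proof (rule field_le_epsilon)
  fix e :: real assume "e > 0"
  define a where "a = ky_fan M f g + e/2"
  define b where "b = ky_fan M g h + e/2"
  have ab: "a > 0" "b > 0" using \<open>e > 0\<close> ky_fan_nonneg[of f g] ky_fan_nonneg[of g h] by (auto simp: a_def b_def)
  have 1: "prob {x\<in>space M. a < \<bar>f x - g x\<bar>} < a" "prob {x\<in>space M. b < \<bar>g x - h x\<bar>} < b"
    using \<open>e > 0\<close> by (intro ky_fan_lessD; simp add: a_def b_def)+
  have "prob {x\<in>space M. a + b < \<bar>f x - h x\<bar>}
      \<le> prob ({x\<in>space M. a < \<bar>f x - g x\<bar>} \<union> {x\<in>space M. b < \<bar>g x - h x\<bar>})"
    by (intro finite_measure_mono) auto
  also have "\<dots> \<le> prob {x\<in>space M. a < \<bar>f x - g x\<bar>} + prob {x\<in>space M. b < \<bar>g x - h x\<bar>}"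
    by (intro measure_Un_le) auto
  finally have "ky_fan M f h \<le> a + b" using 1 ab by (intro ky_fan_le) auto
  then show "ky_fan M f h \<le> ky_fan M f g + ky_fan M g h + e" by (simp add: a_def b_def)
qed

lemma ky_fan_eq_0D:
  assumes [measurable]: "f \<in> borel_measurable M" "g \<in> borel_measurable M" and 0: "ky_fan M f g = 0"
  shows "AE x in M. f x = g x"
proof -
  have "prob {x\<in>space M. \<delta> < \<bar>f x - g x\<bar>} = 0" if "\<delta> > 0" for \<delta>
  proof (rule antisym)
    show "prob {x\<in>space M. \<delta> < \<bar>f x - g x\<bar>} \<le> 0"
    proof (rule field_le_epsilon)
      fix e :: real assume "e > 0"
      \<comment> \<open>Threshold and probability bound are the same number in the Ky Fan distance,
        so the threshold is lowered to \<open>min e \<delta>\<close> to bring the probability below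
        \<open>e\<close>.\<close>
      have "prob {x\<in>space M. \<delta> < \<bar>f x - g x\<bar>} \<le> prob {x\<in>space M. min e \<delta> < \<bar>f x - g x\<bar>}"
        by (intro finite_measure_mono) auto
      also have "\<dots> < min e \<delta>" using 0 \<open>e > 0\<close> that by (intro ky_fan_lessD) auto
      finally show "prob {x\<in>space M. \<delta> < \<bar>f x - g x\<bar>} \<le> 0 + e" by auto
    qed
  qed simp
  then have "AE x in M. \<not> (1 / Suc n < \<bar>f x - g x\<bar>)" for n
    by (intro prob_Collect_eq_0[THEN iffD1]) auto
  then have "AE x in M. \<forall>n. \<not> (1 / Suc n < \<bar>f x - g x\<bar>)" by (simp add: AE_all_countable)
  then show ?thesis
  proof eventually_elim
    case (elim x)
    show ?case
    proof (rule ccontr)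
      assume "f x \<noteq> g x"
      then have "\<bar>f x - g x\<bar> > 0" by simp
      then obtain n where "1 / Suc n < \<bar>f x - g x\<bar>" using nat_approx_posE by blast
      then show False using elim by blast
    qed
  qed
qed

text \<open>The quotient distance between cosets modulo constants, on representatives. One constant
  is enough, since shifting both functions by the same constant does not change
  \<open>ky_fan\<close>.\<close>

definition ky_fan_mod :: "('a \<Rightarrow> real) \<Rightarrow> ('a \<Rightarrow> real) \<Rightarrow> real" where
  "ky_fan_mod f g = (INF c. ky_fan M f (\<lambda>x. g x + c))"

lemma ky_fan_mod_bdd: "bdd_below (range (\<lambda>c. ky_fan M f (\<lambda>x. g x + c)))"
  by (rule bdd_belowI[of _ 0]) (auto simp: ky_fan_nonneg)

lemma ky_fan_mod_nonneg: "0 \<le> ky_fan_mod f g"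
  unfolding ky_fan_mod_def by (rule cINF_greatest) (auto simp: ky_fan_nonneg)

lemma ky_fan_mod_le: "ky_fan_mod f g \<le> ky_fan M f (\<lambda>x. g x + c)"
  unfolding ky_fan_mod_def by (rule cINF_lower[OF ky_fan_mod_bdd]) auto

lemma ky_fan_mod_lessD: "ky_fan_mod f g < e \<Longrightarrow> \<exists>c. ky_fan M f (\<lambda>x. g x + c) < e"
  unfolding ky_fan_mod_def using cINF_less_iff[OF _ ky_fan_mod_bdd] by blast

lemma ky_fan_shift_minus: "ky_fan M f (\<lambda>x. g x + c) = ky_fan M (\<lambda>x. f x - c) g"
  using ky_fan_shift[of "\<lambda>x. f x - c" c g] by simp

lemma ky_fan_mod_commute: "ky_fan_mod f g = ky_fan_mod g f"
proof -
  have "ky_fan_mod f g \<le> ky_fan_mod g f" for f g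
    unfolding ky_fan_mod_def[of g f]
  proof (rule cINF_greatest)
    fix c
    have "ky_fan M g (\<lambda>x. f x + c) = ky_fan M f (\<lambda>x. g x + (-c))"
      using ky_fan_shift_minus[of g f c] ky_fan_commute by simp
    then show "ky_fan_mod f g \<le> ky_fan M g (\<lambda>x. f x + c)" using ky_fan_mod_le[of f g "-c"] by simp
  qed simp
  then show ?thesis by (simp add: antisym)
qed

lemma ky_fan_mod_triangle:
  assumes [measurable]: "f \<in> borel_measurable M" "g \<in> borel_measurable M" "h \<in> borel_measurable M"
  shows "ky_fan_mod f h \<le> ky_fan_mod f g + ky_fan_mod g h"
proof (rule field_le_epsilon)
  fix e :: real assume "e > 0"
  obtain c where c: "ky_fan M f (\<lambda>x. g x + c) < ky_fan_mod f g + e/2"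
    using ky_fan_mod_lessD[of f g "ky_fan_mod f g + e/2"] \<open>e > 0\<close> by auto
  obtain d where d: "ky_fan M g (\<lambda>x. h x + d) < ky_fan_mod g h + e/2"
    using ky_fan_mod_lessD[of g h "ky_fan_mod g h + e/2"] \<open>e > 0\<close> by auto
  have "ky_fan M (\<lambda>x. g x + c) (\<lambda>x. (h x + d) + c) = ky_fan M g (\<lambda>x. h x + d)"
    by (rule ky_fan_shift)
  then have "ky_fan M f (\<lambda>x. h x + (d + c)) \<le> ky_fan M f (\<lambda>x. g x + c) + ky_fan M g (\<lambda>x. h x + d)"
    using ky_fan_triangle[of f "\<lambda>x. g x + c" "\<lambda>x. (h x + d) + c"] by (simp add: algebra_simps)
  then show "ky_fan_mod f h \<le> ky_fan_mod f g + ky_fan_mod g h + e"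
    using c d ky_fan_mod_le[of f h "d + c"] by simp
qed

text \<open>The infimum over constants has to be attained for the quotient distance to separate
  points. Constants \<open>c n\<close> that nearly attain it form a Cauchy sequence, and their limit
  gives Ky Fan distance 0.\<close>

lemma ky_fan_mod_eq_0D:
  assumes [measurable]: "f \<in> borel_measurable M" "g \<in> borel_measurable M" and 0: "ky_fan_mod f g = 0"
  shows "\<exists>c. AE x in M. f x = g x + c"
proof -
  \<comment> \<open>The offset 3 makes every exceptional event have probability below 1/3. Two such
    events cannot cover the space, and a point outside both bounds the difference of the two
    constants.\<close>
  have "\<exists>c. ky_fan M f (\<lambda>x. g x + c) < 1 / real (n + 3)" for n :: nat
    by (rule ky_fan_mod_lessD) (simp add: 0)
  then obtain c where c: "ky_fan M f (\<lambda>x. g x + c n) < 1 / real (n + 3)" for n :: nat by metis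
  have diff: "\<bar>c m - c n\<bar> \<le> 1 / real (m + 3) + 1 / real (n + 3)" for m n
  proof (rule ccontr)
    assume neg: "\<not> ?thesis"
    let ?A = "\<lambda>n. {x\<in>space M. 1 / real (n + 3) < \<bar>f x - (g x + c n)\<bar>}"
    have "prob (?A k) < 1 / real (k + 3)" for k by (intro ky_fan_lessD c) auto
    moreover have "1 / real (k + 3) \<le> 1/3" for k by (simp add: field_simps)
    ultimately have lt: "prob (?A k) < 1/3" for k by (meson less_le_trans)
    have "space M \<subseteq> ?A m \<union> ?A n" using neg by (auto simp: abs_if split: if_splits)
    then have "prob (space M) \<le> prob (?A m \<union> ?A n)" by (intro finite_measure_mono) auto
    also have "\<dots> \<le> prob (?A m) + prob (?A n)" by (intro measure_Un_le) auto
    also have "\<dots> < 1/3 + 1/3" by (intro add_strict_mono lt)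
    finally show False using prob_space by simp
  qed
  have "Cauchy c"
  proof (rule metric_CauchyI)
    fix e :: real assume "e > 0"
    then obtain N where N: "1 / real (Suc N) < e/2" using nat_approx_posE[of "e/2"] by auto
    have b: "1 / real (n + 3) < e/2" if "n \<ge> N" for n
    proof -
      have "1 / real (n + 3) \<le> 1 / real (Suc N)" using that by (intro divide_left_mono) auto
      then show ?thesis using N by linarith
    qed
    have "dist (c m) (c n) < e" if "m \<ge> N" "n \<ge> N" for m n
      using diff[of m n] b[OF that(1)] b[OF that(2)] unfolding dist_real_def by linarith
    then show "\<exists>N. \<forall>m\<ge>N. \<forall>n\<ge>N. dist (c m) (c n) < e" by blast
  qed
  then obtain C where C: "c \<longlonglongrightarrow> C" using Cauchy_convergent_iff convergent_def by blast
  have "ky_fan M f (\<lambda>x. g x + C) = 0"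
  proof (rule antisym[OF _ ky_fan_nonneg], rule field_le_epsilon)
    fix e :: real assume "e > 0"
    have "eventually (\<lambda>n. \<bar>c n - C\<bar> < e/2) sequentially"
      using tendstoD[OF C, of "e/2"] \<open>e > 0\<close> by (simp add: dist_real_def)
    moreover have "eventually (\<lambda>n. 1 / real (n + 3) < e/2) sequentially"
      using \<open>e > 0\<close> by real_asymp
    ultimately have "eventually (\<lambda>n. \<bar>c n - C\<bar> < e/2 \<and> 1 / real (n + 3) < e/2) sequentially"
      by (rule eventually_conj)
    then obtain n where n: "\<bar>c n - C\<bar> < e/2" "1 / real (n + 3) < e/2"
      using eventually_happens'[OF sequentially_bot] by blast
    have "ky_fan M (\<lambda>x. g x + c n) (\<lambda>x. g x + C) \<le> e/2"
      using n \<open>e > 0\<close> by (intro ky_fan_le) auto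
    then show "ky_fan M f (\<lambda>x. g x + C) \<le> 0 + e"
      using ky_fan_triangle[of f "\<lambda>x. g x + c n" "\<lambda>x. g x + C"] c[of n] n by simp
  qed
  then show ?thesis using ky_fan_eq_0D[of f "\<lambda>x. g x + C"] by auto
qed

section \<open>Passage from representatives to the quotient metric space\<close>

definition ae_class :: "('a \<Rightarrow> real) \<Rightarrow> ('a \<Rightarrow> real) set" where
  "ae_class f = ae_rel M `` {f}"

definition shift_class :: "('a \<Rightarrow> real) \<Rightarrow> ('a \<Rightarrow> real) set set" where
  "shift_class f = shift_rel M `` {ae_class f}"

lemma equiv_ae_rel: "equiv (borel_measurable M) (ae_rel M)"
proof (rule equivI)
  show "sym (ae_rel M)" by (auto intro!: symI simp: ae_rel_def)
  show "trans (ae_rel M)"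
    by (rule transI) (auto simp: ae_rel_def)
qed (auto simp: ae_rel_def refl_on_def)

lemma ae_class_eq_iff:
  "f \<in> borel_measurable M \<Longrightarrow> g \<in> borel_measurable M \<Longrightarrow>
    ae_class f = ae_class g \<longleftrightarrow> (AE x in M. f x = g x)"
  unfolding ae_class_def using eq_equiv_class_iff[OF equiv_ae_rel] by (auto simp: ae_rel_def)

lemma mem_ae_class: "g \<in> ae_class f \<longleftrightarrow>
    f \<in> borel_measurable M \<and> g \<in> borel_measurable M \<and> (AE x in M. f x = g x)"
  unfolding ae_class_def by (auto simp: ae_rel_def)

lemma L0_iff: "a \<in> L0 M \<longleftrightarrow> (\<exists>f\<in>borel_measurable M. a = ae_class f)"
  unfolding L0_def ae_class_def by (auto simp: quotient_def)

lemma L0_dist_ae_class: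
  assumes [measurable]: "f \<in> borel_measurable M" "g \<in> borel_measurable M"
  shows "L0_dist M (ae_class f) (ae_class g) = ky_fan M f g"
proof -
  have s: "(SOME h. h \<in> ae_class f') \<in> ae_class f'" if "f' \<in> borel_measurable M" for f'
    by (rule someI[of _ f']) (simp add: mem_ae_class that)
  show ?thesis
    unfolding L0_dist_def using s[of f] s[of g]
    by (intro ky_fan_cong) (auto simp: mem_ae_class)
qed

lemma shift_image_ae_class:
  assumes [measurable]: "f \<in> borel_measurable M"
  shows "(\<lambda>f x. f x + c) ` ae_class f = ae_class (\<lambda>x. f x + c)"
proof (intro equalityI subsetI)
  fix g assume g: "g \<in> ae_class (\<lambda>x. f x + c)"
  then have "(\<lambda>x. g x - c) \<in> ae_class f" by (auto simp: mem_ae_class)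
  then show "g \<in> (\<lambda>f x. f x + c) ` ae_class f" by (intro image_eqI[of _ _ "\<lambda>x. g x - c"]) auto
qed (auto simp: mem_ae_class)

lemma shift_rel_iff:
  assumes [measurable]: "f \<in> borel_measurable M"
  shows "(ae_class f, b) \<in> shift_rel M \<longleftrightarrow> (\<exists>c. b = ae_class (\<lambda>x. f x + c))"
  unfolding shift_rel_def by (auto simp: shift_image_ae_class L0_iff intro!: bexI)

lemma equiv_shift_rel: "equiv (L0 M) (shift_rel M)"
proof (rule equivI)
  show "shift_rel M \<subseteq> L0 M \<times> L0 M" by (auto simp: shift_rel_def)
  show "refl_on (L0 M) (shift_rel M)"
  proof (rule refl_onI)
    fix a assume "a \<in> L0 M"
    then obtain f where "f \<in> borel_measurable M" "a = ae_class f" by (auto simp: L0_iff)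
    then show "(a, a) \<in> shift_rel M" by (auto simp: shift_rel_iff intro!: exI[of _ 0])
  qed
  show "sym (shift_rel M)"
  proof (rule symI)
    fix a b assume ab: "(a, b) \<in> shift_rel M"
    then obtain f where f: "f \<in> borel_measurable M" "a = ae_class f" by (auto simp: L0_iff shift_rel_def)
    then obtain c where b: "b = ae_class (\<lambda>x. f x + c)" using ab shift_rel_iff by auto
    show "(b, a) \<in> shift_rel M" unfolding b using f by (subst shift_rel_iff) (auto intro!: exI[of _ "-c"])
  qed
  show "trans (shift_rel M)"
  proof (rule transI)
    fix a b e assume ab: "(a, b) \<in> shift_rel M" "(b, e) \<in> shift_rel M"
    then obtain f where f: "f \<in> borel_measurable M" "a = ae_class f" by (auto simp: L0_iff shift_rel_def)
    then obtain c where b: "b = ae_class (\<lambda>x. f x + c)" using ab shift_rel_iff by auto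
    obtain c' where e: "e = ae_class (\<lambda>x. f x + c + c')" using ab(2) f unfolding b by (subst (asm) shift_rel_iff) auto
    show "(a, e) \<in> shift_rel M" unfolding e f(2) using f(1)
      by (subst shift_rel_iff) (auto intro!: exI[of _ "c + c'"] simp: algebra_simps)
  qed
qed

lemma mem_shift_class:
  assumes "f \<in> borel_measurable M"
  shows "a \<in> shift_class f \<longleftrightarrow> (\<exists>c. a = ae_class (\<lambda>x. f x + c))"
  using shift_rel_iff[OF assms] by (simp add: shift_class_def)

lemma L0_mod_R_eq: "L0_mod_R M = shift_class ` borel_measurable M"
  unfolding L0_mod_R_def quotient_def shift_class_def by (fastforce simp: L0_iff)

lemma shift_class_eq_iff:
  assumes [measurable]: "f \<in> borel_measurable M" "g \<in> borel_measurable M"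
  shows "shift_class f = shift_class g \<longleftrightarrow> (\<exists>c. AE x in M. f x = g x + c)"
proof -
  have "shift_class f = shift_class g \<longleftrightarrow> (ae_class g, ae_class f) \<in> shift_rel M"
    unfolding shift_class_def using eq_equiv_class_iff[OF equiv_shift_rel, of "ae_class g" "ae_class f"]
      assms L0_iff[of "ae_class f"] L0_iff[of "ae_class g"] by metis
  then show ?thesis by (simp add: shift_rel_iff ae_class_eq_iff)
qed

text \<open>Members of the two cosets carry independent shifts \<open>c\<close> and
  \<open>d\<close>, but the distance only sees \<open>d - c\<close>. The double infimum is therefore
  the single one of \<open>ky_fan_mod\<close>.\<close>

lemma L0_mod_R_dist_shift_class:
  assumes [measurable]: "f \<in> borel_measurable M" "g \<in> borel_measurable M"
  shows "L0_mod_R_dist M (shift_class f) (shift_class g) = ky_fan_mod f g"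
proof -
  have "{L0_dist M a b |a b. a \<in> shift_class f \<and> b \<in> shift_class g} = range (\<lambda>c. ky_fan M f (\<lambda>x. g x + c))"
  proof (intro equalityI subsetI)
    fix t assume "t \<in> {L0_dist M a b |a b. a \<in> shift_class f \<and> b \<in> shift_class g}"
    then obtain c d where "t = L0_dist M (ae_class (\<lambda>x. f x + c)) (ae_class (\<lambda>x. g x + d))"
      by (auto simp: mem_shift_class)
    then have "t = ky_fan M (\<lambda>x. f x + c) (\<lambda>x. (g x + (d - c)) + c)" by (simp add: L0_dist_ae_class)
    then have "t = ky_fan M f (\<lambda>x. g x + (d - c))" by (simp only: ky_fan_shift)
    then show "t \<in> range (\<lambda>c. ky_fan M f (\<lambda>x. g x + c))" by blast
  next
    fix t assume "t \<in> range (\<lambda>c. ky_fan M f (\<lambda>x. g x + c))"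
    then obtain c where "t = ky_fan M f (\<lambda>x. g x + c)" by blast
    then have "t = L0_dist M (ae_class f) (ae_class (\<lambda>x. g x + c))" by (simp add: L0_dist_ae_class)
    moreover have "ae_class f \<in> shift_class f" by (simp add: mem_shift_class exI[of _ 0])
    moreover have "ae_class (\<lambda>x. g x + c) \<in> shift_class g" by (auto simp: mem_shift_class)
    ultimately show "t \<in> {L0_dist M a b |a b. a \<in> shift_class f \<and> b \<in> shift_class g}" by blast
  qed
  then show ?thesis using assms by (simp add: L0_mod_R_dist_def ky_fan_mod_def L0_mod_R_eq)
qed

lemma Metric_space_L0_mod_R: "Metric_space (L0_mod_R M) (L0_mod_R_dist M)"
proof
  show nn: "0 \<le> L0_mod_R_dist M A B" for A B
  proof (cases "A \<in> L0_mod_R M \<and> B \<in> L0_mod_R M")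
    case True
    then show ?thesis by (auto simp: L0_mod_R_eq L0_mod_R_dist_shift_class ky_fan_mod_nonneg)
  qed (simp only: L0_mod_R_dist_def if_False)
  show "L0_mod_R_dist M A B = L0_mod_R_dist M B A" for A B
  proof (cases "A \<in> L0_mod_R M \<and> B \<in> L0_mod_R M")
    case True
    then obtain f g where "f \<in> borel_measurable M" "g \<in> borel_measurable M" "A = shift_class f" "B = shift_class g"
      by (auto simp: L0_mod_R_eq)
    then show ?thesis by (simp add: L0_mod_R_dist_shift_class ky_fan_mod_commute[of f g])
  next
    case False
    then have "\<not> (B \<in> L0_mod_R M \<and> A \<in> L0_mod_R M)" by blast
    then show ?thesis using False by (simp only: L0_mod_R_dist_def if_False)
  qed
  show "L0_mod_R_dist M A B = 0 \<longleftrightarrow> A = B" if "A \<in> L0_mod_R M" "B \<in> L0_mod_R M" for A B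
  proof -
    obtain f g where [measurable]: "f \<in> borel_measurable M" "g \<in> borel_measurable M"
      and AB: "A = shift_class f" "B = shift_class g"
      using \<open>A \<in> L0_mod_R M\<close> \<open>B \<in> L0_mod_R M\<close> by (auto simp: L0_mod_R_eq)
    have "ky_fan_mod f g = 0 \<longleftrightarrow> (\<exists>c. AE x in M. f x = g x + c)"
    proof
      assume "\<exists>c. AE x in M. f x = g x + c"
      then obtain c where c: "AE x in M. f x = g x + c" by blast
      have "ky_fan M f (\<lambda>x. g x + c) = ky_fan M f f"
        using c by (intro ky_fan_cong) auto
      also have "\<dots> \<le> e" if "e > 0" for e using that by (intro ky_fan_le) auto
      finally have "ky_fan M f (\<lambda>x. g x + c) \<le> 0" by (rule field_le_epsilon) simp
      then show "ky_fan_mod f g = 0"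
        using ky_fan_mod_le[of f g c] ky_fan_mod_nonneg[of f g] by simp
    qed (rule ky_fan_mod_eq_0D; measurable)
    then show ?thesis by (simp add: AB L0_mod_R_dist_shift_class shift_class_eq_iff)
  qed
  show "L0_mod_R_dist M A C \<le> L0_mod_R_dist M A B + L0_mod_R_dist M B C"
    if "A \<in> L0_mod_R M" "B \<in> L0_mod_R M" "C \<in> L0_mod_R M" for A B C
    using that by (auto simp: L0_mod_R_eq L0_mod_R_dist_shift_class ky_fan_mod_triangle)
qed

text \<open>Dominated convergence for the indicators of the exceptional events, which vanish
  eventually at every point of convergence.\<close>

lemma AE_tendsto_imp_prob_tendsto_0:
  fixes h :: "nat \<Rightarrow> 'a \<Rightarrow> real"
  assumes [measurable]: "\<And>n. h n \<in> borel_measurable M" "g \<in> borel_measurable M"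
    and lim: "AE x in M. (\<lambda>n. h n x) \<longlonglongrightarrow> g x" and e: "e > 0"
  shows "(\<lambda>n. prob {x\<in>space M. e < \<bar>h n x - g x\<bar>}) \<longlonglongrightarrow> 0"
proof -
  have "(\<lambda>n. \<integral>x. indicat_real {x\<in>space M. e < \<bar>h n x - g x\<bar>} x \<partial>M) \<longlonglongrightarrow> (\<integral>x. (0::real) \<partial>M)"
  proof (rule integral_dominated_convergence[where w="\<lambda>_. 1"])
    show "AE x in M. (\<lambda>n. indicator {x\<in>space M. e < \<bar>h n x - g x\<bar>} x :: real) \<longlonglongrightarrow> 0"
      using lim
    proof eventually_elim
      case (elim x)
      have "eventually (\<lambda>n. dist (h n x) (g x) < e) sequentially"
        using tendstoD[OF elim e] .
      then have "eventually (\<lambda>n. indicator {x\<in>space M. e < \<bar>h n x - g x\<bar>} x = (0::real)) sequentially"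
        by eventually_elim (auto simp: dist_real_def indicator_def)
      then show ?case by (rule tendsto_eventually)
    qed
  qed (auto simp: indicator_def)
  then show ?thesis by simp
qed

end

section \<open>Sequential criteria for concentration in terms of representatives\<close>

definition ae_Lip1 :: "'a emm \<Rightarrow> ('a \<Rightarrow> real) set" where
  "ae_Lip1 X = {f \<in> borel_measurable (emm_meas X).
     \<exists>E\<in>sets (emm_meas X). emeasure (emm_meas X) E = 1 \<and>
        (\<forall>x\<in>E. \<forall>y\<in>E. ennreal \<bar>f x - f y\<bar> \<le> emm_dist X x y)}"

lemma (in prob_space) Lip1_mod_R_eq:
  assumes "emm_meas X = M"
  shows "Lip1_mod_R X = shift_class ` ae_Lip1 X"
  unfolding Lip1_mod_R_def Lip1_def ae_Lip1_def quotient_def shift_class_def ae_class_def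
  using assms by auto

text \<open>In a metric space compactness is sequential compactness. Almost everywhere convergence
  after subtracting some constants \<open>c n\<close> is enough, because \<open>ky_fan_mod\<close>
  is an infimum over all constants.\<close>

lemma concentratedI:
  assumes P: "prob_space (emm_meas X)"
    and seq: "\<And>f :: nat \<Rightarrow> 'a \<Rightarrow> real. (\<And>n. f n \<in> ae_Lip1 X) \<Longrightarrow>
      \<exists>r c g. strict_mono r \<and> g \<in> ae_Lip1 X \<and>
        (AE x in emm_meas X. (\<lambda>n. f (r n) x - c n) \<longlonglongrightarrow> g x)"
  shows "concentrated X"
proof -
  let ?M = "emm_meas X"
  interpret prob_space ?M by fact
  interpret L: Metric_space "L0_mod_R ?M" "L0_mod_R_dist ?M" by (rule Metric_space_L0_mod_R)
  have sub: "ae_Lip1 X \<subseteq> borel_measurable ?M" by (auto simp: ae_Lip1_def)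
  show ?thesis
    unfolding concentrated_def L.compactin_sequentially Lip1_mod_R_eq[OF refl]
  proof (intro conjI allI impI)
    show "shift_class ` ae_Lip1 X \<subseteq> L0_mod_R ?M" using sub by (auto simp: L0_mod_R_eq)
    fix s :: "nat \<Rightarrow> _" assume "range s \<subseteq> shift_class ` ae_Lip1 X"
    then have "\<forall>n. \<exists>f. f \<in> ae_Lip1 X \<and> s n = shift_class f" by (auto simp: image_subset_iff)
    then obtain f where f: "\<And>n. f n \<in> ae_Lip1 X" "\<And>n. s n = shift_class (f n)" by metis
    obtain r c g where r: "strict_mono (r :: nat \<Rightarrow> nat)" "g \<in> ae_Lip1 X"
      and lim: "AE x in ?M. (\<lambda>n. f (r n) x - c n) \<longlonglongrightarrow> g x" using seq[of f, OF f(1)] by blast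
    have [measurable]: "f n \<in> borel_measurable ?M" "g \<in> borel_measurable ?M" for n using f r sub by auto
    have "(\<lambda>n. L0_mod_R_dist ?M (s (r n)) (shift_class g)) \<longlonglongrightarrow> 0"
    proof (rule LIMSEQ_I)
      fix e :: real assume "e > 0"
      have 0: "(\<lambda>n. prob {x\<in>space ?M. e/2 < \<bar>(f (r n) x - c n) - g x\<bar>}) \<longlonglongrightarrow> 0"
        using \<open>e > 0\<close> by (intro AE_tendsto_imp_prob_tendsto_0 lim) auto
      have "eventually (\<lambda>n. prob {x\<in>space ?M. e/2 < \<bar>(f (r n) x - c n) - g x\<bar>} < e/2) sequentially"
        using order_tendstoD(2)[OF 0, of "e/2"] \<open>e > 0\<close> by simp
      then obtain N where N: "\<And>n. n \<ge> N \<Longrightarrow> prob {x\<in>space ?M. e/2 < \<bar>(f (r n) x - c n) - g x\<bar>} < e/2"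
        by (auto simp: eventually_sequentially)
      have "L0_mod_R_dist ?M (s (r n)) (shift_class g) \<le> e/2" if "n \<ge> N" for n
      proof -
        have "ky_fan_mod (f (r n)) g \<le> ky_fan ?M (f (r n)) (\<lambda>x. g x + c n)" by (rule ky_fan_mod_le)
        also have "\<dots> = ky_fan ?M (\<lambda>x. f (r n) x - c n) g" by (rule ky_fan_shift_minus)
        also have "\<dots> \<le> e/2" using N[OF that] \<open>e > 0\<close> by (intro ky_fan_le) auto
        finally show ?thesis by (simp add: f(2) L0_mod_R_dist_shift_class)
      qed
      then show "\<exists>N. \<forall>n\<ge>N. norm (L0_mod_R_dist ?M (s (r n)) (shift_class g) - 0) < e"
        using \<open>e > 0\<close> by (intro exI[of _ N]) (force simp: abs_of_nonneg)
    qed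
    then have "limitin L.mtopology (s \<circ> r) (shift_class g) sequentially"
      unfolding L.limitin_metric_dist_null using f sub r by (auto simp: L0_mod_R_eq intro!: always_eventually)
    then show "\<exists>l r. l \<in> shift_class ` ae_Lip1 X \<and> strict_mono r \<and> limitin L.mtopology (s \<circ> r) l sequentially"
      using r by blast
  qed
qed

text \<open>Two late members of a convergent subsequence would be at quotient distance below
  \<open>\<epsilon>\<close>; by the strict bound in \<open>ky_fan_lessD\<close>, some constant would
  then violate the separation.\<close>

lemma not_concentratedI:
  assumes P: "prob_space (emm_meas X)" and f: "\<And>n :: nat. f n \<in> ae_Lip1 X" and "\<epsilon> > 0"
    and sep: "\<And>m n c. m \<noteq> n \<Longrightarrow>
      measure (emm_meas X) {x\<in>space (emm_meas X). \<epsilon> < \<bar>f m x - (f n x + c)\<bar>} \<ge> \<epsilon>"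
  shows "\<not> concentrated X"
proof
  let ?M = "emm_meas X"
  interpret prob_space ?M by fact
  interpret L: Metric_space "L0_mod_R ?M" "L0_mod_R_dist ?M" by (rule Metric_space_L0_mod_R)
  assume "concentrated X"
  then have "range (\<lambda>n. shift_class (f n)) \<subseteq> shift_class ` ae_Lip1 X \<longrightarrow>
    (\<exists>l r. l \<in> shift_class ` ae_Lip1 X \<and> strict_mono r \<and> limitin L.mtopology ((\<lambda>n. shift_class (f n)) \<circ> r) l sequentially)"
    unfolding concentrated_def L.compactin_sequentially Lip1_mod_R_eq[OF refl] by blast
  then obtain l r where r: "strict_mono (r :: nat \<Rightarrow> nat)"
    "limitin L.mtopology ((\<lambda>n. shift_class (f n)) \<circ> r) l sequentially" using f by auto
  have [measurable]: "f n \<in> borel_measurable ?M" for n using f by (auto simp: ae_Lip1_def)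
  have L: "l \<in> L0_mod_R ?M" and lim: "(\<lambda>n. L0_mod_R_dist ?M (shift_class (f (r n))) l) \<longlonglongrightarrow> 0"
    using r(2) by (auto simp: L.limitin_metric_dist_null)
  have "eventually (\<lambda>n. L0_mod_R_dist ?M (shift_class (f (r n))) l < \<epsilon>/2) sequentially"
    using order_tendstoD(2)[OF lim, of "\<epsilon>/2"] \<open>\<epsilon> > 0\<close> by simp
  then obtain N where N: "\<And>n. n \<ge> N \<Longrightarrow> L0_mod_R_dist ?M (shift_class (f (r n))) l < \<epsilon>/2"
    by (auto simp: eventually_sequentially)
  have ne: "r N \<noteq> r (Suc N)" using r(1) by (metis n_not_Suc_n strict_mono_eq)
  have "L0_mod_R_dist ?M (shift_class (f (r N))) (shift_class (f (r (Suc N)))) \<le>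
    L0_mod_R_dist ?M (shift_class (f (r N))) l + L0_mod_R_dist ?M l (shift_class (f (r (Suc N))))"
    using L by (intro L.triangle) (auto simp: L0_mod_R_eq)
  also have "\<dots> < \<epsilon>" using N[of N] N[of "Suc N"] L.commute[of l] by auto
  finally have "ky_fan_mod (f (r N)) (f (r (Suc N))) < \<epsilon>" by (simp add: L0_mod_R_dist_shift_class)
  then obtain c where "ky_fan ?M (f (r N)) (\<lambda>x. f (r (Suc N)) x + c) < \<epsilon>" using ky_fan_mod_lessD by blast
  then have "prob {x\<in>space ?M. \<epsilon> < \<bar>f (r N) x - (f (r (Suc N)) x + c)\<bar>} < \<epsilon>"
    by (intro ky_fan_lessD) auto
  then show False using sep[OF ne, of c] by simp
qed

section \<open>Property tau of Gaussian measures\<close>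

text \<open>Tonelli for the region under the graph. The condition \<open>0 < t\<close> stays inside
  the set because \<open>t\<close> runs over the whole line.\<close>

lemma nn_integral_layer_cake:
  fixes f :: "real \<Rightarrow> real"
  assumes [measurable]: "f \<in> borel_measurable borel" and nonneg: "\<And>x. 0 \<le> f x"
  shows "(\<integral>\<^sup>+x. ennreal (f x) \<partial>lborel) = (\<integral>\<^sup>+t. emeasure lborel {x. 0 < t \<and> t < f x} \<partial>lborel)"
proof -
  have "(\<integral>\<^sup>+x. ennreal (f x) \<partial>lborel) = (\<integral>\<^sup>+x. (\<integral>\<^sup>+t. indicator {(x, t). 0 < t \<and> t < f x} (x, t) \<partial>lborel) \<partial>lborel)"
  proof (rule nn_integral_cong)
    fix x
    have "(\<integral>\<^sup>+t. indicator {(x, t). 0 < t \<and> t < f x} (x, t) \<partial>lborel) = (\<integral>\<^sup>+t. indicator {0<..<f x} t \<partial>lborel)"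
      by (intro nn_integral_cong) (auto simp: indicator_def)
    then show "ennreal (f x) = (\<integral>\<^sup>+t. indicator {(x, t). 0 < t \<and> t < f x} (x, t) \<partial>lborel)"
      using nonneg[of x] by simp
  qed
  also have "\<dots> = (\<integral>\<^sup>+t. (\<integral>\<^sup>+x. indicator {(x, t). 0 < t \<and> t < f x} (x, t) \<partial>lborel) \<partial>lborel)"
    by (rule lborel_pair.Fubini'[symmetric]) measurable
  also have "\<dots> = (\<integral>\<^sup>+t. emeasure lborel {x. 0 < t \<and> t < f x} \<partial>lborel)"
  proof (rule nn_integral_cong)
    fix t
    have "(\<integral>\<^sup>+x. indicator {(x, t). 0 < t \<and> t < f x} (x, t) \<partial>lborel) =
      (\<integral>\<^sup>+x. indicator {x. 0 < t \<and> t < f x} x \<partial>lborel)"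
      by (intro nn_integral_cong) (auto simp: indicator_def)
    then show "(\<integral>\<^sup>+x. indicator {(x, t). 0 < t \<and> t < f x} (x, t) \<partial>lborel) = emeasure lborel {x. 0 < t \<and> t < f x}"
      by simp
  qed
  finally show ?thesis .
qed

lemma emeasure_lborel_le_diam:
  fixes S :: "real set"
  assumes "S \<noteq> {}" "bdd_below S" "bdd_above S"
  shows "emeasure lborel S \<le> ennreal (Sup S - Inf S)"
proof -
  have "S \<subseteq> {Inf S..Sup S}" using assms by (auto intro: cInf_lower cSup_upper)
  then have "emeasure lborel S \<le> emeasure lborel {Inf S..Sup S}" by (intro emeasure_mono) auto
  then show ?thesis using cInf_le_cSup[OF assms(1,3,2)] by simp
qed

text \<open>One-dimensional Brunn-Minkowski with an interval \<open>U\<close> around the sumset. As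
  \<open>U\<close> is order-convex, it contains everything strictly between
  \<open>Inf S + Inf T\<close> and \<open>Sup S + Sup T\<close>, while \<open>S\<close> and
  \<open>T\<close> are no larger than their diameters.\<close>

lemma emeasure_sumset_interval:
  fixes S T U :: "real set"
  assumes ne: "S \<noteq> {}" "T \<noteq> {}" and U: "is_interval U" "bounded U" "U \<in> sets borel"
    and sub: "\<And>x y. x \<in> S \<Longrightarrow> y \<in> T \<Longrightarrow> x + y \<in> U"
  shows "emeasure lborel S + emeasure lborel T \<le> emeasure lborel U"
proof -
  obtain a b where ab: "U \<subseteq> {a..b}" using bounded_subset_cbox_symmetric[OF U(2)] by (metis cbox_interval)
  obtain x0 y0 where xy0: "x0 \<in> S" "y0 \<in> T" using ne by auto
  have bd: "bdd_below S" "bdd_above S" "bdd_below T" "bdd_above T"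
    using ab sub xy0 by (force intro!: bdd_belowI[of S "a - y0"] bdd_aboveI[of S "b - y0"]
      bdd_belowI[of T "a - x0"] bdd_aboveI[of T "b - x0"])+
  have "{Inf S + Inf T<..<Sup S + Sup T} \<subseteq> U"
  proof
    fix u assume u: "u \<in> {Inf S + Inf T<..<Sup S + Sup T}"
    \<comment> \<open>Half the distance of \<open>u\<close> to the nearer end, so that an error of
      \<open>e\<close> in each of the two summands still leaves \<open>u\<close> between a lower and
      an upper sum.\<close>
    define e where "e = min (u - (Inf S + Inf T)) (Sup S + Sup T - u) / 2"
    have e: "e > 0" using u by (auto simp: e_def)
    have ee: "Inf S + Inf T + 2 * e \<le> u" "u + 2 * e \<le> Sup S + Sup T" by (auto simp: e_def min_def field_simps)
    obtain x1 where x1: "x1 \<in> S" "x1 < Inf S + e" using cInf_lessD[OF ne(1), of "Inf S + e"] e by auto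
    obtain y1 where y1: "y1 \<in> T" "y1 < Inf T + e" using cInf_lessD[OF ne(2), of "Inf T + e"] e by auto
    obtain x2 where x2: "x2 \<in> S" "Sup S - e < x2" using less_cSupD[OF ne(1), of "Sup S - e"] e by auto
    obtain y2 where y2: "y2 \<in> T" "Sup T - e < y2" using less_cSupD[OF ne(2), of "Sup T - e"] e by auto
    have "x1 + y1 \<in> U" "x2 + y2 \<in> U" using sub x1 y1 x2 y2 by auto
    moreover have "x1 + y1 \<le> u" "u \<le> x2 + y2" using x1 y1 x2 y2 ee by linarith+
    ultimately show "u \<in> U" using U(1) unfolding is_interval_1 by blast
  qed
  then have "emeasure lborel {Inf S + Inf T<..<Sup S + Sup T} \<le> emeasure lborel U"
    using U(3) by (intro emeasure_mono) auto
  moreover have "Inf S \<le> Sup S" "Inf T \<le> Sup T" using ne bd by (auto intro: cInf_le_cSup)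
  moreover have "emeasure lborel S + emeasure lborel T \<le> ennreal (Sup S - Inf S) + ennreal (Sup T - Inf T)"
    using ne bd by (intro add_mono emeasure_lborel_le_diam) auto
  ultimately show ?thesis by (simp add: ennreal_plus[symmetric] algebra_simps del: ennreal_plus)
qed

abbreviation gauss :: "real \<Rightarrow> real measure" where
  "gauss s \<equiv> density lborel (\<lambda>x. ennreal (normal_density 0 s x))"

lemma nn_integral_exp_square:
  assumes "s > 0"
  shows "(\<integral>\<^sup>+x. ennreal (exp (- x\<^sup>2 / (2 * s\<^sup>2))) \<partial>lborel) = ennreal (s * sqrt (2 * pi))"
proof -
  have "(\<integral>\<^sup>+x. ennreal (exp (- x\<^sup>2 / (2 * s\<^sup>2))) \<partial>lborel)
      = (\<integral>\<^sup>+x. ennreal (s * sqrt (2 * pi)) * ennreal (normal_density 0 s x) \<partial>lborel)"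
    using assms by (intro nn_integral_cong)
      (simp add: normal_density_def ennreal_mult[symmetric] real_sqrt_mult divide_simps)
  also have "\<dots> = ennreal (s * sqrt (2 * pi)) * (\<integral>\<^sup>+x. ennreal (normal_density 0 s x) \<partial>lborel)"
    by (rule nn_integral_cmult) measurable
  also have "(\<integral>\<^sup>+x. ennreal (normal_density 0 s x) \<partial>lborel) = 1"
    using prob_space.emeasure_space_1[OF prob_space_normal_density[OF assms, of 0]]
    by (simp add: emeasure_density)
  finally show ?thesis by simp
qed

text \<open>Having supremum 1, \<open>f\<close> and \<open>g\<close> have nonempty superlevel sets
  at exactly the same heights below 1, as the sumset estimate demands. Their sum lies in the
  superlevel set of \<open>h\<close>, an interval because \<open>h\<close> is even and decreasing in
  the modulus; integrating over the heights gives a bound for the sum of the integrals.\<close>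

lemma prekopa_leindler_gauss_normalized:
  fixes f g :: "real \<Rightarrow> real"
  assumes s: "s > 0" and C: "C > 0"
    and [measurable]: "f \<in> borel_measurable borel" "g \<in> borel_measurable borel"
    and f: "\<And>x. 0 \<le> f x" "\<And>x. f x \<le> 1" "\<And>t. t < 1 \<Longrightarrow> \<exists>x. t < f x"
    and g: "\<And>x. 0 \<le> g x" "\<And>x. g x \<le> 1" "\<And>t. t < 1 \<Longrightarrow> \<exists>x. t < g x"
    and fg: "\<And>x y. f x * g y * C\<^sup>2 \<le> exp (- (x + y)\<^sup>2 / (4 * s\<^sup>2))"
  shows "(\<integral>\<^sup>+x. f x \<partial>lborel) + (\<integral>\<^sup>+x. g x \<partial>lborel) \<le> ennreal (2 * s * sqrt (2 * pi) / C)"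
proof -
  \<comment> \<open>The square root of the right-hand side of \<open>fg\<close>, divided by
    \<open>C\<close>: if \<open>f x\<close> and \<open>g y\<close> exceed \<open>t\<close>, then so
    does \<open>h (x + y)\<close>. Its width is \<open>2 * s\<close>, which is the source of the
    factor 2 in the bound.\<close>
  define h where "h u = exp (- u\<^sup>2 / (2 * (2 * s)\<^sup>2)) / C" for u
  have [measurable]: "h \<in> borel_measurable borel" unfolding h_def by measurable
  have h2: "exp (- u\<^sup>2 / (4 * s\<^sup>2)) = (h u * C)\<^sup>2" for u
    using C by (simp add: h_def power2_eq_square exp_add[symmetric] field_simps)
  have h_mono: "h u \<le> h v" if "\<bar>v\<bar> \<le> \<bar>u\<bar>" for u v
  proof -
    have "v\<^sup>2 \<le> u\<^sup>2" using that by (simp add: abs_le_square_iff)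
    then show ?thesis using C s by (simp add: h_def divide_right_mono)
  qed
  have lev: "emeasure lborel {x. 0 < t \<and> t < f x} + emeasure lborel {x. 0 < t \<and> t < g x} \<le>
      emeasure lborel {x. 0 < t \<and> t < h x}" for t
  proof (cases "0 < t \<and> t < 1")
    case False
    then have "{x. 0 < t \<and> t < f x} = {}" "{x. 0 < t \<and> t < g x} = {}"
      using f(2) g(2) by (auto simp: not_less intro: order_trans)
    then show ?thesis by (simp only: emeasure_empty) simp
  next
    case True
    show ?thesis
    proof (rule emeasure_sumset_interval)
      show "{x. 0 < t \<and> t < f x} \<noteq> {}" "{x. 0 < t \<and> t < g x} \<noteq> {}" using True f(3) g(3) by auto
      show "is_interval {x. 0 < t \<and> t < h x}"
        unfolding is_interval_1
      proof (intro ballI allI impI)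
        fix a b x assume ab: "a \<in> {x. 0 < t \<and> t < h x}" "b \<in> {x. 0 < t \<and> t < h x}" "a \<le> x \<and> x \<le> b"
        have "\<bar>x\<bar> \<le> \<bar>a\<bar> \<or> \<bar>x\<bar> \<le> \<bar>b\<bar>" using ab(3) by linarith
        then show "x \<in> {x. 0 < t \<and> t < h x}" using h_mono ab by force
      qed
      show "bounded {x. 0 < t \<and> t < h x}"
      proof (rule boundedI)
        fix u assume "u \<in> {x. 0 < t \<and> t < h x}"
        then have "t * C < exp (- u\<^sup>2 / (2 * (2 * s)\<^sup>2))" using C by (simp add: h_def pos_less_divide_eq)
        then have "ln (t * C) < - u\<^sup>2 / (2 * (2 * s)\<^sup>2)"
          using True C by (subst ln_exp[symmetric], subst ln_less_cancel_iff) auto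
        moreover define k where "k = 2 * (2 * s)\<^sup>2"
        moreover have "k > 0" using s by (simp add: k_def)
        ultimately have "ln (t * C) < - u\<^sup>2 / k" "k > 0" by blast+
        then have "ln (t * C) * k < - u\<^sup>2" by (metis pos_less_divide_eq)
        then have "u\<^sup>2 < - ln (t * C) * k" by linarith
        moreover have "(\<bar>u\<bar> - 1)\<^sup>2 \<ge> 0" by simp
        then have "\<bar>u\<bar> \<le> 1 + u\<^sup>2" unfolding power2_diff by simp
        ultimately show "norm u \<le> 1 + - ln (t * C) * (2 * (2 * s)\<^sup>2)"
          unfolding k_def real_norm_def by linarith
      qed
      show "{x. 0 < t \<and> t < h x} \<in> sets borel" by measurable
      fix x y assume xy: "x \<in> {x. 0 < t \<and> t < f x}" "y \<in> {x. 0 < t \<and> t < g x}"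
      have "t * t < f x * g y" using xy True by (intro mult_strict_mono) auto
      then have "t * t * C\<^sup>2 < f x * g y * C\<^sup>2" using C by (intro mult_strict_right_mono) auto
      also have "\<dots> \<le> (h (x + y) * C)\<^sup>2" using fg[of x y] unfolding h2 .
      finally have "(t * C)\<^sup>2 < (h (x + y) * C)\<^sup>2" by (simp only: power2_eq_square ac_simps)
      moreover have "0 \<le> h (x + y) * C" using C by (simp add: h_def)
      ultimately have "t * C < h (x + y) * C" by (rule power2_less_imp_less)
      then have "t < h (x + y)" using C by (simp only: mult_less_cancel_right_pos)
      then show "x + y \<in> {x. 0 < t \<and> t < h x}" using True by simp
    qed
  qed
  have "(\<integral>\<^sup>+x. f x \<partial>lborel) + (\<integral>\<^sup>+x. g x \<partial>lborel) =
      (\<integral>\<^sup>+t. emeasure lborel {x. 0 < t \<and> t < f x} \<partial>lborel) + (\<integral>\<^sup>+t. emeasure lborel {x. 0 < t \<and> t < g x} \<partial>lborel)"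
    using f g by (simp add: nn_integral_layer_cake)
  also have "\<dots> = (\<integral>\<^sup>+t. emeasure lborel {x. 0 < t \<and> t < f x} + emeasure lborel {x. 0 < t \<and> t < g x} \<partial>lborel)"
    by (rule nn_integral_add[symmetric]) measurable
  also have "\<dots> \<le> (\<integral>\<^sup>+t. emeasure lborel {x. 0 < t \<and> t < h x} \<partial>lborel)"
    by (intro nn_integral_mono lev)
  also have "\<dots> = (\<integral>\<^sup>+x. h x \<partial>lborel)" using C by (intro nn_integral_layer_cake[symmetric]) (auto simp: h_def)
  also have "\<dots> = (\<integral>\<^sup>+x. ennreal (1/C) * ennreal (exp (- x\<^sup>2 / (2 * (2 * s)\<^sup>2))) \<partial>lborel)"
    using C by (intro nn_integral_cong) (simp add: h_def ennreal_mult[symmetric])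
  also have "\<dots> = ennreal (1/C) * (\<integral>\<^sup>+x. ennreal (exp (- x\<^sup>2 / (2 * (2 * s)\<^sup>2))) \<partial>lborel)"
    by (rule nn_integral_cmult) measurable
  also have "\<dots> = ennreal (2 * s * sqrt (2 * pi) / C)"
    using nn_integral_exp_square[of "2 * s"] s C by (simp add: ennreal_mult[symmetric])
  finally show ?thesis .
qed

text \<open>Dividing by the suprema \<open>A\<close> and \<open>B\<close> reduces to the normalised
  case with \<open>C = sqrt (A * B)\<close>. The inequality
  \<open>4 * (I * J) \<le> (I + J)\<^sup>2\<close> turns the bound on the sum into one on the
  product, where \<open>A\<close> and \<open>B\<close> cancel.\<close>

lemma prekopa_leindler_gauss:
  fixes f g :: "real \<Rightarrow> ennreal"
  assumes s: "s > 0"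
    and [measurable]: "f \<in> borel_measurable borel" "g \<in> borel_measurable borel"
    and fg: "\<And>x y. f x * g y \<le> ennreal (exp (- (x + y)\<^sup>2 / (4 * s\<^sup>2)))"
  shows "(\<integral>\<^sup>+x. f x \<partial>lborel) * (\<integral>\<^sup>+x. g x \<partial>lborel) \<le> ennreal (s\<^sup>2 * (2 * pi))"
proof (cases "(\<forall>x. f x = 0) \<or> (\<forall>x. g x = 0)")
  case True
  then show ?thesis by auto
next
  case False
  then obtain x0 y0 where xy0: "f x0 \<noteq> 0" "g y0 \<noteq> 0" by auto
  have fg1: "f x * g y \<le> 1" for x y
  proof -
    have "exp (- (x + y)\<^sup>2 / (4 * s\<^sup>2)) \<le> 1" by simp
    then have "ennreal (exp (- (x + y)\<^sup>2 / (4 * s\<^sup>2))) \<le> 1" by (metis ennreal_1 ennreal_leI)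
    then show ?thesis using fg order_trans by blast
  qed
  define a where "a = (SUP x. f x)"
  define b where "b = (SUP x. g x)"
  have a0: "a \<noteq> 0" using xy0 unfolding a_def by (auto simp: SUP_eq_iff bot_ennreal[symmetric] simp del: bot_ennreal)
  have b0: "b \<noteq> 0" using xy0 unfolding b_def by (auto simp: SUP_eq_iff bot_ennreal[symmetric] simp del: bot_ennreal)
  \<comment> \<open>Products of values are at most 1, hence so is the product of the suprema; as
    neither supremum is 0, neither is infinite.\<close>
  have "f x * b \<le> 1" for x
    unfolding b_def SUP_mult_left_ennreal by (rule SUP_least) (rule fg1)
  then have "b * f x \<le> 1" for x by (simp add: mult.commute)
  then have "b * a \<le> 1"
    unfolding a_def SUP_mult_left_ennreal by (intro SUP_least) auto
  then have fin: "a \<noteq> \<infinity>" "b \<noteq> \<infinity>"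
    using a0 b0 by (auto simp: ennreal_top_mult ennreal_mult_top top_unique)
  obtain A where A: "a = ennreal A" "A > 0"
    using fin(1) a0 by (cases a) (auto simp: order_le_less)
  obtain B where B: "b = ennreal B" "B > 0"
    using fin(2) b0 by (cases b) (auto simp: order_le_less)
  have fa: "f x \<le> a" "g x \<le> b" for x by (auto simp: a_def b_def intro: SUP_upper)
  define f' where "f' x = enn2real (f x) / A" for x
  define g' where "g' x = enn2real (g x) / B" for x
  have [measurable]: "f' \<in> borel_measurable borel" "g' \<in> borel_measurable borel"
    unfolding f'_def g'_def by measurable
  have f_eq: "f x = ennreal A * ennreal (f' x)" for x
    using fa(1)[of x] A by (cases "f x") (auto simp: f'_def ennreal_mult[symmetric] top_unique)
  have g_eq: "g x = ennreal B * ennreal (g' x)" for x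
    using fa(2)[of x] B by (cases "g x") (auto simp: g'_def ennreal_mult[symmetric] top_unique)
  have nn: "0 \<le> f' x" "0 \<le> g' x" for x using A B by (auto simp: f'_def g'_def)
  have le1: "f' x \<le> 1" "g' x \<le> 1" for x
    using fa[of x] A B by (cases "f x"; cases "g x"; auto simp: f'_def g'_def top_unique)+
  have ex_f: "\<exists>x. t < f' x" if "t < 1" for t
  proof (rule ccontr)
    assume "\<not> ?thesis"
    then have le: "f' x \<le> max t 0" for x by (auto simp: not_less le_max_iff_disj)
    have "a \<le> ennreal A * ennreal (max t 0)"
      unfolding a_def f_eq by (intro SUP_least mult_left_mono ennreal_leI le) simp
    also have "\<dots> = ennreal (A * max t 0)" using A by (intro ennreal_mult[symmetric]) auto
    finally have "A \<le> A * max t 0" unfolding A(1) using A(2) by (subst (asm) ennreal_le_iff) auto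
    then show False using that A by simp
  qed
  have ex_g: "\<exists>x. t < g' x" if "t < 1" for t
  proof (rule ccontr)
    assume "\<not> ?thesis"
    then have le: "g' x \<le> max t 0" for x by (auto simp: not_less le_max_iff_disj)
    have "b \<le> ennreal B * ennreal (max t 0)"
      unfolding b_def g_eq by (intro SUP_least mult_left_mono ennreal_leI le) simp
    also have "\<dots> = ennreal (B * max t 0)" using B by (intro ennreal_mult[symmetric]) auto
    finally have "B \<le> B * max t 0" unfolding B(1) using B(2) by (subst (asm) ennreal_le_iff) auto
    then show False using that B by simp
  qed
  let ?C = "sqrt (A * B)"
  let ?I = "\<integral>\<^sup>+x. f' x \<partial>lborel"
  let ?J = "\<integral>\<^sup>+x. g' x \<partial>lborel"
  have IJ: "?I + ?J \<le> ennreal (2 * s * sqrt (2 * pi) / ?C)"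
  proof (rule prekopa_leindler_gauss_normalized[OF s _ _ _ nn(1) le1(1) ex_f nn(2) le1(2) ex_g])
    show "?C > 0" using A B by simp
    fix x y
    have "ennreal (f' x * g' y * (A * B)) = f x * g y"
      using nn A B by (simp add: f_eq g_eq ennreal_mult ac_simps)
    then have "ennreal (f' x * g' y * (A * B)) \<le> ennreal (exp (- (x + y)\<^sup>2 / (4 * s\<^sup>2)))"
      using fg[of x y] by (simp only:)
    then show "f' x * g' y * ?C\<^sup>2 \<le> exp (- (x + y)\<^sup>2 / (4 * s\<^sup>2))"
      using A B by (subst (asm) ennreal_le_iff) auto
  qed auto
  then have "?I < \<infinity>" "?J < \<infinity>"
    by (auto simp: less_top[symmetric] top_unique)
  then obtain I J where I: "?I = ennreal I" "I \<ge> 0" and J: "?J = ennreal J" "J \<ge> 0"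
    by (metis ennreal_cases infinity_ennreal_def less_irrefl)
  have le: "I + J \<le> 2 * s * sqrt (2 * pi) / ?C"
    using IJ I J s A B by (simp add: ennreal_plus[symmetric] del: ennreal_plus)
  have "4 * (I * J) \<le> (I + J)\<^sup>2" using sum_squares_ge_zero[of "I - J" 0] by (simp add: power2_eq_square algebra_simps)
  also have "\<dots> \<le> (2 * s * sqrt (2 * pi) / ?C)\<^sup>2" using le I J by (intro power_mono) auto
  also have "\<dots> = 4 * (s\<^sup>2 * (2 * pi) / (A * B))" using A B by (simp add: power_mult_distrib power_divide)
  finally have "A * I * (B * J) \<le> s\<^sup>2 * (2 * pi)" using A B by (simp add: field_simps)
  moreover have "(\<integral>\<^sup>+x. f x \<partial>lborel) = ennreal (A * I)"
    unfolding f_eq using A I by (subst nn_integral_cmult) (auto simp: ennreal_mult)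
  moreover have "(\<integral>\<^sup>+x. g x \<partial>lborel) = ennreal (B * J)"
    unfolding g_eq using B J by (subst nn_integral_cmult) (auto simp: ennreal_mult)
  ultimately show ?thesis using A B I J by (simp add: ennreal_mult[symmetric])
qed

text \<open>With the Gaussian densities absorbed into the functions, the identity \<open>(x -
  y)\<^sup>2 + (x + y)\<^sup>2 = 2 * x\<^sup>2 + 2 * y\<^sup>2\<close> changes the cost in
  \<open>x - y\<close> into a Gaussian in \<open>x + y\<close>. The two normalising constants cancel
  \<open>s\<^sup>2 * (2 * pi)\<close> exactly.\<close>

lemma property_tau_1d:
  fixes F G :: "real \<Rightarrow> ennreal"
  assumes s: "s > 0"
    and [measurable]: "F \<in> borel_measurable borel" "G \<in> borel_measurable borel"
    and FG: "\<And>x y. F x * G y \<le> ennreal (exp ((x - y)\<^sup>2 / (4 * s\<^sup>2)))"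
  shows "(\<integral>\<^sup>+x. F x \<partial>gauss s) * (\<integral>\<^sup>+x. G x \<partial>gauss s) \<le> 1"
proof -
  let ?e = "\<lambda>x. ennreal (exp (- x\<^sup>2 / (2 * s\<^sup>2)))"
  let ?c = "ennreal (1 / (s * sqrt (2 * pi)))"
  have dens: "ennreal (normal_density 0 s x) = ?c * ?e x" for x
    using s by (simp add: normal_density_def ennreal_mult[symmetric] real_sqrt_mult)
  have int: "(\<integral>\<^sup>+x. H x \<partial>gauss s) = ?c * (\<integral>\<^sup>+x. H x * ?e x \<partial>lborel)"
    if [measurable]: "H \<in> borel_measurable borel" for H
    by (subst nn_integral_cmult[symmetric]) (auto simp: nn_integral_density dens ac_simps)
  have "(\<integral>\<^sup>+x. F x * ?e x \<partial>lborel) * (\<integral>\<^sup>+x. G x * ?e x \<partial>lborel) \<le> ennreal (s\<^sup>2 * (2 * pi))"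
  proof (rule prekopa_leindler_gauss[OF s])
    fix x y
    have "F x * ?e x * (G y * ?e y) = (F x * G y) * (?e x * ?e y)" by (simp add: ac_simps)
    also have "\<dots> \<le> ennreal (exp ((x - y)\<^sup>2 / (4 * s\<^sup>2))) * (?e x * ?e y)" by (intro mult_right_mono FG) auto
    also have "\<dots> = ennreal (exp ((x - y)\<^sup>2 / (4 * s\<^sup>2) + (- x\<^sup>2 / (2 * s\<^sup>2) + - y\<^sup>2 / (2 * s\<^sup>2))))"
      by (simp only: exp_add ennreal_mult exp_ge_zero mult_nonneg_nonneg)
    also have "(x - y)\<^sup>2 / (4 * s\<^sup>2) + (- x\<^sup>2 / (2 * s\<^sup>2) + - y\<^sup>2 / (2 * s\<^sup>2)) = - (x + y)\<^sup>2 / (4 * s\<^sup>2)"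
      using s by (simp add: field_simps power2_eq_square)
    finally show "F x * ?e x * (G y * ?e y) \<le> ennreal (exp (- (x + y)\<^sup>2 / (4 * s\<^sup>2)))" .
  qed auto
  then have "?c * ?c * ((\<integral>\<^sup>+x. F x * ?e x \<partial>lborel) * (\<integral>\<^sup>+x. G x * ?e x \<partial>lborel)) \<le> ?c * ?c * ennreal (s\<^sup>2 * (2 * pi))"
    by (intro mult_left_mono) auto
  also have "\<dots> = 1" using s by (simp add: ennreal_mult[symmetric] power2_eq_square)
  finally show ?thesis by (simp add: int ac_simps)
qed

lemma prob_space_gauss: "s > 0 \<Longrightarrow> prob_space (gauss s)"
  by (rule prob_space_normal_density)

text \<open>Integrating out the coordinate \<open>i\<close> gives functions \<open>F1\<close> and
  \<open>G1\<close> that satisfy the same hypothesis on the remaining coordinates: this is the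
  one-dimensional case applied to the slices at fixed \<open>x\<close> and \<open>y\<close>.\<close>

lemma property_tau:
  fixes F G :: "('i \<Rightarrow> real) \<Rightarrow> ennreal"
  assumes "finite I" and s: "\<And>i. s i > 0"
    and "F \<in> borel_measurable (PiM I (\<lambda>i. gauss (s i)))" "G \<in> borel_measurable (PiM I (\<lambda>i. gauss (s i)))"
    and "\<And>x y. x \<in> space (PiM I (\<lambda>i. gauss (s i))) \<Longrightarrow> y \<in> space (PiM I (\<lambda>i. gauss (s i))) \<Longrightarrow>
       F x * G y \<le> ennreal (exp (\<Sum>i\<in>I. (x i - y i)\<^sup>2 / (4 * (s i)\<^sup>2)))"
  shows "(\<integral>\<^sup>+x. F x \<partial>PiM I (\<lambda>i. gauss (s i))) * (\<integral>\<^sup>+x. G x \<partial>PiM I (\<lambda>i. gauss (s i))) \<le> 1"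
  using assms(1,3-)
proof (induction I arbitrary: F G rule: finite_induct)
  case empty
  interpret product_sigma_finite "\<lambda>i. gauss (s i)"
    by (intro product_sigma_finite.intro prob_space_imp_sigma_finite prob_space_gauss s)
  show ?case using empty(3)[of "\<lambda>k. undefined" "\<lambda>k. undefined"]
    by (simp add: nn_integral_empty space_PiM)
next
  case (insert i I)
  interpret product_sigma_finite "\<lambda>i. gauss (s i)"
    by (intro product_sigma_finite.intro prob_space_imp_sigma_finite prob_space_gauss s)
  let ?P = "PiM I (\<lambda>i. gauss (s i))"
  let ?Q = "PiM (insert i I) (\<lambda>i. gauss (s i))"
  have [measurable]: "F \<in> borel_measurable ?Q" "G \<in> borel_measurable ?Q" by fact+
  have upd[measurable]: "(\<lambda>(x, a). x(i := a)) \<in> ?P \<Otimes>\<^sub>M gauss (s i) \<rightarrow>\<^sub>M ?Q"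
    by (rule measurable_add_dim)
  have slice: "(\<lambda>a. H (x(i := a))) \<in> borel_measurable borel"
    if "H \<in> borel_measurable ?Q" "x \<in> space ?P" for H :: "_ \<Rightarrow> ennreal" and x
  proof -
    have "(\<lambda>a. x(i := a)) \<in> gauss (s i) \<rightarrow>\<^sub>M ?Q"
      using measurable_compose[OF measurable_Pair1'[OF that(2)] upd] by simp
    then have "(\<lambda>a. H (x(i := a))) \<in> borel_measurable (gauss (s i))"
      using that(1) by (rule measurable_compose)
    then show ?thesis by simp
  qed
  define F1 where "F1 x = (\<integral>\<^sup>+a. F (x(i := a)) \<partial>gauss (s i))" for x
  define G1 where "G1 x = (\<integral>\<^sup>+a. G (x(i := a)) \<partial>gauss (s i))" for x
  have m1: "(\<lambda>x. \<integral>\<^sup>+a. H (x(i := a)) \<partial>gauss (s i)) \<in> borel_measurable ?P"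
    if H: "H \<in> borel_measurable ?Q" for H :: "_ \<Rightarrow> ennreal"
    using measurable_compose[OF upd H] by (intro sigma_finite_measure.borel_measurable_nn_integral[OF prob_space_imp_sigma_finite[OF prob_space_gauss[OF s]]]) (simp add: split_beta')
  have "(\<integral>\<^sup>+x. F1 x \<partial>?P) * (\<integral>\<^sup>+x. G1 x \<partial>?P) \<le> 1"
  proof (rule insert.IH)
    show "F1 \<in> borel_measurable ?P" "G1 \<in> borel_measurable ?P"
      using m1 \<open>F \<in> _\<close> \<open>G \<in> _\<close> unfolding F1_def G1_def by blast+
    fix x y assume xy: "x \<in> space ?P" "y \<in> space ?P"
    let ?S = "\<Sum>j\<in>I. (x j - y j)\<^sup>2 / (4 * (s j)\<^sup>2)"
    \<comment> \<open>The cost of the coordinates in \<open>I\<close> is constant on a slice. It is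
      moved to the left-hand side for the one-dimensional case and brought back afterwards.\<close>
    let ?c = "ennreal (exp (- ?S))"
    note [measurable] = slice[OF \<open>F \<in> _\<close> xy(1)] slice[OF \<open>G \<in> _\<close> xy(2)]
    have "(\<integral>\<^sup>+a. ?c * F (x(i := a)) \<partial>gauss (s i)) * (\<integral>\<^sup>+a. G (y(i := a)) \<partial>gauss (s i)) \<le> 1"
    proof (rule property_tau_1d[OF s])
      fix a b
      have sp: "x(i := a) \<in> space ?Q" "y(i := b) \<in> space ?Q" using xy by (auto simp: space_PiM PiE_iff extensional_def)
      have "?c * F (x(i := a)) * G (y(i := b)) = ?c * (F (x(i := a)) * G (y(i := b)))" by (simp add: ac_simps)
      also have "\<dots> \<le> ?c * ennreal (exp (\<Sum>j\<in>insert i I. ((x(i := a)) j - (y(i := b)) j)\<^sup>2 / (4 * (s j)\<^sup>2)))"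
        by (intro mult_left_mono insert.prems sp) auto
      also have "(\<Sum>j\<in>insert i I. ((x(i := a)) j - (y(i := b)) j)\<^sup>2 / (4 * (s j)\<^sup>2)) = (a - b)\<^sup>2 / (4 * (s i)\<^sup>2) + ?S"
        using insert.hyps by (simp add: sum.insert) (intro sum.cong, auto)
      also have "?c * ennreal (exp ((a - b)\<^sup>2 / (4 * (s i)\<^sup>2) + ?S)) = ennreal (exp ((a - b)\<^sup>2 / (4 * (s i)\<^sup>2)))"
        by (simp add: ennreal_mult[symmetric] exp_add[symmetric])
      finally show "?c * F (x(i := a)) * G (y(i := b)) \<le> ennreal (exp ((a - b)\<^sup>2 / (4 * (s i)\<^sup>2)))" .
    qed measurable
    then have "?c * (F1 x * G1 y) \<le> 1"
      unfolding F1_def G1_def by (subst (asm) nn_integral_cmult) (auto simp: ac_simps)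
    then have "ennreal (exp ?S) * (?c * (F1 x * G1 y)) \<le> ennreal (exp ?S) * 1" by (intro mult_left_mono) auto
    also have "ennreal (exp ?S) * (?c * (F1 x * G1 y)) = F1 x * G1 y"
      by (simp add: mult.assoc[symmetric] ennreal_mult[symmetric] exp_add[symmetric])
    finally show "F1 x * G1 y \<le> ennreal (exp ?S)" by simp
  qed
  then show ?case
    using insert.hyps by (simp add: product_nn_integral_insert F1_def G1_def)
qed

section \<open>Concentration on finitely many coordinates\<close>

definition splice :: "'i set \<Rightarrow> ('i \<Rightarrow> 'a) \<Rightarrow> ('i \<Rightarrow> 'a) \<Rightarrow> 'i \<Rightarrow> 'a" where
  "splice J x y = (\<lambda>i. if i \<in> J then x i else y i)"

lemma measurable_splice[measurable (raw)]:
  assumes "f \<in> N \<rightarrow>\<^sub>M PiM UNIV M" "g \<in> N \<rightarrow>\<^sub>M PiM UNIV M"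
  shows "(\<lambda>x. splice J (f x) (g x)) \<in> N \<rightarrow>\<^sub>M PiM UNIV M"
proof (rule measurable_PiM_single')
  show "(\<lambda>\<omega>. splice J (f \<omega>) (g \<omega>)) \<in> space N \<rightarrow> (\<Pi>\<^sub>E i\<in>UNIV. space (M i))"
    using measurable_space[OF assms(1)] measurable_space[OF assms(2)]
    by (auto simp: splice_def space_PiM PiE_iff)
next
  fix i
  show "(\<lambda>\<omega>. splice J (f \<omega>) (g \<omega>) i) \<in> N \<rightarrow>\<^sub>M M i"
    using measurable_compose[OF assms(1) measurable_component_singleton[of i]]
      measurable_compose[OF assms(2) measurable_component_singleton[of i]]
    by (cases "i \<in> J") (auto simp: splice_def)
qed

text \<open>Verified on cylinders: the preimage is a rectangle whose first side carries the
  coordinates in \<open>K \<inter> J\<close> and whose second side carries those in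
  \<open>K - J\<close>, so its measure factorises.\<close>

lemma distr_splice:
  assumes M: "\<And>i. prob_space (M i)"
  shows "distr (PiM UNIV M \<Otimes>\<^sub>M PiM UNIV M) (PiM UNIV M) (\<lambda>(x, y). splice J x y) = PiM UNIV M"
proof -
  interpret product_prob_space M UNIV
    using M by (intro product_prob_spaceI)
  interpret P: prob_space "PiM UNIV M" by (rule prob_space_PiM) (rule M)
  interpret PP: pair_prob_space "PiM UNIV M" "PiM UNIV M" ..
  show ?thesis
  proof (rule PiM_eq)
    show "sets (distr (PiM UNIV M \<Otimes>\<^sub>M PiM UNIV M) (PiM UNIV M) (\<lambda>(x, y). splice J x y)) = sets (PiM UNIV M)"
      by simp
  next
    fix K E assume K: "finite K" "K \<subseteq> UNIV" "\<And>j. j \<in> K \<Longrightarrow> E j \<in> sets (M j)"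
    let ?X = "prod_emb UNIV M K (Pi\<^sub>E K E)"
    let ?A = "prod_emb UNIV M (K \<inter> J) (Pi\<^sub>E (K \<inter> J) E)"
    let ?B = "prod_emb UNIV M (K - J) (Pi\<^sub>E (K - J) E)"
    have sub: "\<And>j x. j \<in> K \<Longrightarrow> x \<in> E j \<Longrightarrow> x \<in> space (M j)"
      using K(3)[THEN sets.sets_into_space] by auto
    have "(\<lambda>(x, y). splice J x y) -` ?X \<inter> space (PiM UNIV M \<Otimes>\<^sub>M PiM UNIV M) = ?A \<times> ?B"
      using K sub by (auto simp: space_pair_measure space_PiM PiE_iff prod_emb_def splice_def) (metis (full_types))+
    then have "emeasure (distr (PiM UNIV M \<Otimes>\<^sub>M PiM UNIV M) (PiM UNIV M) (\<lambda>(x, y). splice J x y)) ?X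
        = emeasure (PiM UNIV M \<Otimes>\<^sub>M PiM UNIV M) (?A \<times> ?B)"
      using K by (subst emeasure_distr) (auto intro!: sets_PiM_I)
    also have "\<dots> = emeasure (PiM UNIV M) ?A * emeasure (PiM UNIV M) ?B"
      using K by (intro P.emeasure_pair_measure_Times) (auto intro!: sets_PiM_I)
    also have "\<dots> = (\<Prod>j\<in>K \<inter> J. emeasure (M j) (E j)) * (\<Prod>j\<in>K - J. emeasure (M j) (E j))"
      using K by (subst (1 2) emeasure_PiM_emb) auto
    also have "\<dots> = (\<Prod>j\<in>K. emeasure (M j) (E j))"
      using K by (subst prod.Int_Diff[of K _ J]) auto
    finally show "emeasure (distr (PiM UNIV M \<Otimes>\<^sub>M PiM UNIV M) (PiM UNIV M) (\<lambda>(x, y). splice J x y)) ?X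
        = (\<Prod>j\<in>K. emeasure (M j) (E j))" .
  qed
qed

lemma splice_Compl: "splice (- J) x y = splice J y x"
  by (auto simp: splice_def)

text \<open>Borel-Cantelli: along a fast subsequence the \<open>n\<close>-th increment exceeds
  \<open>(1/2)^n\<close> only finitely often, so the telescoping series converges. No limit has to
  be known beforehand.\<close>

lemma (in prob_space) cauchy_in_prob_AE_subseq:
  fixes h :: "nat \<Rightarrow> 'a \<Rightarrow> real"
  assumes [measurable]: "\<And>n. h n \<in> borel_measurable M"
    and C: "\<And>e. e > 0 \<Longrightarrow> \<exists>K. \<forall>k\<ge>K. \<forall>l\<ge>K. prob {x\<in>space M. e < \<bar>h k x - h l x\<bar>} \<le> e"
  shows "\<exists>r. strict_mono r \<and> (AE x in M. convergent (\<lambda>n. h (r n) x))"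
proof -
  have "\<exists>K. \<forall>k\<ge>K. \<forall>l\<ge>K. prob {x\<in>space M. (1/2)^j < \<bar>h k x - h l x\<bar>} \<le> (1/2)^j" for j :: nat
    by (rule C) simp
  then obtain K where K: "\<And>j k l. k \<ge> K j \<Longrightarrow> l \<ge> K j \<Longrightarrow>
      prob {x\<in>space M. (1/2)^j < \<bar>h k x - h l x\<bar>} \<le> (1/2)^j" by metis
  \<comment> \<open>The sum puts \<open>r j\<close> and \<open>r (Suc j)\<close> beyond
    \<open>K j\<close>; the summand \<open>j\<close> makes the sequence strictly increasing.\<close>
  define r where "r j = (\<Sum>i\<le>j. K i) + j" for j
  have rK: "K j \<le> r j" for j
    unfolding r_def using member_le_sum[of j "{..j}" K] by auto
  have r: "strict_mono r" by (intro strict_mono_Suc_iff[THEN iffD2]) (auto simp: r_def)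
  have rS: "K j \<le> r (Suc j)" for j
    using rK[of j] strict_mono_less_eq[OF r, of j "Suc j"] by linarith
  define A where "A j = {x\<in>space M. (1/2)^j < \<bar>h (r (Suc j)) x - h (r j) x\<bar>}" for j
  have "AE x in M. eventually (\<lambda>n. x \<in> space M - A n) sequentially"
  proof (rule borel_cantelli_AE1)
    show "A n \<in> sets M" for n by (auto simp: A_def)
    show "summable (\<lambda>n. prob (A n))"
      using K[OF rS rK] by (intro summable_comparison_test'[of "\<lambda>n. (1/2)^n" 0 "\<lambda>n. prob (A n)"])
        (auto simp: A_def summable_geometric)
  qed (simp add: less_top[symmetric])
  then have "AE x in M. convergent (\<lambda>n. h (r n) x)"
  proof eventually_elim
    case (elim x)
    have "summable (\<lambda>n. h (r (Suc n)) x - h (r n) x)"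
    proof (rule summable_comparison_test_ev)
      show "eventually (\<lambda>n. norm (h (r (Suc n)) x - h (r n) x) \<le> (1/2)^n) sequentially"
        using elim by eventually_elim (auto simp: A_def)
    qed (simp add: summable_geometric)
    then have "convergent (\<lambda>n. \<Sum>i<n. h (r (Suc i)) x - h (r i) x)"
      by (simp add: summable_iff_convergent)
    then have "convergent (\<lambda>n. h (r n) x - h (r 0) x)"
      using sum_lessThan_telescope[of "\<lambda>i. h (r i) x"] by simp
    then have "convergent (\<lambda>n. h (r n) x - h (r 0) x + h (r 0) x)"
      by (intro convergent_add convergent_const)
    then show ?case by simp
  qed
  then show ?thesis using r by blast
qed

lemma (in prob_space) AE_convergent_imp_cauchy_in_prob:
  fixes h :: "nat \<Rightarrow> 'a \<Rightarrow> real"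
  assumes [measurable]: "\<And>n. h n \<in> borel_measurable M"
    and conv: "AE x in M. convergent (\<lambda>n. h n x)" and e: "e > 0"
  shows "\<exists>K. \<forall>k\<ge>K. \<forall>l\<ge>K. prob {x\<in>space M. e < \<bar>h k x - h l x\<bar>} \<le> e"
proof -
  define g where "g x = lim (\<lambda>n. h n x)" for x
  have [measurable]: "g \<in> borel_measurable M" unfolding g_def by measurable
  have lim: "AE x in M. (\<lambda>n. h n x) \<longlonglongrightarrow> g x"
    using conv by eventually_elim (simp add: g_def convergent_LIMSEQ_iff)
  have 0: "(\<lambda>n. prob {x\<in>space M. e/2 < \<bar>h n x - g x\<bar>}) \<longlonglongrightarrow> 0"
    using e by (intro AE_tendsto_imp_prob_tendsto_0 lim) auto
  have "eventually (\<lambda>n. prob {x\<in>space M. e/2 < \<bar>h n x - g x\<bar>} < e/2) sequentially"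
    using order_tendstoD(2)[OF 0, of "e/2"] \<open>e > 0\<close> by simp
  then obtain K where K: "\<And>n. n \<ge> K \<Longrightarrow> prob {x\<in>space M. e/2 < \<bar>h n x - g x\<bar>} < e/2"
    by (auto simp: eventually_sequentially)
  have "prob {x\<in>space M. e < \<bar>h k x - h l x\<bar>} \<le> e" if "k \<ge> K" "l \<ge> K" for k l
  proof -
    have "prob {x\<in>space M. e < \<bar>h k x - h l x\<bar>} \<le>
      prob ({x\<in>space M. e/2 < \<bar>h k x - g x\<bar>} \<union> {x\<in>space M. e/2 < \<bar>h l x - g x\<bar>})"
      by (intro finite_measure_mono) (auto simp: abs_if split: if_splits)
    also have "\<dots> \<le> prob {x\<in>space M. e/2 < \<bar>h k x - g x\<bar>} + prob {x\<in>space M. e/2 < \<bar>h l x - g x\<bar>}"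
      by (intro measure_Un_le) auto
    finally show ?thesis using K[OF that(1)] K[OF that(2)] by simp
  qed
  then show ?thesis by blast
qed

section \<open>The Gaussian product measure and its dimension-free concentration\<close>

locale gauss_seq =
  fixes \<sigma> :: "nat \<Rightarrow> real"
  assumes pos: "\<And>n. 0 < \<sigma> n"
begin

definition P :: "(nat \<Rightarrow> real) measure" where "P = PiM UNIV (\<lambda>n. gauss (\<sigma> n))"

sublocale G: product_prob_space "\<lambda>n. gauss (\<sigma> n)" UNIV
  by (intro product_prob_spaceI prob_space_gauss pos)

sublocale P: prob_space P
  unfolding P_def by (intro prob_space_PiM prob_space_gauss pos)

sublocale PP: pair_prob_space P P ..

lemma space_P[simp]: "space P = UNIV"
  by (simp add: P_def space_PiM)

lemma sets_P_borel: "sets P = sets borel"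
proof -
  have "sets P = sets (PiM UNIV (\<lambda>_. borel))" unfolding P_def by (intro sets_PiM_cong) auto
  then show ?thesis by (simp add: sets_PiM_equal_borel)
qed

lemma measurable_coord[measurable (raw)]:
  assumes "f \<in> N \<rightarrow>\<^sub>M P" shows "(\<lambda>x. f x i) \<in> borel_measurable N"
proof -
  have "(\<lambda>x. x i) \<in> P \<rightarrow>\<^sub>M gauss (\<sigma> i)" unfolding P_def by (rule measurable_component_singleton) simp
  then have "(\<lambda>x. f x i) \<in> N \<rightarrow>\<^sub>M gauss (\<sigma> i)" by (rule measurable_compose[OF assms])
  then show ?thesis by simp
qed

lemma measurable_splice_P[measurable (raw)]:
  "f \<in> N \<rightarrow>\<^sub>M P \<Longrightarrow> g \<in> N \<rightarrow>\<^sub>M P \<Longrightarrow> (\<lambda>x. splice J (f x) (g x)) \<in> N \<rightarrow>\<^sub>M P"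
  unfolding P_def by (rule measurable_splice)

lemma distr_splice_P: "distr (P \<Otimes>\<^sub>M P) P (\<lambda>(x, y). splice J x y) = P"
  unfolding P_def by (intro distr_splice prob_space_gauss pos)

lemma distr_splice_P': "distr (P \<Otimes>\<^sub>M P) P (\<lambda>(x, y). splice J y x) = P"
  using distr_splice_P[of "- J"] by (simp add: splice_Compl)

lemma sets_P_Collect: "Measurable.pred P Q \<Longrightarrow> {x. Q x} \<in> sets P"
  by (simp add: pred_def)

lemma sets_PP_Collect: "Measurable.pred (P \<Otimes>\<^sub>M P) Q \<Longrightarrow> {z. Q z} \<in> sets (P \<Otimes>\<^sub>M P)"
  by (simp add: pred_def space_pair_measure)

text \<open>Finite-dimensional statements are phrased on \<open>P\<close> itself through this
  predicate. The result type is left open so that sets are covered too, by their membership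
  predicates.\<close>

definition depends_on :: "nat set \<Rightarrow> ((nat \<Rightarrow> real) \<Rightarrow> 'b) \<Rightarrow> bool" where
  "depends_on I F \<longleftrightarrow> (\<forall>x y. (\<forall>i\<in>I. x i = y i) \<longrightarrow> F x = F y)"

lemma property_tau_P:
  fixes F G :: "(nat \<Rightarrow> real) \<Rightarrow> ennreal"
  assumes I: "finite I" and [measurable]: "F \<in> borel_measurable P" "G \<in> borel_measurable P"
    and dep: "depends_on I F" "depends_on I G"
    and FG: "\<And>x y. F x * G y \<le> ennreal (exp (\<Sum>i\<in>I. (x i - y i)\<^sup>2 / (4 * (\<sigma> i)\<^sup>2)))"
  shows "(\<integral>\<^sup>+x. F x \<partial>P) * (\<integral>\<^sup>+x. G x \<partial>P) \<le> 1"
proof -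
  let ?Q = "PiM I (\<lambda>n. gauss (\<sigma> n))"
  \<comment> \<open>The filler 0 is arbitrary: \<open>ext\<close> is only composed with functions
    that depend on the coordinates in \<open>I\<close>.\<close>
  define ext where "ext u = (\<lambda>i. if i \<in> I then u i else 0 :: real)" for u :: "nat \<Rightarrow> real"
  have ext[measurable]: "ext \<in> ?Q \<rightarrow>\<^sub>M P"
    unfolding P_def
  proof (rule measurable_PiM_single')
    show "(\<lambda>u. ext u i) \<in> ?Q \<rightarrow>\<^sub>M gauss (\<sigma> i)" for i
      using measurable_component_singleton[of i I "\<lambda>n. gauss (\<sigma> n)"] by (cases "i \<in> I") (auto simp: ext_def)
  qed (auto simp: space_PiM)
  have restr: "distr P ?Q (\<lambda>x. restrict x I) = ?Q"
    unfolding P_def by (rule G.distr_PiM_restrict_finite) (auto simp: I)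
  have [measurable]: "(\<lambda>x. restrict x I) \<in> P \<rightarrow>\<^sub>M ?Q"
    unfolding P_def by (rule measurable_restrict_subset) auto
  have int: "(\<integral>\<^sup>+x. H x \<partial>P) = (\<integral>\<^sup>+u. H (ext u) \<partial>?Q)"
    if [measurable]: "H \<in> borel_measurable P" and "depends_on I H" for H :: "_ \<Rightarrow> ennreal"
  proof -
    have "(\<integral>\<^sup>+u. H (ext u) \<partial>?Q) = (\<integral>\<^sup>+x. H (ext (restrict x I)) \<partial>P)"
      by (subst restr[symmetric], subst nn_integral_distr) auto
    moreover have "H (ext (restrict x I)) = H x" for x
      using that(2) unfolding depends_on_def by (auto simp: ext_def)
    ultimately show ?thesis by simp
  qed
  have "(\<integral>\<^sup>+u. F (ext u) \<partial>?Q) * (\<integral>\<^sup>+u. G (ext u) \<partial>?Q) \<le> 1"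
  proof (rule property_tau[OF I pos])
    fix x y
    show "F (ext x) * G (ext y) \<le> ennreal (exp (\<Sum>i\<in>I. (x i - y i)\<^sup>2 / (4 * (\<sigma> i)\<^sup>2)))"
      using FG[of "ext x" "ext y"] by (simp add: ext_def cong: sum.cong)
  qed auto
  then show ?thesis using dep by (simp add: int)
qed

text \<open>Property tau for \<open>F\<close> and \<open>G\<close> is the exponential moment bound
  of \<open>\<phi> (fst z) - \<phi> (snd z)\<close> by \<open>exp (s\<^sup>2 * l\<^sup>2)\<close>,
  and Markov's inequality follows. Its hypothesis comes from completing the square: \<open>l * d -
  s\<^sup>2 * l\<^sup>2 \<le> d\<^sup>2 / (4 * s\<^sup>2)\<close>. The indicator of \<open>E\<close>
  makes the product vanish where no Lipschitz bound is available.\<close>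

lemma Lipschitz_concentration_one_sided:
  assumes I: "finite I" and s: "s > 0" "\<And>i. i \<in> I \<Longrightarrow> \<sigma> i \<le> s"
    and [measurable]: "\<phi> \<in> borel_measurable P" "E \<in> sets P" and "P.prob E = 1"
    and dep: "depends_on I \<phi>" "depends_on I (\<lambda>x. x \<in> E)"
    and lip: "\<And>x y. x \<in> E \<Longrightarrow> y \<in> E \<Longrightarrow> \<bar>\<phi> x - \<phi> y\<bar> \<le> sqrt (\<Sum>i\<in>I. (x i - y i)\<^sup>2)"
    and \<eta>: "\<eta> > 0"
  shows "measure (P \<Otimes>\<^sub>M P) {z. \<eta> < \<phi> (fst z) - \<phi> (snd z)} \<le> exp (- \<eta>\<^sup>2 / (4 * s\<^sup>2))"
proof -
  \<comment> \<open>The maximiser of \<open>l * \<eta> - s\<^sup>2 * l\<^sup>2\<close>, with value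
    \<open>\<eta>\<^sup>2 / (4 * s\<^sup>2)\<close>.\<close>
  define l where "l = \<eta> / (2 * s\<^sup>2)"
  have l: "l > 0" using \<eta> s by (simp add: l_def)
  define F where "F x = ennreal (exp (l * \<phi> x)) * indicator E x" for x
  define G where "G x = ennreal (exp (- l * \<phi> x - s\<^sup>2 * l\<^sup>2)) * indicator E x" for x
  have [measurable]: "F \<in> borel_measurable P" "G \<in> borel_measurable P" unfolding F_def G_def by measurable
  have FG: "(\<integral>\<^sup>+x. F x \<partial>P) * (\<integral>\<^sup>+x. G x \<partial>P) \<le> 1"
  proof (rule property_tau_P[OF I])
    have eq: "\<phi> x = \<phi> y" "indicator E x = (indicator E y :: ennreal)" if "\<forall>i\<in>I. x i = y i" for x y
      using dep that unfolding depends_on_def by (auto simp: indicator_def)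
    show "depends_on I F" "depends_on I G" unfolding depends_on_def F_def G_def
      using eq by (metis (no_types))+
    fix x y
    show "F x * G y \<le> ennreal (exp (\<Sum>i\<in>I. (x i - y i)\<^sup>2 / (4 * (\<sigma> i)\<^sup>2)))"
    proof (cases "x \<in> E \<and> y \<in> E")
      case True
      define d where "d = sqrt (\<Sum>i\<in>I. (x i - y i)\<^sup>2)"
      have d2: "d\<^sup>2 = (\<Sum>i\<in>I. (x i - y i)\<^sup>2)" by (simp add: d_def sum_nonneg)
      have "l * (\<phi> x - \<phi> y) - s\<^sup>2 * l\<^sup>2 \<le> l * d - s\<^sup>2 * l\<^sup>2"
        using lip[of x y] True l unfolding d_def by (intro diff_mono mult_left_mono) auto
      also have "\<dots> \<le> d\<^sup>2 / (4 * s\<^sup>2)"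
      proof -
        have "0 \<le> (d / (2 * s) - s * l)\<^sup>2" by simp
        also have "\<dots> = d\<^sup>2 / (4 * s\<^sup>2) - (l * d - s\<^sup>2 * l\<^sup>2)"
          using s(1) by (simp add: power2_eq_square field_simps)
        finally show ?thesis by simp
      qed
      also have "\<dots> = (\<Sum>i\<in>I. (x i - y i)\<^sup>2 / (4 * s\<^sup>2))" by (simp add: d2 sum_divide_distrib)
      \<comment> \<open>The coordinates enter only through the common bound
        \<open>\<sigma> i \<le> s\<close>; their number never appears, which makes the estimate
        dimension-free.\<close>
      also have "\<dots> \<le> (\<Sum>i\<in>I. (x i - y i)\<^sup>2 / (4 * (\<sigma> i)\<^sup>2))"
        using s pos by (intro sum_mono divide_left_mono mult_left_mono power_mono mult_pos_pos zero_less_power) (auto simp: less_imp_le)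
      finally have le: "l * (\<phi> x - \<phi> y) - s\<^sup>2 * l\<^sup>2 \<le> (\<Sum>i\<in>I. (x i - y i)\<^sup>2 / (4 * (\<sigma> i)\<^sup>2))" .
      have "F x * G y = ennreal (exp (l * (\<phi> x - \<phi> y) - s\<^sup>2 * l\<^sup>2))"
        using True by (simp add: F_def G_def ennreal_mult[symmetric] exp_add[symmetric] algebra_simps)
      then show ?thesis using le by (simp add: ennreal_leI)
    qed (auto simp: F_def G_def)
  qed auto
  let ?A = "{z. \<eta> < \<phi> (fst z) - \<phi> (snd z)}"
  have A: "?A \<in> sets (P \<Otimes>\<^sub>M P)"
    by (rule sets_PP_Collect) measurable
  have EE: "AE z in P \<Otimes>\<^sub>M P. fst z \<in> E \<and> snd z \<in> E"
  proof -
    have AE_E: "AE x in P. x \<in> E" using \<open>P.prob E = 1\<close> by (rule P.AE_prob_1)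
    show ?thesis
    proof (rule PP.AE_pair_measure)
      show "{z \<in> space (P \<Otimes>\<^sub>M P). fst z \<in> E \<and> snd z \<in> E} \<in> sets (P \<Otimes>\<^sub>M P)" by measurable
      show "AE x in P. AE y in P. fst (x, y) \<in> E \<and> snd (x, y) \<in> E"
        using AE_E by eventually_elim (use AE_E in simp)
    qed
  qed
  have "ennreal (exp (l * \<eta> - s\<^sup>2 * l\<^sup>2)) * emeasure (P \<Otimes>\<^sub>M P) ?A
      = (\<integral>\<^sup>+z. ennreal (exp (l * \<eta> - s\<^sup>2 * l\<^sup>2)) * indicator ?A z \<partial>(P \<Otimes>\<^sub>M P))"
    using A by (simp add: nn_integral_cmult_indicator)
  also have "\<dots> \<le> (\<integral>\<^sup>+z. F (fst z) * G (snd z) \<partial>(P \<Otimes>\<^sub>M P))"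
  proof (rule nn_integral_mono_AE)
    show "AE z in P \<Otimes>\<^sub>M P. ennreal (exp (l * \<eta> - s\<^sup>2 * l\<^sup>2)) * indicator ?A z \<le> F (fst z) * G (snd z)"
      using EE
    proof eventually_elim
      case (elim z)
      have "F (fst z) * G (snd z) = ennreal (exp (l * (\<phi> (fst z) - \<phi> (snd z)) - s\<^sup>2 * l\<^sup>2))"
        using elim by (simp add: F_def G_def ennreal_mult[symmetric] exp_add[symmetric] algebra_simps)
      then show ?case using l by (auto simp: indicator_def intro!: ennreal_leI mult_left_mono)
    qed
  qed
  also have "\<dots> = (\<integral>\<^sup>+x. (\<integral>\<^sup>+y. F x * G y \<partial>P) \<partial>P)"
    by (subst P.nn_integral_fst[symmetric]) auto
  also have "\<dots> = (\<integral>\<^sup>+x. F x \<partial>P) * (\<integral>\<^sup>+x. G x \<partial>P)"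
    by (simp add: nn_integral_cmult nn_integral_multc)
  also have "\<dots> \<le> 1" by (rule FG)
  finally have "exp (l * \<eta> - s\<^sup>2 * l\<^sup>2) * measure (P \<Otimes>\<^sub>M P) ?A \<le> 1"
    by (simp add: PP.emeasure_eq_measure ennreal_mult[symmetric])
  moreover have "l * \<eta> - s\<^sup>2 * l\<^sup>2 = \<eta>\<^sup>2 / (4 * s\<^sup>2)"
    using s by (simp add: l_def power2_eq_square field_simps)
  ultimately show ?thesis by (simp add: exp_minus field_simps)
qed

lemma Lipschitz_concentration:
  assumes I: "finite I" and s: "s > 0" "\<And>i. i \<in> I \<Longrightarrow> \<sigma> i \<le> s"
    and [measurable]: "\<phi> \<in> borel_measurable P" "E \<in> sets P" and E: "P.prob E = 1"
    and dep: "depends_on I \<phi>" "depends_on I (\<lambda>x. x \<in> E)"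
    and lip: "\<And>x y. x \<in> E \<Longrightarrow> y \<in> E \<Longrightarrow> \<bar>\<phi> x - \<phi> y\<bar> \<le> sqrt (\<Sum>i\<in>I. (x i - y i)\<^sup>2)"
    and \<eta>: "\<eta> > 0"
  shows "measure (P \<Otimes>\<^sub>M P) {z. \<eta> < \<bar>\<phi> (fst z) - \<phi> (snd z)\<bar>} \<le> 2 * exp (- \<eta>\<^sup>2 / (4 * s\<^sup>2))"
proof -
  have m: "{z. \<eta> < \<psi> (fst z) - \<psi> (snd z)} \<in> sets (P \<Otimes>\<^sub>M P)"
    if [measurable]: "\<psi> \<in> borel_measurable P" for \<psi> :: "_ \<Rightarrow> real"
    by (rule sets_PP_Collect) measurable
  have 1: "measure (P \<Otimes>\<^sub>M P) {z. \<eta> < \<phi> (fst z) - \<phi> (snd z)} \<le> exp (- \<eta>\<^sup>2 / (4 * s\<^sup>2))"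
    by (rule Lipschitz_concentration_one_sided[OF I s _ _ E dep lip \<eta>]) auto
  have 2: "measure (P \<Otimes>\<^sub>M P) {z. \<eta> < - \<phi> (fst z) - - \<phi> (snd z)} \<le> exp (- \<eta>\<^sup>2 / (4 * s\<^sup>2))"
    using dep lip by (intro Lipschitz_concentration_one_sided[OF I s _ _ E _ _ _ \<eta>])
      (auto simp: depends_on_def abs_minus_commute)
  have "{z. \<eta> < \<bar>\<phi> (fst z) - \<phi> (snd z)\<bar>} =
      {z. \<eta> < \<phi> (fst z) - \<phi> (snd z)} \<union> {z. \<eta> < - \<phi> (fst z) - - \<phi> (snd z)}"
    using \<eta> by (auto simp: abs_if)
  then have "measure (P \<Otimes>\<^sub>M P) {z. \<eta> < \<bar>\<phi> (fst z) - \<phi> (snd z)\<bar>} \<le>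
      measure (P \<Otimes>\<^sub>M P) {z. \<eta> < \<phi> (fst z) - \<phi> (snd z)} +
      measure (P \<Otimes>\<^sub>M P) {z. \<eta> < - \<phi> (fst z) - - \<phi> (snd z)}"
    using m[of \<phi>] m[of "\<lambda>x. - \<phi> x"] by (auto intro!: measure_Un_le)
  then show ?thesis using 1 2 by simp
qed

end

section \<open>Concentration on the tail coordinates\<close>

lemma l2_dist_splice:
  assumes "finite I"
  shows "l2_dist (splice I z w) (splice I y w) = ennreal (sqrt (\<Sum>i\<in>I. (z i - y i)\<^sup>2))"
proof -
  have eq: "(splice I z w n - splice I y w n)\<^sup>2 = (if n \<in> I then (z n - y n)\<^sup>2 else 0)" for n
    by (auto simp: splice_def)
  have "summable (\<lambda>n. (splice I z w n - splice I y w n)\<^sup>2)"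
    unfolding eq using assms by (intro summable_finite[of I]) auto
  moreover have "(\<Sum>n. (splice I z w n - splice I y w n)\<^sup>2) = (\<Sum>i\<in>I. (z i - y i)\<^sup>2)"
    unfolding eq using assms by (subst suminf_finite[of I]) auto
  ultimately show ?thesis by (simp add: l2_dist_def)
qed

context gauss_seq
begin

lemma measure_vimage_P:
  assumes "T \<in> Q \<rightarrow>\<^sub>M R" "distr Q R T = R" "A \<in> sets R"
  shows "measure Q (T -` A \<inter> space Q) = measure R A"
  using measure_distr[OF assms(1,3)] assms(2) by simp

lemma depends_on_mono: "depends_on I F \<Longrightarrow> I \<subseteq> J \<Longrightarrow> depends_on J F"
  unfolding depends_on_def by blast

text \<open>The splice of two independent samples has law \<open>P\<close> again, and Fubini freezes
  the part that is not resampled.\<close>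

lemma AE_splice:
  assumes "AE x in P. Q x" shows "AE y in P. AE x in P. Q (splice J x y)"
proof -
  have "AE x in distr (P \<Otimes>\<^sub>M P) P (\<lambda>(x, y). splice J y x). Q x"
    using assms by (simp only: distr_splice_P')
  then have "AE z in P \<Otimes>\<^sub>M P. Q ((\<lambda>(x, y). splice J y x) z)"
    by (rule AE_distrD[rotated]) measurable
  from PP.AE_pair[OF this] show ?thesis by simp
qed

text \<open>For a fixed background \<open>w\<close> outside \<open>I\<close>, the function
  \<open>f (splice I z w)\<close> of \<open>z\<close> is Lipschitz for the Euclidean distance on
  \<open>I\<close>, so \<open>Lipschitz_concentration\<close> applies; the bound is then integrated
  over \<open>w\<close>.\<close>

lemma splice_concentration_finite:
  assumes I: "finite I" and s: "s > 0" "\<And>i. i \<in> I \<Longrightarrow> \<sigma> i \<le> s"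
    and [measurable]: "f \<in> borel_measurable P" "E \<in> sets P" and E: "P.prob E = 1"
    and lip: "\<And>x y. x \<in> E \<Longrightarrow> y \<in> E \<Longrightarrow> ennreal \<bar>f x - f y\<bar> \<le> l2_dist x y"
    and \<eta>: "\<eta> > 0"
  shows "measure (P \<Otimes>\<^sub>M P) {z. \<eta> < \<bar>f (fst z) - f (splice I (snd z) (fst z))\<bar>} \<le> 2 * exp (- \<eta>\<^sup>2 / (4 * s\<^sup>2))"
proof -
  let ?A = "{z. \<eta> < \<bar>f (fst z) - f (splice I (snd z) (fst z))\<bar>}"
  let ?C = "ennreal (2 * exp (- \<eta>\<^sup>2 / (4 * s\<^sup>2)))"
  have A[measurable]: "?A \<in> sets (P \<Otimes>\<^sub>M P)"
    by (rule sets_PP_Collect) measurable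
  define h where "h w = emeasure P (Pair w -` ?A)" for w
  have h[measurable]: "h \<in> borel_measurable P" unfolding h_def by (rule P.measurable_emeasure_Pair[OF A])
  have "emeasure (P \<Otimes>\<^sub>M P) ?A = (\<integral>\<^sup>+w. h w \<partial>P)"
    unfolding h_def by (rule P.emeasure_pair_measure_alt[OF A])
  \<comment> \<open>Resampling the \<open>I\<close>-part of the first point as well leaves the
    integral unchanged. The two points compared become independent blocks over one common
    background.\<close>
  also have "\<dots> = (\<integral>\<^sup>+z. h (splice I (snd z) (fst z)) \<partial>(P \<Otimes>\<^sub>M P))"
    by (subst distr_splice_P'[of I, symmetric], subst nn_integral_distr) (auto simp: split_beta')
  also have "\<dots> = (\<integral>\<^sup>+w. (\<integral>\<^sup>+z. h (splice I z w) \<partial>P) \<partial>P)"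
    by (subst P.nn_integral_fst[symmetric]) auto
  also have "\<dots> \<le> (\<integral>\<^sup>+w. ?C \<partial>P)"
  proof (rule nn_integral_mono_AE)
    have "AE w in P. AE z in P. splice I z w \<in> E" using E by (intro AE_splice P.AE_prob_1)
    then show "AE w in P. (\<integral>\<^sup>+z. h (splice I z w) \<partial>P) \<le> ?C"
    proof eventually_elim
      case (elim w)
      let ?B = "{z. \<eta> < \<bar>f (splice I (fst z) w) - f (splice I (snd z) w)\<bar>}"
      have w[measurable]: "w \<in> space P" by simp
      have B: "?B \<in> sets (P \<Otimes>\<^sub>M P)"
    by (rule sets_PP_Collect) measurable
      have Ew: "{z \<in> space P. splice I z w \<in> E} \<in> sets P" by measurable
      have ss: "splice I y (splice I z w) = splice I y w" for y z :: "nat \<Rightarrow> real"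
        by (auto simp: splice_def)
      have "(\<integral>\<^sup>+z. h (splice I z w) \<partial>P) = emeasure (P \<Otimes>\<^sub>M P) ?B"
        unfolding P.emeasure_pair_measure_alt[OF B] h_def by (simp add: vimage_def ss)
      also have "\<dots> \<le> ?C"
        unfolding PP.emeasure_eq_measure
      proof (rule ennreal_leI, rule Lipschitz_concentration[OF I s])
        show "{z. splice I z w \<in> E} \<in> P.events" using Ew by simp
        show "P.prob {z. splice I z w \<in> E} = 1"
          using elim P.prob_Collect_eq_1[OF Ew] by simp
        have "splice I x w = splice I y w" if "\<forall>i\<in>I. x i = y i" for x y
          using that by (auto simp: splice_def)
        then show "depends_on I (\<lambda>z. f (splice I z w))" "depends_on I (\<lambda>x. x \<in> {z. splice I z w \<in> E})"
          unfolding depends_on_def by (metis mem_Collect_eq)+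
        fix x y assume "x \<in> {z. splice I z w \<in> E}" "y \<in> {z. splice I z w \<in> E}"
        then have "ennreal \<bar>f (splice I x w) - f (splice I y w)\<bar> \<le> l2_dist (splice I x w) (splice I y w)"
          by (intro lip) auto
        then show "\<bar>f (splice I x w) - f (splice I y w)\<bar> \<le> sqrt (\<Sum>i\<in>I. (x i - y i)\<^sup>2)"
          by (simp add: l2_dist_splice I sum_nonneg)
      qed (use \<eta> in \<open>measurable\<close>)
      finally show ?case .
    qed
  qed
  also have "\<dots> = ?C" by (simp add: P.emeasure_space_1[simplified])
  finally show ?thesis by (simp add: PP.emeasure_eq_measure)
qed

text \<open>Induction over the generated sigma-algebra with \<open>\<delta>\<close> kept arbitrary.
  Complements leave the symmetric difference unchanged; a countable union is first cut to a finite
  one by continuity of the measure.\<close>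

lemma cylinder_approx_set:
  assumes "A \<in> sets P" "\<delta> > 0"
  shows "\<exists>N B. B \<in> sets P \<and> depends_on {..<N} (\<lambda>x. x \<in> B) \<and> P.prob ((A - B) \<union> (B - A)) < \<delta>"
proof -
  have "A \<in> sigma_sets UNIV {{f. f i \<in> X} |i X. X \<in> sets borel}"
    using assms(1) unfolding P_def sets_PiM_single by (simp add: space_PiM)
  then show ?thesis using assms(2)
  proof (induction arbitrary: \<delta> rule: sigma_sets.induct)
    case (Basic A)
    then obtain i X where A: "A = {f. f i \<in> X}" "X \<in> sets borel" by auto
    have "{f \<in> space P. f i \<in> X} \<in> sets P" using A(2) by measurable
    then have "A \<in> sets P" using A by simp
    moreover have "depends_on {..<Suc i} (\<lambda>x. x \<in> A)" by (auto simp: depends_on_def A)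
    ultimately show ?case using Basic.prems by (intro exI[of _ "Suc i"] exI[of _ A]) auto
  next
    case Empty
    then show ?case by (intro exI[of _ 0] exI[of _ "{}"]) (auto simp: depends_on_def)
  next
    case (Compl A)
    obtain N B where B: "B \<in> sets P" "depends_on {..<N} (\<lambda>x. x \<in> B)" "P.prob ((A - B) \<union> (B - A)) < \<delta>"
      using Compl.IH[OF Compl.prems] by blast
    have "UNIV - B \<in> sets P" using B(1) sets.compl_sets[of B P] by simp
    moreover have "depends_on {..<N} (\<lambda>x. x \<in> UNIV - B)" using B(2) by (auto simp: depends_on_def)
    moreover have "((UNIV - A) - (UNIV - B)) \<union> ((UNIV - B) - (UNIV - A)) = (A - B) \<union> (B - A)" by auto
    ultimately show ?case using B(3) by (intro exI[of _ N] exI[of _ "UNIV - B"]) simp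
  next
    case (Union A)
    have A[measurable]: "A i \<in> sets P" for i
      using Union.hyps unfolding P_def sets_PiM_single by (simp add: space_PiM)
    have "(\<lambda>n. P.prob (\<Union>i\<le>n. A i)) \<longlonglongrightarrow> P.prob (\<Union>n. \<Union>i\<le>n. A i)"
      by (intro P.finite_Lim_measure_incseq) (auto simp: incseq_def intro: order_trans)
    moreover have "(\<Union>n. \<Union>i\<le>n. A i) = (\<Union>i. A i)" by auto
    ultimately have "eventually (\<lambda>n. P.prob (\<Union>i. A i) - \<delta>/2 < P.prob (\<Union>i\<le>n. A i)) sequentially"
      using Union.prems by (intro order_tendstoD(1)) auto
    then obtain n where n: "P.prob (\<Union>i. A i) - \<delta>/2 < P.prob (\<Union>i\<le>n. A i)"
      using eventually_happens'[OF sequentially_bot] by blast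
    \<comment> \<open>Half of \<open>\<delta>\<close> was spent on cutting the union; the other half
      is shared by the \<open>Suc n\<close> sets that remain.\<close>
    have "\<exists>N B. B \<in> sets P \<and> depends_on {..<N} (\<lambda>x. x \<in> B) \<and> P.prob ((A i - B) \<union> (B - A i)) < \<delta> / (2 * Suc n)" for i
      using Union.prems by (intro Union.IH) auto
    then obtain N B where B: "\<And>i. B i \<in> sets P" "\<And>i. depends_on {..<N i} (\<lambda>x. x \<in> B i)"
      "\<And>i. P.prob ((A i - B i) \<union> (B i - A i)) < \<delta> / (2 * Suc n)" by metis
    note [measurable] = B(1)
    define K where "K = (\<Sum>i\<le>n. N i)"
    have K: "depends_on {..<K} (\<lambda>x. x \<in> B i)" if "i \<le> n" for i
      using B(2)[of i] by (rule depends_on_mono) (use that in \<open>auto simp: K_def intro: less_le_trans member_le_sum\<close>)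
    define C where "C = (\<Union>i\<le>n. B i)"
    have C[measurable]: "C \<in> sets P" unfolding C_def by measurable
    have "depends_on {..<K} (\<lambda>x. x \<in> C)" using K unfolding depends_on_def C_def UN_iff by (metis atMost_iff)
    moreover have "P.prob (((\<Union>i. A i) - C) \<union> (C - (\<Union>i. A i))) < \<delta>"
    proof -
      have "P.prob (((\<Union>i. A i) - C) \<union> (C - (\<Union>i. A i))) \<le>
          P.prob (((\<Union>i. A i) - (\<Union>i\<le>n. A i)) \<union> (\<Union>i\<le>n. (A i - B i) \<union> (B i - A i)))"
        by (intro P.finite_measure_mono) (auto simp: C_def)
      also have "\<dots> \<le> P.prob ((\<Union>i. A i) - (\<Union>i\<le>n. A i)) + P.prob (\<Union>i\<le>n. (A i - B i) \<union> (B i - A i))"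
        by (intro measure_Un_le) auto
      also have "P.prob ((\<Union>i. A i) - (\<Union>i\<le>n. A i)) = P.prob (\<Union>i. A i) - P.prob (\<Union>i\<le>n. A i)"
        by (intro P.finite_measure_Diff) auto
      also have "P.prob (\<Union>i\<le>n. (A i - B i) \<union> (B i - A i)) \<le> (\<Sum>i\<le>n. P.prob ((A i - B i) \<union> (B i - A i)))"
        by (intro P.finite_measure_subadditive_finite) auto
      also have "\<dots> \<le> (\<Sum>i\<le>n. \<delta> / (2 * Suc n))" using B(3) by (intro sum_mono) (auto simp: less_imp_le)
      also have "\<dots> = \<delta>/2" by (simp add: field_simps)
      finally show ?thesis using n by linarith
    qed
    ultimately show ?case using C by blast
  qed
qed

text \<open>\<open>f\<close> is rounded down to a multiple of \<open>\<delta>\<close>, which costs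
  at most \<open>\<delta>\<close> in value. All but \<open>\<delta>/2\<close> of the mass lies on
  finitely many levels \<open>J\<close>; their level sets \<open>A k\<close> are replaced by
  cylinder sets \<open>B k\<close> at a total cost of \<open>\<delta>/2\<close> in
  probability.\<close>

lemma cylinder_approx:
  assumes [measurable]: "f \<in> borel_measurable P" and \<delta>: "\<delta> > 0"
  shows "\<exists>N g. g \<in> borel_measurable P \<and> depends_on {..<N} g \<and> P.prob {x. \<delta> < \<bar>f x - (g x :: real)\<bar>} < \<delta>"
proof -
  define q where "q x = \<lfloor>f x / \<delta>\<rfloor>" for x
  have q: "q \<in> measurable P (count_space UNIV)" unfolding q_def by measurable
  have sets_q: "{x. Q (q x)} \<in> sets P" for Q
    using measurable_sets[OF q, of "Collect Q"] by (simp add: vimage_def)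
  have "(\<lambda>n. P.prob {x. \<bar>q x\<bar> \<le> int n}) \<longlonglongrightarrow> P.prob (\<Union>n. {x. \<bar>q x\<bar> \<le> int n})"
  proof (intro P.finite_Lim_measure_incseq)
    have "{x. \<bar>q x\<bar> \<le> int n} \<in> sets P" for n by (rule sets_q)
    then show "range (\<lambda>n. {x. \<bar>q x\<bar> \<le> int n}) \<subseteq> P.events" by auto
  qed (auto simp: incseq_def)
  moreover have "(\<Union>n. {x. \<bar>q x\<bar> \<le> int n}) = space P"
  proof -
    have "\<exists>n. \<bar>q x\<bar> \<le> int n" for x by (rule exI[of _ "nat \<bar>q x\<bar>"]) simp
    then show ?thesis by auto
  qed
  ultimately have "eventually (\<lambda>n. 1 - \<delta>/2 < P.prob {x. \<bar>q x\<bar> \<le> int n}) sequentially"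
    using \<delta> P.prob_space by (intro order_tendstoD(1)) auto
  then obtain m where m: "1 - \<delta>/2 < P.prob {x. \<bar>q x\<bar> \<le> int m}"
    using eventually_happens'[OF sequentially_bot] by blast
  define A where "A k = {x. q x = k}" for k
  have A[measurable]: "A k \<in> sets P" for k unfolding A_def by (rule sets_q)
  define J where "J = {- int m..int m}"
  have J: "finite J" "J \<noteq> {}" by (auto simp: J_def)
  then have cJ: "card J > 0" by auto
  have "\<exists>N B. B \<in> sets P \<and> depends_on {..<N} (\<lambda>x. x \<in> B) \<and> P.prob ((A k - B) \<union> (B - A k)) < \<delta> / (2 * card J)" for k
    using \<delta> cJ by (intro cylinder_approx_set) auto
  then obtain N B where B: "\<And>k. B k \<in> sets P" "\<And>k. depends_on {..<N k} (\<lambda>x. x \<in> B k)"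
    "\<And>k. P.prob ((A k - B k) \<union> (B k - A k)) < \<delta> / (2 * card J)" by metis
  note [measurable] = B(1)
  define K where "K = (\<Sum>k\<in>J. N k)"
  have K: "depends_on {..<K} (\<lambda>x. x \<in> B k)" if "k \<in> J" for k
    using B(2)[of k] by (rule depends_on_mono) (use that J in \<open>auto simp: K_def intro: less_le_trans member_le_sum\<close>)
  define g where "g x = \<delta> * (\<Sum>k\<in>J. of_int k * indicator (B k) x)" for x
  have [measurable]: "g \<in> borel_measurable P" unfolding g_def by measurable
  have "depends_on {..<K} g"
    unfolding depends_on_def
  proof (intro allI impI)
    fix x y :: "nat \<Rightarrow> real" assume "\<forall>i\<in>{..<K}. x i = y i"
    then have "x \<in> B k \<longleftrightarrow> y \<in> B k" if "k \<in> J" for k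
      using K[OF that] unfolding depends_on_def by blast
    then have "indicator (B k) x = (indicator (B k) y :: real)" if "k \<in> J" for k
      using that by (simp add: indicator_def)
    then show "g x = g y" unfolding g_def by (auto intro!: sum.cong)
  qed
  moreover have "P.prob {x. \<delta> < \<bar>f x - g x\<bar>} < \<delta>"
  proof -
    let ?D = "\<lambda>k. (A k - B k) \<union> (B k - A k)"
    have good: "\<bar>f x - g x\<bar> \<le> \<delta>" if "\<bar>q x\<bar> \<le> int m" "\<And>k. k \<in> J \<Longrightarrow> x \<notin> ?D k" for x
    proof -
      have qJ: "q x \<in> J" using that(1) by (auto simp: J_def)
      have "indicator (B k) x = (if k = q x then 1 else 0 :: real)" if "k \<in> J" for k
        using \<open>\<And>k. k \<in> J \<Longrightarrow> x \<notin> ?D k\<close>[OF that] by (auto simp: A_def indicator_def)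
      then have "g x = \<delta> * (\<Sum>k\<in>J. if k = q x then of_int k else 0)"
        unfolding g_def by (intro arg_cong[where f="\<lambda>t. \<delta> * t"] sum.cong) auto
      also have "\<dots> = \<delta> * of_int (q x)" using J qJ by (simp add: sum.delta')
      finally have "g x = \<delta> * of_int (q x)" .
      moreover have "of_int (q x) \<le> f x / \<delta>" "f x / \<delta> < of_int (q x) + 1" unfolding q_def by linarith+
      then have "\<delta> * of_int (q x) \<le> f x" "f x < \<delta> * of_int (q x) + \<delta>" using \<delta> by (simp_all add: field_simps)
      ultimately show ?thesis by simp
    qed
    have [measurable]: "{x. \<bar>q x\<bar> \<le> int m} \<in> sets P" by (rule sets_q)
    have "P.prob {x. \<delta> < \<bar>f x - g x\<bar>} \<le> P.prob ((UNIV - {x. \<bar>q x\<bar> \<le> int m}) \<union> (\<Union>k\<in>J. ?D k))"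
    proof (intro P.finite_measure_mono)
      show "{x. \<delta> < \<bar>f x - g x\<bar>} \<subseteq> (UNIV - {x. \<bar>q x\<bar> \<le> int m}) \<union> (\<Union>k\<in>J. ?D k)"
        using good by (force simp: not_less[symmetric])
      show "(UNIV - {x. \<bar>q x\<bar> \<le> int m}) \<union> (\<Union>k\<in>J. ?D k) \<in> P.events"
        using J(1) sets.compl_sets[of "{x. \<bar>q x\<bar> \<le> int m}" P] by (intro sets.Un sets.finite_UN) auto
    qed
    also have "\<dots> \<le> P.prob (UNIV - {x. \<bar>q x\<bar> \<le> int m}) + P.prob (\<Union>k\<in>J. ?D k)"
      using J(1) sets.compl_sets[of "{x. \<bar>q x\<bar> \<le> int m}" P] by (intro measure_Un_le sets.finite_UN) auto
    also have "P.prob (UNIV - {x. \<bar>q x\<bar> \<le> int m}) = 1 - P.prob {x. \<bar>q x\<bar> \<le> int m}"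
      using P.prob_compl[of "{x. \<bar>q x\<bar> \<le> int m}"] by simp
    also have "P.prob (\<Union>k\<in>J. ?D k) \<le> (\<Sum>k\<in>J. P.prob (?D k))"
      using J by (intro P.finite_measure_subadditive_finite) auto
    also have "\<dots> \<le> (\<Sum>k\<in>J. \<delta> / (2 * card J))" using B(3) by (intro sum_mono) (auto simp: less_imp_le)
    also have "\<dots> = \<delta>/2" using cJ by (simp add: field_simps)
    finally show ?thesis using m by linarith
  qed
  ultimately show ?thesis by (intro exI[of _ K] exI[of _ g]) auto
qed

text \<open>Points that differ on a whole tail may be infinitely far apart, so the Lipschitz bound
  cannot be used on them. An approximant \<open>g\<close> of \<open>f\<close> that depends on the
  coordinates below \<open>M\<close> does not see the tail beyond \<open>M\<close>, and the pair is
  exchanged for one that differs only on \<open>{N..<M}\<close>. The bound for that block does not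
  involve \<open>M\<close>, which is chosen after the approximation.\<close>

lemma splice_concentration_tail:
  assumes s: "s > 0" "\<And>n. n \<ge> N \<Longrightarrow> \<sigma> n \<le> s"
    and [measurable]: "f \<in> borel_measurable P" "E \<in> sets P" and E: "P.prob E = 1"
    and lip: "\<And>x y. x \<in> E \<Longrightarrow> y \<in> E \<Longrightarrow> ennreal \<bar>f x - f y\<bar> \<le> l2_dist x y"
    and \<epsilon>: "\<epsilon> > 0" and \<tau>: "\<tau> > 0"
  shows "measure (P \<Otimes>\<^sub>M P) {z. \<epsilon> < \<bar>f (fst z) - f (splice {..<N} (fst z) (snd z))\<bar>}
    \<le> 2 * exp (- (\<epsilon>/2)\<^sup>2 / (4 * s\<^sup>2)) + \<tau>"
proof -
  \<comment> \<open>Four approximation errors occur: together they cost at most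
    \<open>\<epsilon>/2\<close> in value and at most \<open>\<tau>\<close> in probability.\<close>
  define \<delta> where "\<delta> = min (\<epsilon>/8) (\<tau>/4)"
  have \<delta>: "\<delta> > 0" "4 * \<delta> \<le> \<epsilon>/2" "4 * \<delta> \<le> \<tau>" using \<epsilon> \<tau> by (auto simp: \<delta>_def)
  obtain M0 g where g[measurable]: "g \<in> borel_measurable P" and "depends_on {..<M0} g"
    and fg: "P.prob {x. \<delta> < \<bar>f x - g x\<bar>} < \<delta>"
    using cylinder_approx[OF \<open>f \<in> _\<close> \<delta>(1)] by blast
  define M where "M = max N M0"
  have gM: "depends_on {..<M} g" using \<open>depends_on {..<M0} g\<close> by (rule depends_on_mono) (auto simp: M_def)
  let ?PP = "P \<Otimes>\<^sub>M P"
  let ?Q = "?PP \<Otimes>\<^sub>M P"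
  interpret Q: pair_prob_space ?PP P ..
  have spQ: "space ?Q = UNIV" by (simp add: space_pair_measure)
  define V :: "nat set \<Rightarrow> ((nat \<Rightarrow> real) \<times> (nat \<Rightarrow> real)) \<times> (nat \<Rightarrow> real) \<Rightarrow> (nat \<Rightarrow> real) \<times> (nat \<Rightarrow> real)"
    where "V J = (\<lambda>(p, y). ((\<lambda>(x, b). splice J x b) p, y))" for J
  have V[measurable]: "V J \<in> ?Q \<rightarrow>\<^sub>M ?PP" for J unfolding V_def by measurable
  have dV: "distr ?Q ?PP (V J) = ?PP" for J
  proof -
    have "distr P P (\<lambda>y. y) = P" by (rule distr_id2) simp
    moreover have "distr ?PP P (\<lambda>(x, b). splice J x b) \<Otimes>\<^sub>M distr P P (\<lambda>y. y) = distr ?Q ?PP (V J)"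
      unfolding V_def
    proof (rule pair_measure_distr)
      show "sigma_finite_measure (distr P P (\<lambda>y. y))"
        unfolding \<open>distr P P (\<lambda>y. y) = P\<close> by (rule P.sigma_finite_measure)
    qed measurable
    ultimately show ?thesis by (simp only: distr_splice_P)
  qed
  have m1: "measure ?Q {\<omega>. \<delta> < \<bar>f (T \<omega>) - g (T \<omega>)\<bar>} < \<delta>" "{\<omega>. \<delta> < \<bar>f (T \<omega>) - g (T \<omega>)\<bar>} \<in> sets ?Q"
    if [measurable]: "T \<in> ?Q \<rightarrow>\<^sub>M P" and d: "distr ?Q P T = P" for T
  proof -
    have S: "{x \<in> space P. \<delta> < \<bar>f x - g x\<bar>} \<in> sets P" by measurable
    show "measure ?Q {\<omega>. \<delta> < \<bar>f (T \<omega>) - g (T \<omega>)\<bar>} < \<delta>"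
      using measure_vimage_P[OF that S] fg spQ by (simp add: vimage_def)
    have "{\<omega> \<in> space ?Q. \<delta> < \<bar>f (T \<omega>) - g (T \<omega>)\<bar>} \<in> sets ?Q" by measurable
    then show "{\<omega>. \<delta> < \<bar>f (T \<omega>) - g (T \<omega>)\<bar>} \<in> sets ?Q" by (simp add: spQ)
  qed
  \<comment> \<open>From independent \<open>x\<close>, \<open>b\<close>, \<open>y\<close>:
    \<open>T1\<close> is \<open>x\<close>, and \<open>T2\<close> is \<open>x\<close> below
    \<open>N\<close> and \<open>y\<close> from there on. \<open>T3\<close> is \<open>x\<close> below
    \<open>M\<close> and \<open>b\<close> beyond, and \<open>T4\<close> is \<open>T3\<close> with
    the block \<open>{N..<M}\<close> taken from \<open>y\<close>. All four have law
    \<open>P\<close>; \<open>g\<close> cannot tell \<open>T1\<close> from \<open>T3\<close> nor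
    \<open>T2\<close> from \<open>T4\<close>.\<close>
  define T1 where "T1 = (\<lambda>\<omega>. fst (V UNIV \<omega>))"
  define T2 where "T2 = (\<lambda>\<omega>. splice {..<N} (fst (V UNIV \<omega>)) (snd (V UNIV \<omega>)))"
  define T3 where "T3 = (\<lambda>\<omega>. fst (V {..<M} \<omega>))"
  define T4 where "T4 = (\<lambda>\<omega>. splice {N..<M} (snd (V {..<M} \<omega>)) (fst (V {..<M} \<omega>)))"
  have [measurable]: "T1 \<in> ?Q \<rightarrow>\<^sub>M P" "T2 \<in> ?Q \<rightarrow>\<^sub>M P" "T3 \<in> ?Q \<rightarrow>\<^sub>M P" "T4 \<in> ?Q \<rightarrow>\<^sub>M P"
    unfolding T1_def T2_def T3_def T4_def by measurable
  have comp: "distr ?Q P (\<lambda>\<omega>. S (V J \<omega>)) = P" if "S \<in> ?PP \<rightarrow>\<^sub>M P" "distr ?PP P S = P" for J S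
    using distr_distr[OF that(1) V[of J]] that(2) dV[of J] by (simp add: comp_def)
  have ds: "distr ?PP P (\<lambda>z. splice K (fst z) (snd z)) = P" "distr ?PP P (\<lambda>z. splice K (snd z) (fst z)) = P" for K
    using distr_splice_P[of K] distr_splice_P'[of K] by (simp_all add: split_beta')
  have "distr ?PP P fst = P" using ds(1)[of UNIV] by (simp add: splice_def)
  then have d: "distr ?Q P T1 = P" "distr ?Q P T2 = P" "distr ?Q P T3 = P" "distr ?Q P T4 = P"
    unfolding T1_def T2_def T3_def T4_def
    using comp[of fst] comp[OF _ ds(1)] comp[OF _ ds(2)] by auto
  have g13: "g (T1 \<omega>) = g (T3 \<omega>)" for \<omega>
  proof -
    have "\<forall>i\<in>{..<M}. T1 \<omega> i = T3 \<omega> i" by (auto simp: T1_def T3_def V_def splice_def split_beta)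
    then show ?thesis using gM unfolding depends_on_def by blast
  qed
  have g24: "g (T2 \<omega>) = g (T4 \<omega>)" for \<omega>
  proof -
    have "\<forall>i\<in>{..<M}. T2 \<omega> i = T4 \<omega> i" by (auto simp: T2_def T4_def V_def splice_def split_beta)
    then show ?thesis using gM unfolding depends_on_def by blast
  qed
  let ?B = "\<lambda>T. {\<omega>. \<delta> < \<bar>f (T \<omega>) - g (T \<omega>)\<bar>}"
  let ?R = "{\<omega>. \<epsilon>/2 < \<bar>f (T3 \<omega>) - f (T4 \<omega>)\<bar>}"
  have R: "?R \<in> sets ?Q"
  proof -
    have "{\<omega> \<in> space ?Q. \<epsilon>/2 < \<bar>f (T3 \<omega>) - f (T4 \<omega>)\<bar>} \<in> sets ?Q" by measurable
    then show ?thesis by (simp add: spQ)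
  qed
  have mR: "measure ?Q ?R \<le> 2 * exp (- (\<epsilon>/2)\<^sup>2 / (4 * s\<^sup>2))"
  proof -
    have S: "{z \<in> space ?PP. \<epsilon>/2 < \<bar>f (fst z) - f (splice {N..<M} (snd z) (fst z))\<bar>} \<in> sets ?PP" by measurable
    have "measure ?Q ?R = measure ?PP {z. \<epsilon>/2 < \<bar>f (fst z) - f (splice {N..<M} (snd z) (fst z))\<bar>}"
      using measure_vimage_P[OF V dV S, of "{..<M}"] spQ
      by (simp add: vimage_def space_pair_measure T3_def T4_def)
    also have "\<dots> \<le> 2 * exp (- (\<epsilon>/2)\<^sup>2 / (4 * s\<^sup>2))"
      using s \<epsilon> by (intro splice_concentration_finite[OF _ _ _ _ _ E lip]) auto
    finally show ?thesis .
  qed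
  have S: "{z \<in> space ?PP. \<epsilon> < \<bar>f (fst z) - f (splice {..<N} (fst z) (snd z))\<bar>} \<in> sets ?PP" by measurable
  have "measure ?PP {z. \<epsilon> < \<bar>f (fst z) - f (splice {..<N} (fst z) (snd z))\<bar>}
      = measure ?Q {\<omega>. \<epsilon> < \<bar>f (T1 \<omega>) - f (T2 \<omega>)\<bar>}"
    using measure_vimage_P[OF V dV S, of UNIV] spQ
    by (simp add: vimage_def space_pair_measure T1_def T2_def)
  also have "\<dots> \<le> measure ?Q (((?B T1 \<union> ?B T2) \<union> (?B T3 \<union> ?B T4)) \<union> ?R)"
  proof (intro Q.finite_measure_mono subsetI)
    fix \<omega> assume \<omega>: "\<omega> \<in> {\<omega>. \<epsilon> < \<bar>f (T1 \<omega>) - f (T2 \<omega>)\<bar>}"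
    show "\<omega> \<in> ((?B T1 \<union> ?B T2) \<union> (?B T3 \<union> ?B T4)) \<union> ?R"
    proof (rule ccontr)
      assume "\<not> ?thesis"
      then have "\<bar>f (T1 \<omega>) - g (T1 \<omega>)\<bar> \<le> \<delta>" "\<bar>f (T2 \<omega>) - g (T2 \<omega>)\<bar> \<le> \<delta>" "\<bar>f (T3 \<omega>) - g (T1 \<omega>)\<bar> \<le> \<delta>"
        "\<bar>f (T4 \<omega>) - g (T2 \<omega>)\<bar> \<le> \<delta>" "\<bar>f (T3 \<omega>) - f (T4 \<omega>)\<bar> \<le> \<epsilon>/2"
        by (auto simp: not_less g13 g24)
      then have "\<bar>f (T1 \<omega>) - f (T2 \<omega>)\<bar> \<le> 4 * \<delta> + \<epsilon>/2" by linarith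
      then show False using \<omega> \<delta> by simp
    qed
  qed (use m1(2) R d in \<open>intro sets.Un, simp_all\<close>)
  also have "\<dots> \<le> ((measure ?Q (?B T1) + measure ?Q (?B T2)) + (measure ?Q (?B T3) + measure ?Q (?B T4))) + measure ?Q ?R"
    using m1(2) R d by (intro order_trans[OF measure_Un_le] add_mono sets.Un order_refl) simp_all
  also have "\<dots> \<le> ((\<delta> + \<delta>) + (\<delta> + \<delta>)) + 2 * exp (- (\<epsilon>/2)\<^sup>2 / (4 * s\<^sup>2))"
    using m1(1) d mR by (intro add_mono) (simp_all add: less_imp_le)
  finally show ?thesis using \<delta> by linarith
qed

text \<open>If almost every section in \<open>y\<close> had an exceptional set of mass at least
  \<open>\<epsilon>\<close>, so would the product. A good \<open>y\<close> turns the tail estimate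
  into an approximation of \<open>f\<close> by a function of the first \<open>N\<close> coordinates
  that inherits the Lipschitz bound almost everywhere.\<close>

lemma exists_good_section:
  assumes [measurable]: "f \<in> borel_measurable P" "E \<in> sets P" and E: "P.prob E = 1"
    and lt: "measure (P \<Otimes>\<^sub>M P) {z. \<epsilon> < \<bar>f (fst z) - f (splice {..<N} (fst z) (snd z))\<bar>} < \<epsilon>"
  shows "\<exists>y. P.prob {x. \<epsilon> < \<bar>f x - f (splice {..<N} x y)\<bar>} < \<epsilon> \<and> (AE x in P. splice {..<N} x y \<in> E)"
proof (rule ccontr)
  assume neg: "\<not> ?thesis"
  let ?A = "{z. \<epsilon> < \<bar>f (fst z) - f (splice {..<N} (fst z) (snd z))\<bar>}"
  have A: "?A \<in> sets (P \<Otimes>\<^sub>M P)"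
    by (rule sets_PP_Collect) measurable
  have "AE y in P. AE x in P. splice {..<N} x y \<in> E" using E by (intro AE_splice P.AE_prob_1)
  then have ge: "AE y in P. ennreal \<epsilon> \<le> emeasure P ((\<lambda>x. (x, y)) -` ?A)"
  proof eventually_elim
    case (elim y)
    then have "\<epsilon> \<le> P.prob {x. \<epsilon> < \<bar>f x - f (splice {..<N} x y)\<bar>}" using neg by (auto simp: not_less)
    then show ?case by (simp add: vimage_def P.emeasure_eq_measure ennreal_leI)
  qed
  have "ennreal \<epsilon> = (\<integral>\<^sup>+y. ennreal \<epsilon> \<partial>P)" by (simp add: P.emeasure_space_1[simplified])
  also have "\<dots> \<le> (\<integral>\<^sup>+y. emeasure P ((\<lambda>x. (x, y)) -` ?A) \<partial>P)" by (rule nn_integral_mono_AE[OF ge])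
  also have "\<dots> = emeasure (P \<Otimes>\<^sub>M P) ?A" by (rule PP.emeasure_pair_measure_alt2[OF A, symmetric])
  finally show False using lt by (simp add: PP.emeasure_eq_measure)
qed

end

section \<open>Compactness of the 1-Lipschitz functions modulo constants\<close>

text \<open>The diagonal argument in the form of Tychonoff's theorem: a product of compact intervals
  is compact, and sequentially compact because the sequence space is first countable.\<close>

lemma bounded_diagonal_subseq:
  fixes a :: "nat \<Rightarrow> nat \<Rightarrow> real"
  assumes "\<And>k i. \<bar>a k i\<bar> \<le> B i"
  shows "\<exists>r. strict_mono r \<and> (\<forall>i. convergent (\<lambda>k. a (r k) i))"
proof -
  let ?K = "\<Pi>\<^sub>E i\<in>UNIV. {- B i..B i}"
  have "compactin (product_topology (\<lambda>_. euclidean) UNIV) ?K"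
    unfolding compactin_PiE by simp
  then have "compact ?K" by (metis euclidean_product_topology compactin_euclidean_iff)
  then have "seq_compact ?K" by (rule compact_imp_seq_compact)
  moreover have "a k \<in> ?K" for k using assms[of k] by (auto simp: abs_le_iff minus_le_iff)
  ultimately obtain l r where r: "strict_mono r" "(a \<circ> r) \<longlonglongrightarrow> l"
    unfolding seq_compact_def by metis
  have "(\<lambda>k. a (r k) i) \<longlonglongrightarrow> l i" for i
  proof -
    have "isCont (\<lambda>x :: nat \<Rightarrow> real. x i) l"
      by (rule continuous_on_interior[OF continuous_on_product_coordinates]) simp
    from isCont_tendsto_compose[OF this r(2)] show ?thesis by (simp add: comp_def)
  qed
  then show ?thesis using r(1) unfolding convergent_def by blast
qed

lemma coordinate_le_l2_dist: "ennreal \<bar>x n - y n\<bar> \<le> l2_dist x y"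
proof (cases "summable (\<lambda>n. (x n - y n)\<^sup>2)")
  case True
  have "(\<Sum>i\<in>{n}. (x i - y i)\<^sup>2) \<le> (\<Sum>n. (x n - y n)\<^sup>2)" by (rule sum_le_suminf[OF True]) auto
  then have "sqrt ((x n - y n)\<^sup>2) \<le> sqrt (\<Sum>n. (x n - y n)\<^sup>2)" by (intro real_sqrt_le_mono) simp
  then show ?thesis using True by (simp add: l2_dist_def ennreal_leI)
qed (simp add: l2_dist_def)

text \<open>The density is at most \<open>1 / (2 * s)\<close>, because
  \<open>2 \<le> sqrt (2 * pi)\<close>, and the interval has length
  \<open>2 * \<epsilon>\<close>.\<close>

lemma emeasure_gauss_interval:
  assumes s: "s > 0" and \<epsilon>: "\<epsilon> \<ge> 0"
  shows "emeasure (gauss s) {t. \<bar>t - u\<bar> \<le> \<epsilon>} \<le> ennreal (\<epsilon> / s)"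
proof -
  have eq: "{t. \<bar>t - u\<bar> \<le> \<epsilon>} = {u - \<epsilon>..u + \<epsilon>}" by (auto simp: abs_le_iff)
  have "2 \<le> sqrt (2 * pi)" using pi_ge_two by (intro real_le_rsqrt) simp
  then have c: "normal_density 0 s x \<le> 1 / (2 * s)" for x
  proof -
    have "normal_density 0 s x = exp (- x\<^sup>2 / (2 * s\<^sup>2)) / (s * sqrt (2 * pi))"
      using s by (simp add: normal_density_def real_sqrt_mult)
    also have "\<dots> \<le> 1 / (s * 2)" using s \<open>2 \<le> sqrt (2 * pi)\<close> by (intro frac_le mult_left_mono) auto
    finally show ?thesis by (simp add: mult.commute)
  qed
  have "emeasure (gauss s) {u - \<epsilon>..u + \<epsilon>} =
      (\<integral>\<^sup>+x. ennreal (normal_density 0 s x) * indicator {u - \<epsilon>..u + \<epsilon>} x \<partial>lborel)"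
    by (rule emeasure_density) auto
  also have "\<dots> \<le> (\<integral>\<^sup>+x. ennreal (1 / (2 * s)) * indicator {u - \<epsilon>..u + \<epsilon>} x \<partial>lborel)"
    by (intro nn_integral_mono mult_right_mono ennreal_leI c) auto
  also have "\<dots> = ennreal (1 / (2 * s)) * ennreal (2 * \<epsilon>)"
    using \<epsilon> by (subst nn_integral_cmult_indicator) auto
  also have "\<dots> = ennreal (\<epsilon> / s)" using s \<epsilon> by (simp add: ennreal_mult[symmetric])
  finally show ?thesis unfolding eq .
qed

section \<open>Failure of compactness when the variances do not tend to 0\<close>

context gauss_seq
begin

lemma emm_meas_eq: "emm_meas (gaussian_R_infinity \<sigma>) = P"
  by (simp add: gaussian_R_infinity_def P_def)

lemma mem_ae_Lip1_iff: "f \<in> ae_Lip1 (gaussian_R_infinity \<sigma>) \<longleftrightarrow> f \<in> borel_measurable P \<and>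
    (\<exists>E\<in>sets P. P.prob E = 1 \<and> (\<forall>x\<in>E. \<forall>y\<in>E. ennreal \<bar>f x - f y\<bar> \<le> l2_dist x y))"
  by (auto simp: ae_Lip1_def emm_meas_eq P.emeasure_eq_measure) (auto simp: gaussian_R_infinity_def)

lemma distr_coord: "distr P (gauss (\<sigma> n)) (\<lambda>x. x n) = gauss (\<sigma> n)"
  unfolding P_def by (rule G.PiM_component) simp

lemma emeasure_coord:
  assumes "A \<in> sets borel" shows "emeasure P {x. x n \<in> A} = emeasure (gauss (\<sigma> n)) A"
proof -
  have "(\<lambda>x. x n) \<in> P \<rightarrow>\<^sub>M gauss (\<sigma> n)" unfolding P_def by (rule measurable_component_singleton) simp
  then have "emeasure (distr P (gauss (\<sigma> n)) (\<lambda>x. x n)) A = emeasure P ((\<lambda>x. x n) -` A \<inter> space P)"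
    using assms by (intro emeasure_distr) auto
  then show ?thesis by (simp add: distr_coord vimage_def)
qed

text \<open>Resampling coordinate \<open>a\<close> makes it independent of \<open>x b\<close>. With
  \<open>x b + c\<close> frozen, \<open>x a\<close> has to hit an interval of half-width
  \<open>\<epsilon>\<close>, whose mass is at most \<open>\<epsilon> / \<sigma> a\<close>.\<close>

lemma coordinates_separated:
  assumes "a \<noteq> b" "\<epsilon> > 0" "2 * \<epsilon> \<le> \<sigma> a"
  shows "P.prob {x. \<bar>x a - (x b + c)\<bar> \<le> \<epsilon>} \<le> 1/2"
proof -
  let ?A = "{x. \<bar>x a - (x b + c)\<bar> \<le> \<epsilon>}"
  have A: "?A \<in> sets P"
    by (rule sets_P_Collect) measurable
  have B: "{z. \<bar>fst z a - (snd z b + c)\<bar> \<le> \<epsilon>} \<in> sets (P \<Otimes>\<^sub>M P)"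
    by (rule sets_PP_Collect) measurable
  have "emeasure P ?A = emeasure (P \<Otimes>\<^sub>M P) ((\<lambda>(x, y). splice {a} x y) -` ?A \<inter> space (P \<Otimes>\<^sub>M P))"
    using A by (subst distr_splice_P[of "{a}", symmetric], subst emeasure_distr) auto
  also have "(\<lambda>(x, y). splice {a} x y) -` ?A \<inter> space (P \<Otimes>\<^sub>M P) = {z. \<bar>fst z a - (snd z b + c)\<bar> \<le> \<epsilon>}"
    using assms(1) by (auto simp: splice_def space_pair_measure)
  also have "emeasure (P \<Otimes>\<^sub>M P) \<dots> = (\<integral>\<^sup>+y. emeasure P ((\<lambda>x. (x, y)) -` {z. \<bar>fst z a - (snd z b + c)\<bar> \<le> \<epsilon>}) \<partial>P)"
    by (rule PP.emeasure_pair_measure_alt2[OF B])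
  also have "\<dots> \<le> (\<integral>\<^sup>+y. ennreal (1/2) \<partial>P)"
  proof (rule nn_integral_mono)
    fix y
    have "emeasure P ((\<lambda>x. (x, y)) -` {z. \<bar>fst z a - (snd z b + c)\<bar> \<le> \<epsilon>}) = emeasure P {x. x a \<in> {t. \<bar>t - (y b + c)\<bar> \<le> \<epsilon>}}"
      by (simp add: vimage_def)
    also have "\<dots> = emeasure (gauss (\<sigma> a)) {t. \<bar>t - (y b + c)\<bar> \<le> \<epsilon>}" by (intro emeasure_coord) measurable
    also have "\<dots> \<le> ennreal (\<epsilon> / \<sigma> a)" using pos assms by (intro emeasure_gauss_interval) auto
    also have "\<dots> \<le> ennreal (1/2)" using pos[of a] assms by (intro ennreal_leI) (simp add: field_simps)
    finally show "emeasure P ((\<lambda>x. (x, y)) -` {z. \<bar>fst z a - (snd z b + c)\<bar> \<le> \<epsilon>}) \<le> ennreal (1/2)" .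
  qed
  also have "\<dots> = ennreal (1/2)" by (simp add: P.emeasure_space_1[simplified])
  finally show ?thesis unfolding P.emeasure_eq_measure by (subst (asm) ennreal_le_iff) auto
qed

lemma concentrated_imp_tendsto_0:
  assumes "concentrated (gaussian_R_infinity \<sigma>)"
  shows "\<sigma> \<longlonglongrightarrow> 0"
proof (rule ccontr)
  assume "\<not> \<sigma> \<longlonglongrightarrow> 0"
  then obtain \<delta> where \<delta>: "\<delta> > 0" "\<not> eventually (\<lambda>n. dist (\<sigma> n) 0 < \<delta>) sequentially"
    unfolding tendsto_iff by blast
  define S where "S = {n. \<delta> \<le> \<sigma> n}"
  have "infinite S"
    unfolding S_def infinite_nat_iff_unbounded_le
    using \<delta>(2) pos by (force simp: eventually_sequentially not_less abs_of_pos)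
  define f where "f k = (\<lambda>x :: nat \<Rightarrow> real. x (enumerate S k))" for k
  \<comment> \<open>The first bound gives \<open>2 * \<epsilon> \<le> \<sigma>\<close> on
    \<open>S\<close>; the second makes the remaining mass 1/2 at least
    \<open>\<epsilon>\<close>.\<close>
  define \<epsilon> where "\<epsilon> = min (\<delta>/2) (1/2)"
  have \<epsilon>: "\<epsilon> > 0" using \<delta> by (simp add: \<epsilon>_def)
  have "\<not> concentrated (gaussian_R_infinity \<sigma>)"
  proof (rule not_concentratedI)
    show "prob_space (emm_meas (gaussian_R_infinity \<sigma>))" unfolding emm_meas_eq by (rule P.prob_space_axioms)
    show "f k \<in> ae_Lip1 (gaussian_R_infinity \<sigma>)" for k
      unfolding mem_ae_Lip1_iff f_def
      using sets.top[of P] by (intro conjI bexI[of _ "space P"]) (auto simp: coordinate_le_l2_dist P.prob_space[simplified])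
    show "\<epsilon> > 0" by fact
    fix m n :: nat and c :: real assume "m \<noteq> n"
    then have ne: "enumerate S m \<noteq> enumerate S n"
      using strict_mono_enumerate[OF \<open>infinite S\<close>] strict_mono_eq by blast
    have "\<delta> \<le> \<sigma> (enumerate S m)" using enumerate_in_set[OF \<open>infinite S\<close>, of m] by (simp add: S_def)
    then have le: "P.prob {x. \<bar>x (enumerate S m) - (x (enumerate S n) + c)\<bar> \<le> \<epsilon>} \<le> 1/2"
      by (intro coordinates_separated ne \<epsilon>) (auto simp: \<epsilon>_def)
    have A: "{x \<in> space P. \<bar>x (enumerate S m) - (x (enumerate S n) + c)\<bar> \<le> \<epsilon>} \<in> sets P" by measurable
    have "P.prob (space P - {x \<in> space P. \<bar>x (enumerate S m) - (x (enumerate S n) + c)\<bar> \<le> \<epsilon>}) \<ge> 1/2"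
      using P.prob_compl[OF A] le by simp
    also have "space P - {x \<in> space P. \<bar>x (enumerate S m) - (x (enumerate S n) + c)\<bar> \<le> \<epsilon>} =
        {x \<in> space P. \<epsilon> < \<bar>f m x - (f n x + c)\<bar>}" by (auto simp: f_def)
    finally show "\<epsilon> \<le> measure (emm_meas (gaussian_R_infinity \<sigma>))
        {x \<in> space (emm_meas (gaussian_R_infinity \<sigma>)). \<epsilon> < \<bar>f m x - (f n x + c)\<bar>}"
      unfolding emm_meas_eq by (simp add: \<epsilon>_def)
  qed
  then show False using assms by simp
qed

section \<open>Compactness when the variances tend to 0\<close>

lemma distr_fst_P: "distr (P \<Otimes>\<^sub>M P) P fst = P"
  using distr_splice_P[of UNIV] by (simp add: splice_def split_beta')

lemma distr_snd_P: "distr (P \<Otimes>\<^sub>M P) P snd = P"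
  using distr_splice_P[of "{}"] by (simp add: splice_def split_beta')

text \<open>The cut-off \<open>N\<close> is determined by \<open>\<sigma>\<close> and
  \<open>e\<close> alone, and so serves every \<open>f\<close> and \<open>E\<close> at once. This
  uniformity is the input to compactness.\<close>

lemma splice_uniform_approx:
  assumes "\<sigma> \<longlonglongrightarrow> 0" and e: "e > 0"
  shows "\<exists>N. \<forall>f E. f \<in> borel_measurable P \<longrightarrow> E \<in> sets P \<longrightarrow> P.prob E = 1 \<longrightarrow>
      (\<forall>x\<in>E. \<forall>y\<in>E. ennreal \<bar>f x - f y\<bar> \<le> l2_dist x y) \<longrightarrow>
      measure (P \<Otimes>\<^sub>M P) {z. e < \<bar>f (fst z) - f (splice {..<N} (fst z) (snd z))\<bar>} < e"
proof -
  \<comment> \<open>Chosen so that the exponent \<open>(e/2)\<^sup>2 / (4 * s\<^sup>2)\<close>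
    equals \<open>4 / e\<close>. Since \<open>exp (4 / e)\<close> exceeds \<open>4 / e\<close>, the
    Gaussian term is below \<open>e/2\<close>, and \<open>e/4\<close> is left for
    \<open>\<tau>\<close>.\<close>
  define s where "s = sqrt (e^3 / 64)"
  have s: "s > 0" "s\<^sup>2 = e^3 / 64" using e by (auto simp: s_def)
  have "eventually (\<lambda>n. \<sigma> n < s) sequentially" using order_tendstoD(2)[OF assms(1) s(1)] .
  then obtain N where N: "\<And>n. n \<ge> N \<Longrightarrow> \<sigma> n < s" by (auto simp: eventually_sequentially)
  have "2 * exp (- (e/2)\<^sup>2 / (4 * s\<^sup>2)) < e / 2"
  proof -
    have "(e/2)\<^sup>2 / (4 * s\<^sup>2) = 4 / e" unfolding s(2) using e by (simp add: power2_eq_square power3_eq_cube field_simps)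
    then have "exp (- (e/2)\<^sup>2 / (4 * s\<^sup>2)) = 1 / exp (4 / e)" by (simp add: exp_minus field_simps)
    also have "4 / e < exp (4 / e)" using exp_ge_add_one_self[of "4 / e"] by linarith
    then have "1 / exp (4 / e) < 1 / (4 / e)" using e by (intro divide_strict_left_mono) auto
    finally show ?thesis using e by simp
  qed
  then have "2 * exp (- (e/2)\<^sup>2 / (4 * s\<^sup>2)) + e/4 < e" using e by linarith
  then have "measure (P \<Otimes>\<^sub>M P) {z. e < \<bar>f (fst z) - f (splice {..<N} (fst z) (snd z))\<bar>} < e"
    if "f \<in> borel_measurable P" "E \<in> sets P" "P.prob E = 1"
      "\<forall>x\<in>E. \<forall>y\<in>E. ennreal \<bar>f x - f y\<bar> \<le> l2_dist x y" for f E
    using splice_concentration_tail[OF s(1) _ that(1-3) _ e, of N "e/4"] N that(4) e by (force simp: less_imp_le)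
  then show ?thesis by blast
qed

lemma tendsto_0_imp_concentrated:
  assumes \<sigma>: "\<sigma> \<longlonglongrightarrow> 0"
  shows "concentrated (gaussian_R_infinity \<sigma>)"
proof (rule concentratedI)
  show "prob_space (emm_meas (gaussian_R_infinity \<sigma>))" unfolding emm_meas_eq by (rule P.prob_space_axioms)
  fix f :: "nat \<Rightarrow> (nat \<Rightarrow> real) \<Rightarrow> real" assume "\<And>n. f n \<in> ae_Lip1 (gaussian_R_infinity \<sigma>)"
  then have f[measurable]: "\<And>n. f n \<in> borel_measurable P" and "\<And>n. \<exists>E\<in>sets P. P.prob E = 1 \<and>
      (\<forall>x\<in>E. \<forall>y\<in>E. ennreal \<bar>f n x - f n y\<bar> \<le> l2_dist x y)"
    by (auto simp: mem_ae_Lip1_iff)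
  then obtain E where E[measurable]: "\<And>n. E n \<in> sets P" and E1: "\<And>n. P.prob (E n) = 1"
    and lip: "\<And>n x y. x \<in> E n \<Longrightarrow> y \<in> E n \<Longrightarrow> ennreal \<bar>f n x - f n y\<bar> \<le> l2_dist x y" by metis
  define e :: "nat \<Rightarrow> real" where "e j = (1/2)^j" for j
  have e: "e j > 0" for j by (simp add: e_def)
  have exN: "\<exists>N. \<forall>k. measure (P \<Otimes>\<^sub>M P) {z. e j < \<bar>f k (fst z) - f k (splice {..<N} (fst z) (snd z))\<bar>} < e j" for j
  proof -
    obtain N where N: "\<forall>f E. f \<in> borel_measurable P \<longrightarrow> E \<in> sets P \<longrightarrow> P.prob E = 1 \<longrightarrow>
      (\<forall>x\<in>E. \<forall>y\<in>E. ennreal \<bar>f x - f y\<bar> \<le> l2_dist x y) \<longrightarrow>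
      measure (P \<Otimes>\<^sub>M P) {z. e j < \<bar>f (fst z) - f (splice {..<N} (fst z) (snd z))\<bar>} < e j"
      using splice_uniform_approx[OF \<sigma> e, of j] by (elim exE)
    show ?thesis using N[rule_format, OF f E E1 lip] by blast
  qed
  define N where "N j = (SOME N. \<forall>k. measure (P \<Otimes>\<^sub>M P)
      {z. e j < \<bar>f k (fst z) - f k (splice {..<N} (fst z) (snd z))\<bar>} < e j)" for j
  have N: "measure (P \<Otimes>\<^sub>M P) {z. e j < \<bar>f k (fst z) - f k (splice {..<N j} (fst z) (snd z))\<bar>} < e j" for j k
    unfolding N_def by (rule someI_ex[OF exN, THEN spec])
  have exy: "\<exists>y. P.prob {x. e j < \<bar>f k x - f k (splice {..<N j} x y)\<bar>} < e j \<and>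
      (AE x in P. splice {..<N j} x y \<in> E k)" for j k
    by (rule exists_good_section[OF f E E1 N])
  define y where "y j k = (SOME y. P.prob {x. e j < \<bar>f k x - f k (splice {..<N j} x y)\<bar>} < e j \<and>
      (AE x in P. splice {..<N j} x y \<in> E k))" for j k
  have y: "P.prob {x. e j < \<bar>f k x - f k (splice {..<N j} x (y j k))\<bar>} < e j"
    and yE: "AE x in P. splice {..<N j} x (y j k) \<in> E k" for j k
    unfolding y_def using someI_ex[OF exy] by blast+
  define g where "g k j x = f k (splice {..<N j} x (y j k))" for k j x
  have g[measurable]: "g k j \<in> borel_measurable P" for k j
  proof -
    have "(\<lambda>x. splice {..<N j} x (y j k)) \<in> P \<rightarrow>\<^sub>M P"
      by (intro measurable_splice_P measurable_ident measurable_const) simp_all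
    then show ?thesis unfolding g_def using f by (rule measurable_compose)
  qed
  \<comment> \<open>One set for all \<open>k\<close>, still of full measure as a countable
    intersection; the Lipschitz bound of every \<open>g k j\<close> holds on it.\<close>
  define F where "F j = {x. \<forall>k. splice {..<N j} x (y j k) \<in> E k}" for j
  have AE_F: "AE x in P. x \<in> F j" for j using yE[of j] by (simp add: F_def AE_all_countable)
  define \<rho> where "\<rho> j x x' = sqrt (\<Sum>i<N j. (x i - x' i)\<^sup>2)" for j and x x' :: "nat \<Rightarrow> real"
  have g_lip: "\<bar>g k j x - g k j x'\<bar> \<le> \<rho> j x x'" if "x \<in> F j" "x' \<in> F j" for k j x x'
  proof -
    have "ennreal \<bar>g k j x - g k j x'\<bar> \<le> l2_dist (splice {..<N j} x (y j k)) (splice {..<N j} x' (y j k))"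
      unfolding g_def using that by (intro lip) (auto simp: F_def)
    then show ?thesis by (simp add: l2_dist_splice \<rho>_def sum_nonneg)
  qed
  have exq: "\<exists>q :: nat \<Rightarrow> nat \<Rightarrow> real. range q \<subseteq> F j \<and> (\<forall>x\<in>F j. \<forall>\<epsilon>>0. \<exists>n. \<rho> j x (q n) < \<epsilon>)" for j
  proof -
    have "F j \<noteq> {}"
    proof
      assume "F j = {}"
      then have "AE x in P. False" using AE_F[of j] by simp
      then show False by (simp add: P.AE_False)
    qed
    obtain D where D: "countable D" "D \<subseteq> F j" "F j \<subseteq> closure D" by (rule separable)
    have "D \<noteq> {}" using D(3) \<open>F j \<noteq> {}\<close> by auto
    have "\<exists>n. \<rho> j x (from_nat_into D n) < \<epsilon>" if "x \<in> F j" "\<epsilon> > 0" for x \<epsilon>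
    proof -
      have "continuous_on UNIV (\<lambda>x'. \<rho> j x x')"
        unfolding \<rho>_def by (intro continuous_intros continuous_on_product_coordinates)
      then have "open {x'. \<rho> j x x' < \<epsilon>}" by (intro open_Collect_less continuous_on_const)
      moreover have "x \<in> {x'. \<rho> j x x' < \<epsilon>}" using that by (simp add: \<rho>_def)
      moreover have "x \<in> closure D" using D that by blast
      ultimately obtain d where "d \<in> D" "\<rho> j x d < \<epsilon>"
        using open_Int_closure_eq_empty[of "{x'. \<rho> j x x' < \<epsilon>}" D] by blast
      then show ?thesis using from_nat_into_surj[OF D(1)] by metis
    qed
    moreover have "range (from_nat_into D) \<subseteq> F j" using D \<open>D \<noteq> {}\<close> by (simp add: range_from_nat_into)
    ultimately have "range (from_nat_into D) \<subseteq> F j \<and>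
        (\<forall>x\<in>F j. \<forall>\<epsilon>>0. \<exists>n. \<rho> j x (from_nat_into D n) < \<epsilon>)" by simp
    then show ?thesis by (rule exI[where x = "from_nat_into D"])
  qed
  define q where "q j = (SOME q :: nat \<Rightarrow> nat \<Rightarrow> real. range q \<subseteq> F j \<and> (\<forall>x\<in>F j. \<forall>\<epsilon>>0. \<exists>n. \<rho> j x (q n) < \<epsilon>))" for j
  have q: "range (q j) \<subseteq> F j" and dense: "x \<in> F j \<Longrightarrow> \<epsilon> > 0 \<Longrightarrow> \<exists>n. \<rho> j x (q j n) < \<epsilon>" for j x \<epsilon>
    unfolding q_def using someI_ex[OF exq, of j] by blast+
  have qF: "q j n \<in> F j" for j n using q by blast
  \<comment> \<open>The values themselves may be unbounded, but differences to the base point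
    \<open>q j 0\<close> are bounded by \<open>\<rho> j\<close>, uniformly in \<open>k\<close>.
    Coding \<open>(j, n)\<close> as one index lets one subsequence serve all accuracies.\<close>
  define a where "a k i = (case prod_decode i of (j, n) \<Rightarrow> g k j (q j n) - g k j (q j 0))" for k i
  have "\<bar>a k i\<bar> \<le> (case prod_decode i of (j, n) \<Rightarrow> \<rho> j (q j n) (q j 0))" for k i
    unfolding a_def by (auto split: prod.split intro!: g_lip qF)
  from bounded_diagonal_subseq[of a, OF this]
  obtain r where r: "strict_mono r" "\<And>i. convergent (\<lambda>k. a (r k) i)" by blast
  have conv_q: "convergent (\<lambda>k. g (r k) j (q j n) - g (r k) j (q j 0))" for j n
    using r(2)[of "prod_encode (j, n)"] by (simp add: a_def)
  have conv_F: "convergent (\<lambda>k. g (r k) j x - g (r k) j x')" if x: "x \<in> F j" "x' \<in> F j" for j x x'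
  proof (rule Cauchy_convergent, rule metric_CauchyI)
    fix \<epsilon> :: real assume \<epsilon>: "\<epsilon> > 0"
    \<comment> \<open>Replacing \<open>x\<close> and \<open>x'\<close> by dense points for both
      indices \<open>k\<close> and \<open>l\<close> causes four errors of
      \<open>\<epsilon>/6\<close>; the Cauchy condition at the dense points takes the remaining
      \<open>\<epsilon>/3\<close>.\<close>
    obtain n n' where n: "\<rho> j x (q j n) < \<epsilon>/6" "\<rho> j x' (q j n') < \<epsilon>/6"
      using dense[OF x(1), of "\<epsilon>/6"] dense[OF x(2), of "\<epsilon>/6"] \<epsilon> by auto
    have "convergent (\<lambda>k. (g (r k) j (q j n) - g (r k) j (q j 0)) - (g (r k) j (q j n') - g (r k) j (q j 0)))"
      by (intro convergent_diff conv_q)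
    then have "Cauchy (\<lambda>k. g (r k) j (q j n) - g (r k) j (q j n'))" by (simp add: convergent_Cauchy)
    moreover have "\<epsilon>/3 > 0" using \<epsilon> by simp
    ultimately have "\<exists>K. \<forall>k\<ge>K. \<forall>l\<ge>K.
        dist (g (r k) j (q j n) - g (r k) j (q j n')) (g (r l) j (q j n) - g (r l) j (q j n')) < \<epsilon>/3"
      by (rule metric_CauchyD)
    then obtain K where K: "\<forall>k\<ge>K. \<forall>l\<ge>K.
        dist (g (r k) j (q j n) - g (r k) j (q j n')) (g (r l) j (q j n) - g (r l) j (q j n')) < \<epsilon>/3"
      by (elim exE)
    have "dist (g (r k) j x - g (r k) j x') (g (r l) j x - g (r l) j x') < \<epsilon>" if "k \<ge> K" "l \<ge> K" for k l
      using K[rule_format, OF that] g_lip[OF x(1) qF, of "r k" n] g_lip[OF x(1) qF, of "r l" n]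
        g_lip[OF x(2) qF, of "r k" n'] g_lip[OF x(2) qF, of "r l" n'] n
      unfolding dist_real_def by linarith
    then show "\<exists>K. \<forall>k\<ge>K. \<forall>l\<ge>K. dist (g (r k) j x - g (r k) j x') (g (r l) j x - g (r l) j x') < \<epsilon>" by blast
  qed
  let ?PP = "P \<Otimes>\<^sub>M P"
  have AE_FF: "AE z in ?PP. convergent (\<lambda>k. g (r k) j (fst z) - g (r k) j (snd z))" for j
  proof -
    have "AE x in distr ?PP P fst. x \<in> F j" "AE x in distr ?PP P snd. x \<in> F j"
      unfolding distr_fst_P distr_snd_P by (rule AE_F)+
    note AE_distrD[OF measurable_fst this(1)] AE_distrD[OF measurable_snd this(2)]
    then show ?thesis by eventually_elim (rule conv_F)
  qed
  have "\<exists>r'. strict_mono r' \<and> (AE z in ?PP. convergent (\<lambda>k. f (r (r' k)) (fst z) - f (r (r' k)) (snd z)))"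
  proof (rule PP.cauchy_in_prob_AE_subseq)
    fix \<epsilon> :: real assume "\<epsilon> > 0"
    \<comment> \<open>Five terms of size \<open>e j\<close>: the replacement of \<open>f\<close> by
      \<open>g\<close> at two points for two indices, and the Cauchy error of the differences of
      \<open>g\<close>.\<close>
    then obtain j where "(1/2 :: real) ^ j < \<epsilon>/5" using real_arch_pow_inv[of "\<epsilon>/5" "1/2"] by auto
    then have j: "5 * e j < \<epsilon>" by (simp add: e_def)
    have "(\<lambda>z. g (r k) j (fst z) - g (r k) j (snd z)) \<in> borel_measurable ?PP" for k by measurable
    from PP.AE_convergent_imp_cauchy_in_prob[OF this AE_FF e[of j]]
    obtain K where K: "\<forall>k\<ge>K. \<forall>l\<ge>K. PP.prob {z \<in> space ?PP. e j <
        \<bar>(g (r k) j (fst z) - g (r k) j (snd z)) - (g (r l) j (fst z) - g (r l) j (snd z))\<bar>} \<le> e j"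
      by (elim exE)
    let ?A = "\<lambda>h k. {z \<in> space ?PP. e j < \<bar>f (r k) (h z) - g (r k) j (h z)\<bar>}"
    have A: "PP.prob (?A h k) \<le> e j" if [measurable]: "h \<in> ?PP \<rightarrow>\<^sub>M P" and h: "distr ?PP P h = P" for h k
    proof -
      have "{x \<in> space P. e j < \<bar>f (r k) x - g (r k) j x\<bar>} \<in> sets P" by measurable
      from measure_vimage_P[OF that this] have "PP.prob (?A h k) = P.prob {x. e j < \<bar>f (r k) x - g (r k) j x\<bar>}"
        by (simp add: vimage_def space_pair_measure)
      then show ?thesis using y[of j "r k"] by (simp add: g_def less_imp_le)
    qed
    have "PP.prob {z \<in> space ?PP. \<epsilon> < \<bar>(f (r k) (fst z) - f (r k) (snd z)) - (f (r l) (fst z) - f (r l) (snd z))\<bar>} \<le> \<epsilon>"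
      if kl: "k \<ge> K" "l \<ge> K" for k l
    proof -
      let ?C = "{z \<in> space ?PP. e j < \<bar>(g (r k) j (fst z) - g (r k) j (snd z)) - (g (r l) j (fst z) - g (r l) j (snd z))\<bar>}"
      have "PP.prob {z \<in> space ?PP. \<epsilon> < \<bar>(f (r k) (fst z) - f (r k) (snd z)) - (f (r l) (fst z) - f (r l) (snd z))\<bar>} \<le>
          PP.prob (((?A fst k \<union> ?A snd k) \<union> (?A fst l \<union> ?A snd l)) \<union> ?C)"
      proof (intro PP.finite_measure_mono subsetI)
        fix z assume z: "z \<in> {z \<in> space ?PP. \<epsilon> < \<bar>(f (r k) (fst z) - f (r k) (snd z)) - (f (r l) (fst z) - f (r l) (snd z))\<bar>}"
        show "z \<in> ((?A fst k \<union> ?A snd k) \<union> (?A fst l \<union> ?A snd l)) \<union> ?C"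
        proof (rule ccontr)
          assume "\<not> ?thesis"
          then have "\<bar>f (r k) (fst z) - g (r k) j (fst z)\<bar> \<le> e j" "\<bar>f (r k) (snd z) - g (r k) j (snd z)\<bar> \<le> e j"
            "\<bar>f (r l) (fst z) - g (r l) j (fst z)\<bar> \<le> e j" "\<bar>f (r l) (snd z) - g (r l) j (snd z)\<bar> \<le> e j"
            "\<bar>(g (r k) j (fst z) - g (r k) j (snd z)) - (g (r l) j (fst z) - g (r l) j (snd z))\<bar> \<le> e j"
            using z by (auto simp: not_less)
          then have "\<bar>(f (r k) (fst z) - f (r k) (snd z)) - (f (r l) (fst z) - f (r l) (snd z))\<bar> \<le> 5 * e j" by linarith
          then show False using z j by simp
        qed
      qed measurable
      also have "\<dots> \<le> ((PP.prob (?A fst k) + PP.prob (?A snd k)) + (PP.prob (?A fst l) + PP.prob (?A snd l))) + PP.prob ?C"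
        by (intro order_trans[OF measure_Un_le] add_mono sets.Un order_refl) measurable
      also have "\<dots> \<le> ((e j + e j) + (e j + e j)) + e j"
        by (intro add_mono A distr_fst_P distr_snd_P K[rule_format] kl) measurable
      finally show ?thesis using j by linarith
    qed
    then show "\<exists>K. \<forall>k\<ge>K. \<forall>l\<ge>K. PP.prob {z \<in> space ?PP. \<epsilon> < \<bar>(f (r k) (fst z) - f (r k) (snd z)) - (f (r l) (fst z) - f (r l) (snd z))\<bar>} \<le> \<epsilon>"
      by blast
  qed measurable
  then obtain r' where r': "strict_mono r'" "AE z in ?PP. convergent (\<lambda>k. f (r (r' k)) (fst z) - f (r (r' k)) (snd z))"
    by blast
  \<comment> \<open>A good first point \<open>x0\<close> is frozen by Fubini, and the values of the
    functions at \<open>x0\<close> become the constants \<open>c k\<close> to be subtracted.\<close>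
  have "AE x in P. AE x' in P. convergent (\<lambda>k. f (r (r' k)) x - f (r (r' k)) x')"
    using PP.AE_pair[OF r'(2)] by simp
  then have "\<exists>x. AE x' in P. convergent (\<lambda>k. f (r (r' k)) x - f (r (r' k)) x')"
    by (rule eventually_happens'[OF P.ae_filter_bot])
  then obtain x0 where x0: "AE x' in P. convergent (\<lambda>k. f (r (r' k)) x0 - f (r (r' k)) x')" by blast
  define R where "R k = r (r' k)" for k
  define c where "c k = f (R k) x0" for k
  define G where "G x = lim (\<lambda>k. f (R k) x - c k)" for x
  have [measurable]: "G \<in> borel_measurable P" unfolding G_def by measurable
  have lim: "AE x in P. (\<lambda>k. f (R k) x - c k) \<longlonglongrightarrow> G x"
    using x0
  proof eventually_elim
    case (elim x)
    then have "convergent (\<lambda>k. - (f (R k) x0 - f (R k) x))" unfolding R_def by (rule convergent_minus_iff[THEN iffD1])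
    then have "convergent (\<lambda>k. f (R k) x - c k)" by (simp add: c_def)
    then show ?case unfolding G_def by (simp add: convergent_LIMSEQ_iff)
  qed
  have "AE x in P. x \<in> E k" for k using E1 by (rule P.AE_prob_1)
  then have "AE x in P. \<forall>k. x \<in> E k" by (simp add: AE_all_countable)
  with lim have "AE x in P. (\<forall>k. x \<in> E k) \<and> (\<lambda>k. f (R k) x - c k) \<longlonglongrightarrow> G x"
    by eventually_elim simp
  then obtain S where S: "S \<subseteq> {x \<in> space P. (\<forall>k. x \<in> E k) \<and> (\<lambda>k. f (R k) x - c k) \<longlonglongrightarrow> G x}"
    "S \<in> sets P" "P.prob S = 1" by (rule P.AE_E_prob)
  \<comment> \<open>The constants cancel in differences, so the Lipschitz bound passes to the limit
    on the common full-measure set \<open>S\<close>.\<close>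
  have "ennreal \<bar>G x - G x'\<bar> \<le> l2_dist x x'" if "x \<in> S" "x' \<in> S" for x x'
  proof (cases "l2_dist x x'")
    case (real L)
    have "(\<lambda>k. \<bar>(f (R k) x - c k) - (f (R k) x' - c k)\<bar>) \<longlonglongrightarrow> \<bar>G x - G x'\<bar>"
      using S that by (intro tendsto_intros) auto
    moreover have "\<bar>(f (R k) x - c k) - (f (R k) x' - c k)\<bar> \<le> L" for k
    proof -
      have "ennreal \<bar>f (R k) x - f (R k) x'\<bar> \<le> l2_dist x x'" using S(1) that by (intro lip) auto
      then show ?thesis using real by simp
    qed
    ultimately have "\<bar>G x - G x'\<bar> \<le> L" by (intro LIMSEQ_le_const2) auto
    then show ?thesis using real by (simp add: ennreal_leI)
  qed simp
  then have "G \<in> ae_Lip1 (gaussian_R_infinity \<sigma>)" using S unfolding mem_ae_Lip1_iff by auto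
  moreover have "strict_mono R" using r r' by (auto simp: R_def strict_mono_def)
  ultimately show "\<exists>r c g. strict_mono r \<and> g \<in> ae_Lip1 (gaussian_R_infinity \<sigma>) \<and>
      (AE x in emm_meas (gaussian_R_infinity \<sigma>). (\<lambda>n. f (r n) x - c n) \<longlonglongrightarrow> g x)"
    unfolding emm_meas_eq using lim by blast
qed

end

section \<open>The extended metric measure space of Gaussian sequences\<close>

lemma second_countable_euclidean:
  "second_countable (euclidean :: 'a::second_countable_topology topology)"
proof -
  obtain \<B> :: "'a set set" where \<B>: "countable \<B>" "\<And>C. C \<in> \<B> \<Longrightarrow> open C" "\<And>S. open S \<Longrightarrow> \<exists>U. U \<subseteq> \<B> \<and> S = \<Union>U"
    using univ_second_countable by blast
  have "\<exists>V\<in>\<B>. x \<in> V \<and> V \<subseteq> U" if "open U" "x \<in> U" for U x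
    using \<B>(3)[OF that(1)] that(2) by blast
  then show ?thesis unfolding second_countable_def using \<B>(1,2) by (auto intro!: exI[of _ \<B>])
qed

lemma sets_borel_eq_sigma_sets: "sets (borel :: 'a::topological_space measure) = sigma_sets UNIV {U. open U}"
  unfolding borel_def by (rule sets_measure_of) simp

text \<open>Replaces the case distinction on summability by conditions on finite partial sums. The
  triangle inequality, lower semicontinuity and completeness are all reduced to
  \<open>L2_set\<close> through it.\<close>

lemma l2_dist_le_iff: "l2_dist x y \<le> c \<longleftrightarrow> (\<forall>N. ennreal (L2_set (\<lambda>n. x n - y n) {..<N}) \<le> c)"
proof (cases c)
  case (real L)
  have iff: "L2_set (\<lambda>n. x n - y n) {..<N} \<le> L \<longleftrightarrow> (\<Sum>n<N. (x n - y n)\<^sup>2) \<le> L\<^sup>2" for N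
    using real(1) by (auto simp: L2_set_def sqrt_le_D intro: real_le_lsqrt sum_nonneg)
  show ?thesis
  proof
    assume le: "l2_dist x y \<le> c"
    then have s: "summable (\<lambda>n. (x n - y n)\<^sup>2)" using real by (auto simp: l2_dist_def top_unique split: if_splits)
    then have "sqrt (\<Sum>n. (x n - y n)\<^sup>2) \<le> L" using le real by (simp add: l2_dist_def)
    moreover have "L2_set (\<lambda>n. x n - y n) {..<N} \<le> sqrt (\<Sum>n. (x n - y n)\<^sup>2)" for N
      unfolding L2_set_def by (intro real_sqrt_le_mono sum_le_suminf s) auto
    ultimately show "\<forall>N. ennreal (L2_set (\<lambda>n. x n - y n) {..<N}) \<le> c"
      using real by (auto intro!: ennreal_leI intro: order_trans)
  next
    assume "\<forall>N. ennreal (L2_set (\<lambda>n. x n - y n) {..<N}) \<le> c"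
    then have le: "(\<Sum>n<N. (x n - y n)\<^sup>2) \<le> L\<^sup>2" for N using real iff by simp
    then have s: "summable (\<lambda>n. (x n - y n)\<^sup>2)" by (intro summableI_nonneg_bounded) auto
    then have "(\<Sum>n. (x n - y n)\<^sup>2) \<le> L\<^sup>2" by (intro suminf_le_const le)
    then have "sqrt (\<Sum>n. (x n - y n)\<^sup>2) \<le> L" using real by (intro real_le_lsqrt) (auto intro: suminf_nonneg s)
    then show "l2_dist x y \<le> c" using s real by (simp add: l2_dist_def ennreal_leI)
  qed
qed simp

lemma l2_dist_eq_SUP: "l2_dist x y = (SUP N. ennreal (L2_set (\<lambda>n. x n - y n) {..<N}))"
proof (rule antisym)
  show "l2_dist x y \<le> (SUP N. ennreal (L2_set (\<lambda>n. x n - y n) {..<N}))"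
    unfolding l2_dist_le_iff by (auto intro: SUP_upper)
  show "(SUP N. ennreal (L2_set (\<lambda>n. x n - y n) {..<N})) \<le> l2_dist x y"
    using l2_dist_le_iff[of x y "l2_dist x y"] by (auto intro: SUP_least)
qed

lemma l2_dist_commute: "l2_dist x y = l2_dist y x"
  unfolding l2_dist_def by (simp add: power2_commute)

lemma l2_dist_triangle: "l2_dist x z \<le> l2_dist x y + l2_dist y z"
  unfolding l2_dist_le_iff[of x z]
proof
  fix N
  have "L2_set (\<lambda>n. x n - z n) {..<N} = L2_set (\<lambda>n. (x n - y n) + (y n - z n)) {..<N}" by simp
  also have "\<dots> \<le> L2_set (\<lambda>n. x n - y n) {..<N} + L2_set (\<lambda>n. y n - z n) {..<N}"
    by (rule L2_set_triangle_ineq)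
  finally have "ennreal (L2_set (\<lambda>n. x n - z n) {..<N}) \<le>
      ennreal (L2_set (\<lambda>n. x n - y n) {..<N}) + ennreal (L2_set (\<lambda>n. y n - z n) {..<N})"
    by (simp add: ennreal_plus[symmetric] ennreal_leI del: ennreal_plus)
  also have "\<dots> \<le> l2_dist x y + l2_dist y z"
    using l2_dist_le_iff[of x y "l2_dist x y"] l2_dist_le_iff[of y z "l2_dist y z"] by (intro add_mono) auto
  finally show "ennreal (L2_set (\<lambda>n. x n - z n) {..<N}) \<le> l2_dist x y + l2_dist y z" .
qed

lemma l2_dist_eq_0_iff: "l2_dist x y = 0 \<longleftrightarrow> x = y"
proof
  assume "l2_dist x y = 0"
  then have "\<bar>x n - y n\<bar> = 0" for n using coordinate_le_l2_dist[of x n y] by (simp add: ennreal_eq_0_iff)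
  then show "x = y" by auto
next
  assume "x = y" then show "l2_dist x y = 0" by (simp add: l2_dist_def)
qed

lemma ennreal_tendsto_0I:
  fixes f :: "nat \<Rightarrow> ennreal"
  assumes "\<And>e. e > 0 \<Longrightarrow> \<exists>N. \<forall>n\<ge>N. f n \<le> ennreal e"
  shows "f \<longlonglongrightarrow> 0"
proof (rule order_tendstoI)
  fix a :: ennreal assume "0 < a"
  then obtain b where b: "0 < b" "b < a" using dense by blast
  then obtain e where e: "b = ennreal e" "e > 0" by (cases b) (auto simp: ennreal_less_zero_iff)
  then obtain N where "\<forall>n\<ge>N. f n \<le> ennreal e" using assms by blast
  then show "eventually (\<lambda>n. f n < a) sequentially"
    using b e unfolding eventually_sequentially by (meson le_less_trans)
qed simp

text \<open>Coordinates converge because each is dominated by the distance. Letting \<open>j\<close>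
  tend to infinity in a finite truncation, where continuity is available, shows that the
  coordinatewise limit is a limit in distance.\<close>

lemma ext_complete_l2_dist: "ext_complete_on UNIV l2_dist"
  unfolding ext_complete_on_def
proof (intro allI impI)
  fix s :: "nat \<Rightarrow> nat \<Rightarrow> real"
  assume "range s \<subseteq> UNIV \<and> (\<forall>\<epsilon>>0. \<exists>N. \<forall>i\<ge>N. \<forall>j\<ge>N. l2_dist (s i) (s j) < \<epsilon>)"
  then have C: "\<And>\<epsilon>. \<epsilon> > 0 \<Longrightarrow> \<exists>N. \<forall>i\<ge>N. \<forall>j\<ge>N. l2_dist (s i) (s j) < ennreal \<epsilon>" by simp
  have "Cauchy (\<lambda>i. s i n)" for n
  proof (rule metric_CauchyI)
    fix \<epsilon> :: real assume "\<epsilon> > 0"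
    then obtain N where N: "\<forall>i\<ge>N. \<forall>j\<ge>N. l2_dist (s i) (s j) < ennreal \<epsilon>" using C by blast
    have "dist (s i n) (s j n) < \<epsilon>" if "i \<ge> N" "j \<ge> N" for i j
      using le_less_trans[OF coordinate_le_l2_dist N[rule_format, OF that], of n]
      by (simp add: dist_real_def ennreal_less_iff)
    then show "\<exists>N. \<forall>i\<ge>N. \<forall>j\<ge>N. dist (s i n) (s j n) < \<epsilon>" by blast
  qed
  then have "\<exists>l. (\<lambda>i. s i n) \<longlonglongrightarrow> l" for n by (simp add: Cauchy_convergent_iff convergent_def)
  then obtain x where x: "\<And>n. (\<lambda>i. s i n) \<longlonglongrightarrow> x n" by metis
  have "(\<lambda>i. l2_dist (s i) x) \<longlonglongrightarrow> 0"
  proof (rule ennreal_tendsto_0I)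
    fix \<epsilon> :: real assume \<epsilon>: "\<epsilon> > 0"
    then obtain N where N: "\<forall>i\<ge>N. \<forall>j\<ge>N. l2_dist (s i) (s j) < ennreal \<epsilon>" using C by blast
    have "l2_dist (s i) x \<le> ennreal \<epsilon>" if "i \<ge> N" for i
      unfolding l2_dist_le_iff
    proof
      fix K
      have "(\<lambda>j. L2_set (\<lambda>n. s i n - s j n) {..<K}) \<longlonglongrightarrow> L2_set (\<lambda>n. s i n - x n) {..<K}"
        unfolding L2_set_def by (intro tendsto_intros x)
      moreover have "L2_set (\<lambda>n. s i n - s j n) {..<K} \<le> \<epsilon>" if "j \<ge> N" for j
      proof -
        have "l2_dist (s i) (s j) \<le> ennreal \<epsilon>" using N \<open>i \<ge> N\<close> that by (simp add: less_imp_le)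
        then show ?thesis using \<epsilon> by (simp add: l2_dist_le_iff)
      qed
      ultimately have "L2_set (\<lambda>n. s i n - x n) {..<K} \<le> \<epsilon>" by (intro LIMSEQ_le_const2) auto
      then show "ennreal (L2_set (\<lambda>n. s i n - x n) {..<K}) \<le> ennreal \<epsilon>" by (rule ennreal_leI)
    qed
    then show "\<exists>N. \<forall>i\<ge>N. l2_dist (s i) x \<le> ennreal \<epsilon>" by blast
  qed
  then show "\<exists>x\<in>UNIV. (\<lambda>i. l2_dist (s i) x) \<longlonglongrightarrow> 0" by blast
qed

lemma continuous_on_L2_set_diff:
  "continuous_on UNIV (\<lambda>z. ennreal (L2_set (\<lambda>n. fst z n - snd z n :: real) {..<N :: nat}))"
proof -
  have "continuous_on UNIV (\<lambda>z :: (nat \<Rightarrow> real) \<times> (nat \<Rightarrow> real). fst z)"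
    "continuous_on UNIV (\<lambda>z :: (nat \<Rightarrow> real) \<times> (nat \<Rightarrow> real). snd z)"
    by (rule continuous_on_fst continuous_on_snd continuous_on_id)+
  note c = this[THEN continuous_on_product_then_coordinatewise]
  show ?thesis
    unfolding L2_set_def
    by (intro continuous_on_ennreal continuous_on_real_sqrt continuous_on_sum continuous_on_power
        continuous_on_diff c)
qed

lemma lsc_l2_dist: "lsc_dist euclidean l2_dist"
  unfolding lsc_dist_def
proof
  fix c
  have "{(x, y). x \<in> topspace euclidean \<and> y \<in> topspace euclidean \<and> c < l2_dist x y} =
      (\<Union>N. {z. c < ennreal (L2_set (\<lambda>n. fst z n - snd z n) {..<N})})"
    by (auto simp: l2_dist_eq_SUP less_SUP_iff)
  moreover have "open \<dots>"
    by (intro open_UN ballI open_Collect_less continuous_on_const continuous_on_L2_set_diff)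
  ultimately show "openin (prod_topology euclidean euclidean)
      {(x, y). x \<in> topspace euclidean \<and> y \<in> topspace euclidean \<and> c < l2_dist x y}"
    by simp
qed

lemma dist_topology_finer_l2_dist: "dist_topology_finer euclidean l2_dist"
  unfolding dist_topology_finer_def
proof (intro allI impI ballI)
  fix U :: "(nat \<Rightarrow> real) set" and x assume U: "openin euclidean U" "x \<in> U"
  from product_topology_open_contains_basis[of "\<lambda>_. euclideanreal" UNIV U x,
      unfolded euclidean_product_topology, OF this]
  obtain X where "x \<in> (\<Pi>\<^sub>E i\<in>UNIV. X i) \<and> (\<forall>i. openin euclideanreal (X i)) \<and>
    finite {i. X i \<noteq> topspace euclideanreal} \<and> (\<Pi>\<^sub>E i\<in>UNIV. X i) \<subseteq> U" by (elim exE)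
  then have X: "x \<in> (\<Pi>\<^sub>E i\<in>UNIV. X i)" "\<And>i. openin euclideanreal (X i)"
    "finite {i. X i \<noteq> topspace euclideanreal}" "(\<Pi>\<^sub>E i\<in>UNIV. X i) \<subseteq> U" by simp_all
  have "\<exists>e>0. \<forall>t. dist t (x i) < e \<longrightarrow> t \<in> X i" for i
    using X(1) X(2)[of i] unfolding open_openin[symmetric] open_dist by (auto simp: PiE_iff)
  then have "\<exists>e>0. \<forall>t. \<bar>x i - t\<bar> < e \<longrightarrow> t \<in> X i" for i
    by (simp add: dist_real_def abs_minus_commute)
  then obtain e where e: "\<And>i. e i > 0" "\<And>i t. \<bar>x i - t\<bar> < e i \<Longrightarrow> t \<in> X i" by metis
  \<comment> \<open>A basic open set restricts finitely many coordinates; the inserted 1 keeps the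
    minimum meaningful if it restricts none.\<close>
  define \<epsilon> where "\<epsilon> = Min (insert 1 (e ` {i. X i \<noteq> UNIV}))"
  have fin: "finite (insert 1 (e ` {i. X i \<noteq> UNIV}))" using X(3) by simp
  have "\<epsilon> > 0" unfolding \<epsilon>_def using fin e(1) by (subst Min_gr_iff) auto
  moreover have "y \<in> U" if "l2_dist x y < ennreal \<epsilon>" for y
  proof -
    have "y i \<in> X i" for i
    proof (cases "X i = UNIV")
      case False
      have "ennreal \<bar>x i - y i\<bar> < ennreal \<epsilon>" using coordinate_le_l2_dist that by (rule le_less_trans)
      then have "\<bar>x i - y i\<bar> < \<epsilon>" by (simp add: ennreal_less_iff)
      also have "\<epsilon> \<le> e i" unfolding \<epsilon>_def using False fin by (intro Min_le) auto
      finally show ?thesis by (rule e(2))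
    qed simp
    then show ?thesis using X(4) by (auto simp: PiE_iff)
  qed
  ultimately show "\<exists>\<epsilon>>0. \<forall>y\<in>topspace euclidean. l2_dist x y < \<epsilon> \<longrightarrow> y \<in> U"
    by (intro exI[of _ "ennreal \<epsilon>"]) auto
qed

text \<open>Completing the square gives a multiple of the normal density with mean
  \<open>y * \<tau>\<^sup>2\<close> and variance
  \<open>\<tau>\<^sup>2 = s\<^sup>2 / (1 + s\<^sup>2)\<close>. The leftover factor
  \<open>exp (- y\<^sup>2 * (1 - \<tau>\<^sup>2) / 2)\<close> is at most 1; dropping it makes the
  bound uniform in \<open>y\<close>.\<close>

lemma nn_integral_gauss_exp_le:
  assumes s: "s > 0"
  shows "(\<integral>\<^sup>+t. ennreal (exp (- (t - y)\<^sup>2 / 2)) \<partial>gauss s) \<le> ennreal (1 / sqrt (1 + s\<^sup>2))"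
proof -
  define \<tau> where "\<tau> = s / sqrt (1 + s\<^sup>2)"
  have p: "1 + s\<^sup>2 > 0" by (simp add: add_pos_nonneg)
  have \<tau>: "\<tau> > 0" "\<tau>\<^sup>2 = s\<^sup>2 / (1 + s\<^sup>2)" using s p by (simp_all add: \<tau>_def power_divide)
  define a where "a = y * \<tau>\<^sup>2"
  have le: "normal_density 0 s t * exp (- (t - y)\<^sup>2 / 2) \<le> (1 / sqrt (1 + s\<^sup>2)) * normal_density a \<tau> t" for t
  proof -
    have "t\<^sup>2 / (2 * s\<^sup>2) + (t - y)\<^sup>2 / 2 - (t - a)\<^sup>2 / (2 * \<tau>\<^sup>2) = y\<^sup>2 * (1 - \<tau>\<^sup>2) / 2"
    proof -
      have "1 / \<tau>\<^sup>2 = 1 + 1 / s\<^sup>2" using s p by (simp add: \<tau>(2) field_simps)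
      moreover have "(t - a)\<^sup>2 / (2 * \<tau>\<^sup>2) = (t\<^sup>2 * (1 / \<tau>\<^sup>2) - 2 * t * y + y\<^sup>2 * \<tau>\<^sup>2) / 2"
        using \<tau>(1) by (simp add: a_def field_simps power2_eq_square)
      ultimately have "(t - a)\<^sup>2 / (2 * \<tau>\<^sup>2) = (t\<^sup>2 * (1 + 1/s\<^sup>2) - 2 * t * y + y\<^sup>2 * \<tau>\<^sup>2) / 2"
        by (simp only:)
      then show ?thesis using s by (simp add: field_simps power2_eq_square)
    qed
    moreover have "\<tau>\<^sup>2 \<le> 1" using p by (simp add: \<tau>(2))
    then have "0 \<le> y\<^sup>2 * (1 - \<tau>\<^sup>2) / 2" by simp
    ultimately have e: "- t\<^sup>2 / (2 * s\<^sup>2) + - (t - y)\<^sup>2 / 2 \<le> - (t - a)\<^sup>2 / (2 * \<tau>\<^sup>2)"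
      by (simp add: minus_divide_left[symmetric] del: minus_divide_left)
    have "normal_density 0 s t * exp (- (t - y)\<^sup>2 / 2) = (1 / (s * sqrt (2 * pi))) * exp (- t\<^sup>2 / (2 * s\<^sup>2) + - (t - y)\<^sup>2 / 2)"
      using s by (simp add: normal_density_def real_sqrt_mult mult_exp_exp ac_simps)
    also have "\<dots> \<le> (1 / (s * sqrt (2 * pi))) * exp (- (t - a)\<^sup>2 / (2 * \<tau>\<^sup>2))"
      using s e by (intro mult_left_mono) auto
    also have "\<dots> = (1 / sqrt (1 + s\<^sup>2)) * normal_density a \<tau> t"
      using s \<tau>(1) p by (simp add: normal_density_def real_sqrt_mult) (simp add: \<tau>_def)
    finally show ?thesis .
  qed
  have "(\<integral>\<^sup>+t. ennreal (exp (- (t - y)\<^sup>2 / 2)) \<partial>gauss s) =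
      (\<integral>\<^sup>+t. ennreal (normal_density 0 s t * exp (- (t - y)\<^sup>2 / 2)) \<partial>lborel)"
    by (subst nn_integral_density) (auto simp: ennreal_mult)
  also have "\<dots> \<le> (\<integral>\<^sup>+t. ennreal (1 / sqrt (1 + s\<^sup>2)) * ennreal (normal_density a \<tau> t) \<partial>lborel)"
    using le p by (intro nn_integral_mono) (auto simp: ennreal_mult[symmetric] intro!: ennreal_leI)
  also have "\<dots> = ennreal (1 / sqrt (1 + s\<^sup>2)) * (\<integral>\<^sup>+t. ennreal (normal_density a \<tau> t) \<partial>lborel)"
    by (rule nn_integral_cmult) measurable
  also have "(\<integral>\<^sup>+t. ennreal (normal_density a \<tau> t) \<partial>lborel) = 1"
    using prob_space.emeasure_space_1[OF prob_space_normal_density[OF \<tau>(1), of a]]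
    by (simp add: emeasure_density)
  finally show ?thesis by simp
qed

lemma prod_mono_ennreal:
  fixes f g :: "nat \<Rightarrow> ennreal"
  assumes "\<And>n. f n \<le> g n"
  shows "(\<Prod>n<N. f n) \<le> (\<Prod>n<N. g n)"
  using assms by (induction N) (auto intro!: mult_mono)

text \<open>Lets an infinite sum of variances force the product of the factors
  \<open>1 + (\<sigma> n)\<^sup>2\<close> to infinity.\<close>

lemma one_plus_sum_le_prod:
  fixes a :: "nat \<Rightarrow> real"
  assumes "\<And>n. 0 \<le> a n"
  shows "1 + (\<Sum>n<N. a n) \<le> (\<Prod>n<N. 1 + a n)"
proof (induction N)
  case (Suc N)
  have "1 \<le> (\<Prod>n<N. 1 + a n)" using assms by (intro prod_ge_1) simp
  then have "1 * a N \<le> (\<Prod>n<N. 1 + a n) * a N" using assms by (intro mult_right_mono)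
  then show ?case using Suc by (simp add: algebra_simps)
qed simp

context gauss_seq
begin

lemma emm_space_gaussian: "emm_space (gaussian_R_infinity \<sigma>)"
proof -
  have top: "emm_top (gaussian_R_infinity \<sigma>) = euclidean" and dist: "emm_dist (gaussian_R_infinity \<sigma>) = l2_dist"
    by (simp_all add: gaussian_R_infinity_def euclidean_product_topology)
  show ?thesis
    unfolding emm_space_def top dist emm_meas_eq
    using completely_metrizable_space_euclidean second_countable_euclidean lsc_l2_dist
      dist_topology_finer_l2_dist ext_complete_l2_dist P.prob_space_axioms
    by (auto simp: ext_distance_on_def l2_dist_commute l2_dist_triangle l2_dist_eq_0_iff borel_prob_on_def
        sets_P_borel sets_borel_eq_sigma_sets)
qed

lemma nn_integral_prod_coordinates:
  assumes [measurable]: "\<And>n. f n \<in> borel_measurable borel" and I: "finite I"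
  shows "(\<integral>\<^sup>+x. (\<Prod>n\<in>I. f n (x n)) \<partial>P) = (\<Prod>n\<in>I. (\<integral>\<^sup>+t. f n t \<partial>gauss (\<sigma> n)))"
proof -
  let ?Q = "PiM I (\<lambda>n. gauss (\<sigma> n))"
  have restr: "distr P ?Q (\<lambda>x. restrict x I) = ?Q"
    unfolding P_def by (rule G.distr_PiM_restrict_finite) (auto simp: I)
  have [measurable]: "(\<lambda>x. restrict x I) \<in> P \<rightarrow>\<^sub>M ?Q"
    unfolding P_def by (rule measurable_restrict_subset) auto
  have [measurable]: "(\<lambda>u. u n) \<in> borel_measurable ?Q" if "n \<in> I" for n
    using measurable_component_singleton[OF that, of "\<lambda>n. gauss (\<sigma> n)"] by simp
  have "(\<Prod>n\<in>I. (\<integral>\<^sup>+t. f n t \<partial>gauss (\<sigma> n))) = (\<integral>\<^sup>+u. (\<Prod>n\<in>I. f n (u n)) \<partial>?Q)"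
    by (rule G.product_nn_integral_prod[symmetric]) (auto simp: I)
  also have "\<dots> = (\<integral>\<^sup>+x. (\<Prod>n\<in>I. f n (restrict x I n)) \<partial>P)"
    by (subst restr[symmetric], subst nn_integral_distr) auto
  finally show ?thesis by simp
qed

text \<open>A metric takes finite values only, so almost every \<open>x\<close> would be at finite
  \<open>l2_dist\<close> from one fixed point \<open>y\<close>. The Laplace transform of the squared
  distance to \<open>y\<close> excludes this, whatever \<open>y\<close> is.\<close>

lemma iso_mm_space_imp_summable:
  fixes Y :: "'b emm"
  assumes Y: "mm_space Y" and iso: "emm_iso (gaussian_R_infinity \<sigma>) Y"
  shows "summable (\<lambda>n. (\<sigma> n)\<^sup>2)"
proof (rule ccontr)
  assume ns: "\<not> summable (\<lambda>n. (\<sigma> n)\<^sup>2)"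
  obtain F A where A: "A \<in> sets (completion P)" "emeasure (completion P) A = 1"
    and F: "\<And>x y. x \<in> A \<Longrightarrow> y \<in> A \<Longrightarrow> emm_dist Y (F x) (F y) = l2_dist x y"
    using iso unfolding emm_iso_def emm_meas_eq by (auto simp: gaussian_R_infinity_def)
  have fin: "emm_dist Y u v \<noteq> \<infinity>" for u v using Y by (auto simp: mm_space_def)
  interpret C: prob_space "completion P" by (rule P.prob_space_completion)
  have "AE x in completion P. x \<in> A"
    using A by (intro C.AE_prob_1) (simp add: C.emeasure_eq_measure)
  then have AE_A: "AE x in P. x \<in> A" by (simp add: AE_completion_iff)
  then obtain y where y: "y \<in> A" using eventually_happens'[OF P.ae_filter_bot] by blast
  have AE_s: "AE x in P. summable (\<lambda>n. (x n - y n)\<^sup>2)"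
    using AE_A
  proof eventually_elim
    case (elim x)
    then have "l2_dist x y \<noteq> \<infinity>" using F[OF elim y] fin by metis
    then show ?case by (auto simp: l2_dist_def split: if_splits)
  qed
  define h where "h x = ennreal (exp (- (\<Sum>n. (x n - y n)\<^sup>2) / 2))" for x :: "nat \<Rightarrow> real"
  have [measurable]: "h \<in> borel_measurable P" unfolding h_def by measurable
  have le: "(\<integral>\<^sup>+x. h x \<partial>P) \<le> ennreal (1 / sqrt (1 + (\<Sum>n<N. (\<sigma> n)\<^sup>2)))" for N
  proof -
    have "(\<integral>\<^sup>+x. h x \<partial>P) \<le> (\<integral>\<^sup>+x. (\<Prod>n<N. ennreal (exp (- (x n - y n)\<^sup>2 / 2))) \<partial>P)"
    proof (rule nn_integral_mono_AE)
      show "AE x in P. h x \<le> (\<Prod>n<N. ennreal (exp (- (x n - y n)\<^sup>2 / 2)))"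
        using AE_s
      proof eventually_elim
        case (elim x)
        have "(\<Sum>n<N. (x n - y n)\<^sup>2) \<le> (\<Sum>n. (x n - y n)\<^sup>2)" by (intro sum_le_suminf elim) auto
        then have "h x \<le> ennreal (exp (- (\<Sum>n<N. (x n - y n)\<^sup>2) / 2))" by (simp add: h_def ennreal_leI)
        also have "exp (- (\<Sum>n<N. (x n - y n)\<^sup>2) / 2) = (\<Prod>n<N. exp (- (x n - y n)\<^sup>2 / 2))"
          by (simp add: exp_sum[symmetric] sum_negf sum_divide_distrib)
        finally show ?case by (simp add: prod_ennreal)
      qed
    qed
    also have "\<dots> = (\<Prod>n<N. (\<integral>\<^sup>+t. ennreal (exp (- (t - y n)\<^sup>2 / 2)) \<partial>gauss (\<sigma> n)))"
      by (rule nn_integral_prod_coordinates) auto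
    also have "\<dots> \<le> (\<Prod>n<N. ennreal (1 / sqrt (1 + (\<sigma> n)\<^sup>2)))"
      by (intro prod_mono_ennreal nn_integral_gauss_exp_le pos)
    also have "\<dots> = ennreal (\<Prod>n<N. 1 / sqrt (1 + (\<sigma> n)\<^sup>2))"
      by (rule prod_ennreal) auto
    also have "(\<Prod>n<N. 1 / sqrt (1 + (\<sigma> n)\<^sup>2)) = 1 / sqrt (\<Prod>n<N. 1 + (\<sigma> n)\<^sup>2)"
      by (induction N) (auto simp: real_sqrt_mult)
    also have "\<dots> \<le> ennreal (1 / sqrt (1 + (\<Sum>n<N. (\<sigma> n)\<^sup>2)))"
      using one_plus_sum_le_prod[of "\<lambda>n. (\<sigma> n)\<^sup>2" N]
      by (intro ennreal_leI divide_left_mono real_sqrt_le_mono mult_pos_pos)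
        (auto intro!: prod_pos add_pos_nonneg sum_nonneg)
    finally show ?thesis .
  qed
  have "(\<integral>\<^sup>+x. h x \<partial>P) = 0"
  proof (rule ccontr)
    assume "(\<integral>\<^sup>+x. h x \<partial>P) \<noteq> 0"
    moreover have "(\<integral>\<^sup>+x. h x \<partial>P) \<le> 1" using le[of 0] by simp
    ultimately obtain c where c: "(\<integral>\<^sup>+x. h x \<partial>P) = ennreal c" "c > 0"
      by (cases "\<integral>\<^sup>+x. h x \<partial>P") (auto simp: top_unique order_le_less)
    have "(\<Sum>n<N. (\<sigma> n)\<^sup>2) \<le> 1 / c\<^sup>2" for N
    proof -
      let ?S = "1 + (\<Sum>n<N. (\<sigma> n)\<^sup>2)"
      have S: "?S > 0" by (intro add_pos_nonneg sum_nonneg) auto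
      have "c \<le> 1 / sqrt ?S" using le[of N] c S by (simp add: c(1))
      then have "c * sqrt ?S \<le> 1" using S by (simp add: field_simps)
      then have "(c * sqrt ?S)\<^sup>2 \<le> 1" using c S by (intro power_le_one) auto
      then have "c\<^sup>2 * ?S \<le> 1" using S by (simp add: power_mult_distrib)
      then have "?S \<le> 1 / c\<^sup>2" using c by (simp add: field_simps)
      then show ?thesis by linarith
    qed
    then have "summable (\<lambda>n. (\<sigma> n)\<^sup>2)" by (intro summableI_nonneg_bounded) auto
    then show False using ns by simp
  qed
  then have "AE x in P. h x = 0" by (simp add: nn_integral_0_iff_AE)
  then have "AE x in P. False" by eventually_elim (simp add: h_def)
  then show False using P.AE_False by simp
qed

end

section \<open>Finite total variance and square-summable sequences\<close>

definition l2_seqs :: "(nat \<Rightarrow> real) set" where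
  "l2_seqs = {x. l2_dist x (\<lambda>_. 0) < \<infinity>}"

text \<open>As \<open>enn2real\<close> sends \<open>\<infinity>\<close> to 0, this is meaningful
  only on \<open>l2_seqs\<close>, where all distances are finite.\<close>

definition l2_metric :: "(nat \<Rightarrow> real) \<Rightarrow> (nat \<Rightarrow> real) \<Rightarrow> real" where
  "l2_metric x y = enn2real (l2_dist x y)"

lemma mem_l2_seqs_iff: "x \<in> l2_seqs \<longleftrightarrow> summable (\<lambda>n. (x n)\<^sup>2)"
  by (auto simp: l2_seqs_def l2_dist_def)

lemma l2_dist_finite:
  assumes "x \<in> l2_seqs" "y \<in> l2_seqs" shows "l2_dist x y < \<infinity>"
proof -
  have "l2_dist x y \<le> l2_dist x (\<lambda>_. 0) + l2_dist (\<lambda>_. 0) y" by (rule l2_dist_triangle)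
  also have "\<dots> < \<infinity>" using assms by (simp add: l2_seqs_def l2_dist_commute[of _ y])
  finally show ?thesis .
qed

lemma ennreal_l2_metric: "x \<in> l2_seqs \<Longrightarrow> y \<in> l2_seqs \<Longrightarrow> ennreal (l2_metric x y) = l2_dist x y"
  using l2_dist_finite by (simp add: l2_metric_def)

lemma l2_metric_nonneg: "0 \<le> l2_metric x y"
  by (simp add: l2_metric_def)

lemma l2_metric_less_iff:
  assumes "x \<in> l2_seqs" "y \<in> l2_seqs"
  shows "l2_metric x y < r \<longleftrightarrow> l2_dist x y < ennreal r"
  unfolding ennreal_l2_metric[OF assms, symmetric] by (rule ennreal_less_iff[OF l2_metric_nonneg, symmetric])

lemma Metric_space_l2: "Metric_space l2_seqs l2_metric"
proof
  show "0 \<le> l2_metric x y" "l2_metric x y = l2_metric y x" for x y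
    by (simp_all add: l2_metric_def l2_dist_commute)
  show "l2_metric x y = 0 \<longleftrightarrow> x = y" if "x \<in> l2_seqs" "y \<in> l2_seqs" for x y
    using l2_dist_finite[OF that] by (auto simp: l2_metric_def enn2real_eq_0_iff l2_dist_eq_0_iff)
  show "l2_metric x z \<le> l2_metric x y + l2_metric y z"
    if "x \<in> l2_seqs" "y \<in> l2_seqs" "z \<in> l2_seqs" for x y z
  proof -
    have "ennreal (l2_metric x z) \<le> ennreal (l2_metric x y) + ennreal (l2_metric y z)"
      using that l2_dist_triangle by (simp add: ennreal_l2_metric)
    also have "\<dots> = ennreal (l2_metric x y + l2_metric y z)" by (simp add: l2_metric_def)
    finally show ?thesis by (subst (asm) ennreal_le_iff) (auto simp: l2_metric_def)
  qed
qed

interpretation l2: Metric_space l2_seqs l2_metric by (rule Metric_space_l2)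

text \<open>The limit provided by completeness of the extended distance is within distance 1 of some
  member of the sequence, hence square-summable itself.\<close>

lemma mcomplete_l2: "l2.mcomplete"
  unfolding l2.mcomplete_def
proof (intro allI impI)
  fix s assume s: "l2.MCauchy s"
  then have sl: "s n \<in> l2_seqs" for n by (auto simp: l2.MCauchy_def)
  have "\<exists>N. \<forall>i\<ge>N. \<forall>j\<ge>N. l2_dist (s i) (s j) < \<epsilon>" if "\<epsilon> > 0" for \<epsilon>
  proof -
    obtain b where b: "0 < b" "b < \<epsilon>" using \<open>\<epsilon> > 0\<close> dense by blast
    then obtain e where e: "b = ennreal e" "e > 0" by (cases b) (auto simp: ennreal_less_zero_iff)
    obtain N where N: "\<forall>i j. N \<le> i \<longrightarrow> N \<le> j \<longrightarrow> l2_metric (s i) (s j) < e"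
      using s e by (auto simp: l2.MCauchy_def)
    have "l2_dist (s i) (s j) < \<epsilon>" if "i \<ge> N" "j \<ge> N" for i j
    proof -
      have "l2_dist (s i) (s j) < b" using N that by (simp add: l2_metric_less_iff[symmetric] sl e)
      then show ?thesis using b by order
    qed
    then show ?thesis by blast
  qed
  then obtain x where x: "(\<lambda>n. l2_dist (s n) x) \<longlonglongrightarrow> 0"
    using ext_complete_l2_dist unfolding ext_complete_on_def by blast
  have "eventually (\<lambda>n. l2_dist (s n) x < 1) sequentially" using order_tendstoD(2)[OF x, of 1] by simp
  then obtain n where n: "l2_dist (s n) x < 1" using eventually_happens'[OF sequentially_bot] by blast
  have xl: "x \<in> l2_seqs"
  proof -
    have "l2_dist x (\<lambda>_. 0) \<le> l2_dist x (s n) + l2_dist (s n) (\<lambda>_. 0)" by (rule l2_dist_triangle)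
    also have "\<dots> < \<infinity>" using sl[of n] n l2_dist_commute[of x "s n"] order.strict_trans[OF n, of \<top>]
      by (simp add: l2_seqs_def)
    finally show ?thesis by (simp add: l2_seqs_def)
  qed
  have "limitin l2.mtopology s x sequentially"
    unfolding l2.limitin_metric
  proof (intro conjI xl allI impI)
    fix \<epsilon> :: real assume "\<epsilon> > 0"
    then have "eventually (\<lambda>n. l2_dist (s n) x < ennreal \<epsilon>) sequentially" using order_tendstoD(2)[OF x] by simp
    then show "eventually (\<lambda>n. s n \<in> l2_seqs \<and> l2_metric (s n) x < \<epsilon>) sequentially"
      by eventually_elim (simp add: sl xl l2_metric_less_iff)
  qed
  then show "\<exists>x. limitin l2.mtopology s x sequentially" by blast
qed

text \<open>The usual countable dense subset of the Hilbert space of square-summable sequences;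
  indexing it by lists makes countability immediate.\<close>

definition finite_rational_seqs :: "(nat \<Rightarrow> real) set" where
  "finite_rational_seqs = range (\<lambda>l :: rat list. \<lambda>n. if n < length l then of_rat (l ! n) else 0)"

lemma finite_rational_seqs_subset: "finite_rational_seqs \<subseteq> l2_seqs"
proof -
  have "summable (\<lambda>n. (if n < length l then of_rat (l ! n) else 0 :: real)\<^sup>2)" for l :: "rat list"
    by (intro summable_finite[of "{..<length l}"]) auto
  then show ?thesis by (auto simp: finite_rational_seqs_def mem_l2_seqs_iff)
qed

lemma finite_rational_seqs_dense:
  assumes x: "x \<in> l2_seqs" and \<epsilon>: "\<epsilon> > 0"
  shows "\<exists>q\<in>finite_rational_seqs. l2_dist x q < ennreal \<epsilon>"
proof -
  have s: "summable (\<lambda>n. (x n)\<^sup>2)" using x by (simp add: mem_l2_seqs_iff)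
  have "(\<epsilon>/2)\<^sup>2 > 0" using \<epsilon> by simp
  then obtain N where N: "\<And>n. n \<ge> N \<Longrightarrow> norm (\<Sum>i. (x (i + n))\<^sup>2) < (\<epsilon>/2)\<^sup>2"
    using suminf_exist_split[OF _ s] by blast
  \<comment> \<open>Rounding the first \<open>N\<close> entries costs at most
    \<open>N * \<delta> \<le> \<epsilon>/4\<close>, on top of the \<open>\<epsilon>/2\<close> for
    the tail. The \<open>+ 1\<close> covers \<open>N = 0\<close>.\<close>
  define \<delta> where "\<delta> = \<epsilon> / (4 * (real N + 1))"
  have \<delta>: "\<delta> > 0" using \<epsilon> by (simp add: \<delta>_def)
  have "\<exists>r :: rat. \<bar>x n - of_rat r\<bar> < \<delta>" for n
  proof -
    obtain r where "x n < real_of_rat r" "real_of_rat r < x n + \<delta>" using of_rat_dense[of "x n" "x n + \<delta>"] \<delta> by auto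
    then show ?thesis by (intro exI[of _ r]) auto
  qed
  then obtain r :: "nat \<Rightarrow> rat" where r: "\<And>n. \<bar>x n - of_rat (r n)\<bar> < \<delta>" by metis
  define q where "q = (\<lambda>n. if n < N then of_rat (r n) else 0 :: real)"
  have "q = (\<lambda>n. if n < length (map r [0..<N]) then of_rat (map r [0..<N] ! n) else 0)"
    by (auto simp: q_def)
  then have qD: "q \<in> finite_rational_seqs" unfolding finite_rational_seqs_def by blast
  define t where "t = (\<lambda>n. if n < N then x n else 0)"
  have 1: "l2_dist x t \<le> ennreal (\<epsilon>/2)"
  proof -
    have sq: "(x n - t n)\<^sup>2 = (if n < N then 0 else (x n)\<^sup>2)" for n by (simp add: t_def)
    have s': "summable (\<lambda>n. (x n - t n)\<^sup>2)"
      by (rule summable_comparison_test'[OF s, of 0]) (simp add: sq)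
    have "(\<Sum>n. (x n - t n)\<^sup>2) = (\<Sum>i. (x (i + N) - t (i + N))\<^sup>2) + (\<Sum>i<N. (x i - t i)\<^sup>2)"
      by (rule suminf_split_initial_segment[OF s'])
    also have "\<dots> = (\<Sum>i. (x (i + N))\<^sup>2)" by (simp add: t_def)
    also have "\<dots> \<le> (\<epsilon>/2)\<^sup>2" using N[of N] by simp
    finally have "sqrt (\<Sum>n. (x n - t n)\<^sup>2) \<le> \<epsilon>/2" using \<epsilon> by (intro real_le_lsqrt) (auto intro: suminf_nonneg s')
    then show ?thesis using s' by (simp add: l2_dist_def ennreal_leI)
  qed
  have 2: "l2_dist t q \<le> ennreal (\<epsilon>/4)"
    unfolding l2_dist_le_iff
  proof
    fix K
    have "L2_set (\<lambda>n. t n - q n) {..<K} \<le> (\<Sum>n<K. \<bar>t n - q n\<bar>)" by (rule L2_set_le_sum_abs)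
    also have "\<dots> \<le> (\<Sum>n<K. if n \<in> {..<N} then \<delta> else 0)"
      using r by (intro sum_mono) (auto simp: t_def q_def less_imp_le)
    also have "\<dots> = (\<Sum>n\<in>{..<K} \<inter> {..<N}. \<delta>)" by (rule sum.inter_restrict[symmetric]) simp
    also have "\<dots> \<le> real N * \<delta>" using \<delta> card_mono[of "{..<N}" "{..<K} \<inter> {..<N}"] by (simp add: mult_right_mono)
    also have "\<dots> \<le> \<epsilon>/4" using \<epsilon> by (simp add: \<delta>_def field_simps)
    finally show "ennreal (L2_set (\<lambda>n. t n - q n) {..<K}) \<le> ennreal (\<epsilon>/4)" by (rule ennreal_leI)
  qed
  have "l2_dist x q \<le> l2_dist x t + l2_dist t q" by (rule l2_dist_triangle)
  also have "\<dots> \<le> ennreal (\<epsilon>/2) + ennreal (\<epsilon>/4)" by (intro add_mono 1 2)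
  also have "\<dots> < ennreal \<epsilon>" using \<epsilon> by (simp add: ennreal_plus[symmetric] ennreal_less_iff del: ennreal_plus)
  finally show ?thesis using qD by blast
qed

lemma countable_finite_rational_seqs: "countable finite_rational_seqs"
  unfolding finite_rational_seqs_def by simp

lemma separable_l2: "separable_space l2.mtopology"
  unfolding separable_space_def
proof (intro exI conjI)
  show "countable finite_rational_seqs" by (rule countable_finite_rational_seqs)
  show "finite_rational_seqs \<subseteq> topspace l2.mtopology" using finite_rational_seqs_subset by simp
  have "\<exists>y\<in>finite_rational_seqs. y \<in> l2.mball x r" if x: "x \<in> l2_seqs" and r: "r > 0" for x r
  proof -
    obtain q where q: "q \<in> finite_rational_seqs" "l2_dist x q < ennreal r"
      using finite_rational_seqs_dense[OF x r] by blast
    then have "q \<in> l2_seqs" using finite_rational_seqs_subset by auto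
    then show ?thesis using q x by (intro bexI[of _ q]) (auto simp: l2.in_mball l2_metric_less_iff)
  qed
  then show "l2.mtopology closure_of finite_rational_seqs = topspace l2.mtopology"
    by (auto simp: l2.metric_closure_of)
qed

lemma nn_integral_gauss_square:
  assumes s: "s > 0"
  shows "(\<integral>\<^sup>+t. ennreal (t\<^sup>2) \<partial>gauss s) = ennreal (s\<^sup>2)"
proof -
  have b: "has_bochner_integral lborel (\<lambda>x. normal_density 0 s x * x\<^sup>2) (s\<^sup>2)"
    using normal_moment_even[OF s, of 0 1] by (simp add: field_simps power2_eq_square)
  have "(\<integral>\<^sup>+t. ennreal (t\<^sup>2) \<partial>gauss s) = (\<integral>\<^sup>+t. ennreal (normal_density 0 s t * t\<^sup>2) \<partial>lborel)"
    by (subst nn_integral_density) (auto simp: ennreal_mult)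
  also have "\<dots> = ennreal (s\<^sup>2)"
    using b by (subst nn_integral_eq_integral) (auto simp: has_bochner_integral_iff)
  finally show ?thesis .
qed

context gauss_seq
begin

lemma measurable_l2_dist_P[measurable]: "(\<lambda>x. l2_dist x y) \<in> borel_measurable P"
  unfolding l2_dist_eq_SUP L2_set_def by measurable

lemma sets_l2_seqs: "l2_seqs \<in> sets P"
proof -
  have "{x \<in> space P. l2_dist x (\<lambda>_. 0) < \<infinity>} \<in> sets P" by measurable
  then show ?thesis by (simp add: l2_seqs_def)
qed

text \<open>The expectation of the squared norm is the sum of the variances; a finite expectation
  makes the norm finite almost surely.\<close>

lemma AE_l2_seqs:
  assumes s: "summable (\<lambda>n. (\<sigma> n)\<^sup>2)"
  shows "AE x in P. x \<in> l2_seqs"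
proof -
  have "(\<integral>\<^sup>+x. (\<Sum>n. ennreal ((x n)\<^sup>2)) \<partial>P) = (\<Sum>n. (\<integral>\<^sup>+x. ennreal ((x n)\<^sup>2) \<partial>P))"
    by (rule nn_integral_suminf) measurable
  also have "\<dots> = (\<Sum>n. ennreal ((\<sigma> n)\<^sup>2))"
  proof (rule suminf_cong)
    fix n
    have "(\<integral>\<^sup>+x. ennreal ((x n)\<^sup>2) \<partial>P) = (\<integral>\<^sup>+t. ennreal (t\<^sup>2) \<partial>gauss (\<sigma> n))"
      using nn_integral_prod_coordinates[of "\<lambda>_ t. ennreal (t\<^sup>2)" "{n}"] by simp
    then show "(\<integral>\<^sup>+x. ennreal ((x n)\<^sup>2) \<partial>P) = ennreal ((\<sigma> n)\<^sup>2)" using pos by (simp add: nn_integral_gauss_square)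
  qed
  also have "\<dots> = ennreal (\<Sum>n. (\<sigma> n)\<^sup>2)" by (intro suminf_ennreal2 s) auto
  finally have "(\<integral>\<^sup>+x. (\<Sum>n. ennreal ((x n)\<^sup>2)) \<partial>P) \<noteq> \<infinity>" by simp
  then have "AE x in P. (\<Sum>n. ennreal ((x n)\<^sup>2)) \<noteq> \<infinity>"
    by (intro nn_integral_PInf_AE) auto
  then show ?thesis
    by eventually_elim (auto simp: mem_l2_seqs_iff intro: summable_suminf_not_top)
qed

text \<open>The target is the Hilbert space of square-summable sequences, and the map is the
  identity on this full-measure set, with the default value 0 elsewhere. What needs proof is that
  the map is measurable for the finer norm topology.\<close>

lemma summable_imp_iso_mm_space:
  assumes s: "summable (\<lambda>n. (\<sigma> n)\<^sup>2)"
  shows "\<exists>Y :: (nat \<Rightarrow> real) emm. mm_space Y \<and> emm_iso (gaussian_R_infinity \<sigma>) Y"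
proof -
  define F where "F x = (if x \<in> l2_seqs then x else (\<lambda>_. 0))" for x :: "nat \<Rightarrow> real"
  have z: "(\<lambda>_. 0) \<in> l2_seqs" by (simp add: mem_l2_seqs_iff)
  have sub: "{U. openin l2.mtopology U} \<subseteq> Pow l2_seqs"
    using openin_subset by fastforce
  define S where "S = sigma l2_seqs {U. openin l2.mtopology U}"
  note sets_l2_seqs[measurable]
  have ball: "l2.mball q r \<in> sets P" if "q \<in> l2_seqs" for q r
  proof -
    have "{x \<in> space P. x \<in> l2_seqs \<and> l2_dist x q < ennreal r} \<in> sets P" by measurable
    moreover have "l2.mball q r = {x \<in> space P. x \<in> l2_seqs \<and> l2_dist x q < ennreal r}"
      using that by (auto simp: l2.in_mball l2.commute[of q] l2_metric_less_iff)
    ultimately show ?thesis by simp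
  qed
  \<comment> \<open>Norm balls are measurable since \<open>l2_dist\<close> is a countable supremum
    of measurable functions. By separability an open set is a countable union of balls with rational
    radii around the dense set.\<close>
  have opens: "U \<in> sets P" if U: "openin l2.mtopology U" for U
  proof -
    define C where "C = {(q, r :: rat). q \<in> finite_rational_seqs \<and> l2.mball q (of_rat r) \<subseteq> U}"
    have "countable (finite_rational_seqs \<times> (UNIV :: rat set))"
      using countable_finite_rational_seqs by simp
    then have C: "countable C" by (rule countable_subset[rotated]) (auto simp: C_def)
    have "U = (\<Union>(q, r)\<in>C. l2.mball q (of_rat r))"
    proof (intro equalityI subsetI)
      fix x assume x: "x \<in> U"
      then have xl: "x \<in> l2_seqs" using openin_subset[OF U] by auto
      have "\<exists>r>0. l2.mball x r \<subseteq> U" using U x by (simp add: l2.openin_mtopology)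
      then obtain e where e: "e > 0" "l2.mball x e \<subseteq> U" by (elim exE conjE)
      obtain q where q: "q \<in> finite_rational_seqs" "l2_dist x q < ennreal (e/2)"
        using finite_rational_seqs_dense[OF xl, of "e/2"] e by auto
      then have ql: "q \<in> l2_seqs" using finite_rational_seqs_subset by auto
      then have "l2_metric x q < e/2" using q(2) xl by (subst l2_metric_less_iff)
      then obtain r where r: "l2_metric x q < real_of_rat r" "real_of_rat r < e/2" using of_rat_dense by blast
      have "l2.mball q (of_rat r) \<subseteq> l2.mball x e"
      proof
        fix y assume y: "y \<in> l2.mball q (of_rat r)"
        then have "l2_metric x y \<le> l2_metric x q + l2_metric q y"
          using xl ql by (intro l2.triangle) auto
        then show "y \<in> l2.mball x e" using y r xl by (auto simp: l2.in_mball)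
      qed
      then have "(q, r) \<in> C" using e q by (auto simp: C_def)
      moreover have "x \<in> l2.mball q (of_rat r)" using r xl ql by (simp add: l2.in_mball l2.commute)
      ultimately show "x \<in> (\<Union>(q, r)\<in>C. l2.mball q (of_rat r))" by blast
    qed (auto simp: C_def)
    moreover have "(\<Union>(q, r)\<in>C. l2.mball q (of_rat r)) \<in> sets P"
      using C finite_rational_seqs_subset by (intro sets.countable_UN') (auto simp: C_def intro!: ball)
    ultimately show ?thesis by simp
  qed
  have F: "F \<in> P \<rightarrow>\<^sub>M S"
    unfolding S_def
  proof (rule measurable_measure_of[OF sub])
    show "F \<in> space P \<rightarrow> l2_seqs" using z by (auto simp: F_def)
    fix U assume "U \<in> {U. openin l2.mtopology U}"
    then have U: "U \<in> sets P" "U \<subseteq> l2_seqs" using opens sub by auto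
    have "F -` U \<inter> space P = U \<union> (if (\<lambda>_. 0) \<in> U then space P - l2_seqs else {})"
      using U(2) by (auto simp: F_def split: if_splits)
    moreover have "space P - l2_seqs \<in> sets P" using sets_l2_seqs by (rule sets.compl_sets)
    ultimately show "F -` U \<inter> space P \<in> sets P" using U(1) by (auto intro: sets.Un)
  qed
  define m where "m = distr P S F"
  have bp: "borel_prob_on l2.mtopology m"
    unfolding borel_prob_on_def m_def using P.prob_space_distr[OF F] sub by (simp add: S_def sets_measure_of)
  define Y where "Y = \<lparr>emm_top = l2.mtopology, emm_dist = (\<lambda>x y. ennreal (l2_metric x y)), emm_meas = m\<rparr>"
  have "mm_space Y"
    unfolding mm_space_def Y_def using Metric_space_l2 mcomplete_l2 separable_l2 bp by blast
  moreover have "emm_iso (gaussian_R_infinity \<sigma>) Y"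
    unfolding emm_iso_def emm_meas_eq
  proof (intro exI conjI)
    have Fm: "F \<in> P \<rightarrow>\<^sub>M m" using F by (simp add: m_def)
    show "F \<in> completion P \<rightarrow>\<^sub>M emm_meas Y" using measurable_completion[OF Fm] by (simp add: Y_def)
    have "distr (completion P) m F = distr P m F" by (rule distr_completion[OF Fm])
    also have "\<dots> = distr P S F" by (rule distr_cong) (simp_all add: m_def)
    finally show "distr (completion P) (emm_meas Y) F = emm_meas Y" by (simp add: Y_def m_def)
    have "emeasure P l2_seqs = 1"
      using AE_l2_seqs[OF s] P.prob_eq_1[OF sets_l2_seqs] by (simp add: P.emeasure_eq_measure)
    then show "\<exists>A\<in>sets (completion P). emeasure (completion P) A = 1 \<and>
        (\<forall>x\<in>A. \<forall>y\<in>A. emm_dist Y (F x) (F y) = emm_dist (gaussian_R_infinity \<sigma>) x y)"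
      using sets_l2_seqs by (intro bexI[of _ l2_seqs])
        (auto simp: Y_def F_def gaussian_R_infinity_def ennreal_l2_metric)
  qed
  ultimately show ?thesis by blast
qed

lemma in_X_conc_iff: "in_X_conc (gaussian_R_infinity \<sigma>) \<longleftrightarrow> \<sigma> \<longlonglongrightarrow> 0"
proof
  assume "in_X_conc (gaussian_R_infinity \<sigma>)"
  then show "\<sigma> \<longlonglongrightarrow> 0" unfolding in_X_conc_def by (intro concentrated_imp_tendsto_0) (rule conjunct2)
next
  assume "\<sigma> \<longlonglongrightarrow> 0"
  then show "in_X_conc (gaussian_R_infinity \<sigma>)"
    unfolding in_X_conc_def by (intro conjI emm_space_gaussian tendsto_0_imp_concentrated)
qed

lemma in_boundary_X_conc_iff: "in_boundary_X_conc (gaussian_R_infinity \<sigma>) \<longleftrightarrow>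
    \<sigma> \<longlonglongrightarrow> 0 \<and> (\<Sum>n. ennreal ((\<sigma> n)\<^sup>2)) = \<infinity>"
proof -
  have "(\<Sum>n. ennreal ((\<sigma> n)\<^sup>2)) = \<infinity> \<longleftrightarrow> \<not> summable (\<lambda>n. (\<sigma> n)\<^sup>2)"
  proof
    assume "(\<Sum>n. ennreal ((\<sigma> n)\<^sup>2)) = \<infinity>"
    then show "\<not> summable (\<lambda>n. (\<sigma> n)\<^sup>2)" using suminf_ennreal2[of "\<lambda>n. (\<sigma> n)\<^sup>2"] by auto
  next
    assume "\<not> summable (\<lambda>n. (\<sigma> n)\<^sup>2)"
    then show "(\<Sum>n. ennreal ((\<sigma> n)\<^sup>2)) = \<infinity>"
      using summable_suminf_not_top[of "\<lambda>n. (\<sigma> n)\<^sup>2"] by fastforce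
  qed
  moreover have "(\<exists>Y :: (nat \<Rightarrow> real) emm. mm_space Y \<and> emm_iso (gaussian_R_infinity \<sigma>) Y) \<longleftrightarrow>
      summable (\<lambda>n. (\<sigma> n)\<^sup>2)"
    using summable_imp_iso_mm_space by (auto intro: iso_mm_space_imp_summable)
  ultimately show ?thesis by (simp only: in_boundary_X_conc_def in_X_conc_iff not_not)
qed

end

section \<open>Joint normality and orthonormal sequences\<close>

text \<open>Under the probability measure with density \<open>u / Z\<close>, the variable
  \<open>X\<close> has the characteristic function of a standard normal, and Levy uniqueness
  identifies its law. The weight is there so that other variables can be encoded in it.\<close>

lemma (in prob_space) weighted_normal_law:
  fixes X u :: "'a \<Rightarrow> real"
  assumes [measurable]: "X \<in> borel_measurable M" "u \<in> borel_measurable M" "B \<in> sets borel"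
    and u: "\<And>x. 0 \<le> u x" "\<And>x. u x \<le> C"
    and cosX: "\<And>s. (\<integral>x. u x * cos (s * X x) \<partial>M) = (\<integral>x. u x \<partial>M) * exp (- s\<^sup>2 / 2)"
    and sinX: "\<And>s. (\<integral>x. u x * sin (s * X x) \<partial>M) = 0"
  shows "(\<integral>x. u x * indicator B (X x) \<partial>M) = (\<integral>x. u x \<partial>M) * measure (gauss 1) B"
proof -
  have int: "integrable M (\<lambda>x. u x * g x)" if [measurable]: "g \<in> borel_measurable M" and "\<And>x. \<bar>g x\<bar> \<le> 1"
    for g :: "'a \<Rightarrow> real"
  proof (rule integrable_const_bound[of _ C])
    have "\<bar>u x * g x\<bar> \<le> C" for x
      using mult_mono[OF u(2)[of x] that(2)[of x]] u(1)[of x] u(2)[of x] by (simp add: abs_mult)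
    then show "AE x in M. norm (u x * g x) \<le> C" by simp
  qed measurable
  have int_u: "integrable M u" using int[of "\<lambda>_. 1"] by simp
  define Z where "Z = (\<integral>x. u x \<partial>M)"
  have "Z \<ge> 0" unfolding Z_def using u by simp
  show ?thesis
  proof (cases "Z = 0")
    case True
    then have "AE x in M. u x = 0"
      using integral_nonneg_eq_0_iff_AE[OF int_u] u by (simp add: Z_def)
    then have "(\<integral>x. u x * indicator B (X x) \<partial>M) = (\<integral>x. 0 \<partial>M)" by (intro integral_cong_AE) auto
    then show ?thesis using True by (simp add: Z_def)
  next
    case False
    then have Z: "Z > 0" using \<open>Z \<ge> 0\<close> by simp
    define N where "N = density M (\<lambda>x. ennreal (u x / Z))"
    have uZ: "0 \<le> u x / Z" for x using u Z by simp
    have N: "prob_space N"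
    proof
      have "emeasure N (space N) = (\<integral>\<^sup>+x. ennreal (u x / Z) \<partial>M)"
        by (simp add: N_def emeasure_density cong: nn_integral_cong)
      also have "\<dots> = ennreal (\<integral>x. u x / Z \<partial>M)" using int_u uZ by (intro nn_integral_eq_integral) auto
      finally show "emeasure N (space N) = 1" using Z by (simp add: Z_def)
    qed
    interpret N: prob_space N by fact
    have [measurable]: "X \<in> borel_measurable N" by (simp add: N_def)
    have integral_N: "(\<integral>x. g x \<partial>N) = (\<integral>x. u x * g x \<partial>M) / Z" if [measurable]: "g \<in> borel_measurable M" for g :: "'a \<Rightarrow> real"
    proof -
      have "(\<integral>x. g x \<partial>N) = (\<integral>x. (u x / Z) * g x \<partial>M)"
        unfolding N_def using uZ by (subst integral_real_density) auto
      then show ?thesis by simp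
    qed
    define \<nu> where "\<nu> = distr N borel X"
    have "char \<nu> = char (gauss 1)"
    proof
      fix s :: real
      have "char \<nu> s = (CLINT x|N. iexp (s * X x))" unfolding char_def \<nu>_def by (subst integral_distr) auto
      also have "\<dots> = (CLINT x|N. complex_of_real (cos (s * X x)) + \<i> * complex_of_real (sin (s * X x)))"
        by (simp only: exp_Euler cos_of_real sin_of_real)
      also have "\<dots> = complex_of_real (\<integral>x. cos (s * X x) \<partial>N) + \<i> * complex_of_real (\<integral>x. sin (s * X x) \<partial>N)"
        by (subst Bochner_Integration.integral_add) (auto intro!: N.integrable_const_bound[of _ 1] simp: norm_mult)
      also have "(\<integral>x. cos (s * X x) \<partial>N) = exp (- s\<^sup>2 / 2)" using Z by (simp add: integral_N cosX Z_def)
      also have "(\<integral>x. sin (s * X x) \<partial>N) = 0" by (simp add: integral_N sinX)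
      finally show "char \<nu> s = char (gauss 1) s" by (simp add: char_std_normal_distribution)
    qed
    moreover have "real_distribution \<nu>" unfolding \<nu>_def by (rule N.real_distribution_distr) simp
    moreover have "real_distribution (gauss 1)"
      using prob_space_gauss[of 1] by (simp add: real_distribution_def real_distribution_axioms_def)
    ultimately have "\<nu> = gauss 1" by (intro Levy_uniqueness)
    then have "measure (gauss 1) B = measure N (X -` B \<inter> space N)"
      unfolding \<nu>_def by (metis \<open>B \<in> sets borel\<close> \<open>X \<in> borel_measurable N\<close> measure_distr)
    also have "\<dots> = (\<integral>x. indicator (X -` B \<inter> space N) x \<partial>N)" by simp
    also have "\<dots> = (\<integral>x. indicator B (X x) \<partial>N)" by (intro Bochner_Integration.integral_cong) (auto simp: indicator_def)
    also have "\<dots> = (\<integral>x. u x * indicator B (X x) \<partial>M) / Z" by (rule integral_N) measurable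
    finally show ?thesis using Z by (simp add: Z_def)
  qed
qed

text \<open>Joint uniqueness from the one-dimensional theorem. The induction moves the indicator of
  one coordinate into the weight, so the trigonometric integrals of the others must be known for the
  new weight; these come from one-dimensional uniqueness with weights
  \<open>w x * (1 + cos (T t x))\<close> and \<open>w x * (1 + sin (T t x))\<close>.\<close>

lemma (in prob_space) weighted_joint_normal_law:
  fixes X :: "'i \<Rightarrow> 'a \<Rightarrow> real" and w :: "'a \<Rightarrow> real"
  assumes J: "finite J" and X[measurable]: "\<And>j. X j \<in> borel_measurable M" and B[measurable]: "\<And>j. B j \<in> sets borel"
    and "w \<in> borel_measurable M" "\<And>x. 0 \<le> w x" "\<And>x. w x \<le> C"
    and "\<And>t. (\<integral>x. w x * cos (\<Sum>j\<in>J. t j * X j x) \<partial>M) = (\<integral>x. w x \<partial>M) * exp (- (\<Sum>j\<in>J. (t j)\<^sup>2) / 2)"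
    and "\<And>t. (\<integral>x. w x * sin (\<Sum>j\<in>J. t j * X j x) \<partial>M) = 0"
  shows "(\<integral>x. w x * (\<Prod>j\<in>J. indicator (B j) (X j x)) \<partial>M) = (\<integral>x. w x \<partial>M) * (\<Prod>j\<in>J. measure (gauss 1) (B j))"
  using J assms(4-)
proof (induction J arbitrary: w rule: finite_induct)
  case (insert j J)
  note [measurable] = insert.prems(1)
  note w = insert.prems(2,3)
  define W where "W = (\<integral>x. w x \<partial>M)"
  let ?\<gamma> = "measure (gauss 1) (B j)"
  have int: "integrable M (\<lambda>x. w x * g x)" if [measurable]: "g \<in> borel_measurable M" and "\<And>x. \<bar>g x\<bar> \<le> 1"
    for g :: "'a \<Rightarrow> real"
  proof (rule integrable_const_bound[of _ C])
    have "\<bar>w x * g x\<bar> \<le> C" for x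
      using mult_mono[OF w(2)[of x] that(2)[of x]] w(1)[of x] w(2)[of x] by (simp add: abs_mult)
    then show "AE x in M. norm (w x * g x) \<le> C" by simp
  qed measurable
  have int_w: "integrable M w" using int[of "\<lambda>_. 1"] by simp
  define T where "T t x = (\<Sum>i\<in>J. t i * X i x)" for t :: "'i \<Rightarrow> real" and x
  have T[measurable]: "T t \<in> borel_measurable M" for t unfolding T_def by measurable
  have T_minus: "T (\<lambda>i. - t i) x = - T t x" for t x by (simp add: T_def sum_negf)
  define q where "q t = exp (- (\<Sum>i\<in>J. (t i)\<^sup>2) / 2)" for t :: "'i \<Rightarrow> real"
  have q_minus: "q (\<lambda>i. - t i) = q t" for t by (simp add: q_def)
  have split: "(\<Sum>i\<in>insert j J. (t(j := s)) i * X i x) = s * X j x + T t x"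
    "(\<Sum>i\<in>insert j J. ((t(j := s)) i)\<^sup>2) = s\<^sup>2 + (\<Sum>i\<in>J. (t i)\<^sup>2)" for t s x
  proof -
    have "(\<Sum>i\<in>J. (t(j := s)) i * X i x) = T t x" unfolding T_def using insert.hyps by (intro sum.cong) auto
    then show "(\<Sum>i\<in>insert j J. (t(j := s)) i * X i x) = s * X j x + T t x" using insert.hyps by simp
    have "(\<Sum>i\<in>J. ((t(j := s)) i)\<^sup>2) = (\<Sum>i\<in>J. (t i)\<^sup>2)" using insert.hyps by (intro sum.cong) auto
    then show "(\<Sum>i\<in>insert j J. ((t(j := s)) i)\<^sup>2) = s\<^sup>2 + (\<Sum>i\<in>J. (t i)\<^sup>2)" using insert.hyps by simp
  qed
  have c: "(\<integral>x. w x * cos (s * X j x + T t x) \<partial>M) = W * (exp (- s\<^sup>2 / 2) * q t)" for s t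
  proof -
    have "(\<integral>x. w x * cos (s * X j x + T t x) \<partial>M) = W * exp (- (s\<^sup>2 + (\<Sum>i\<in>J. (t i)\<^sup>2)) / 2)"
      using insert.prems(4)[of "t(j := s)"] unfolding split W_def .
    also have "exp (- (s\<^sup>2 + (\<Sum>i\<in>J. (t i)\<^sup>2)) / 2) = exp (- s\<^sup>2 / 2) * q t"
      unfolding q_def mult_exp_exp by (simp add: field_simps)
    finally show ?thesis .
  qed
  have sn: "(\<integral>x. w x * sin (s * X j x + T t x) \<partial>M) = 0" for s t
    using insert.prems(5)[of "t(j := s)"] unfolding split .
  have c': "(\<integral>x. w x * cos (s * X j x - T t x) \<partial>M) = W * (exp (- s\<^sup>2 / 2) * q t)" for s t
    using c[of s "\<lambda>i. - t i"] by (simp add: T_minus q_minus)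
  have sn': "(\<integral>x. w x * sin (s * X j x - T t x) \<partial>M) = 0" for s t
    using sn[of s "\<lambda>i. - t i"] by (simp add: T_minus)
  have T0: "T (\<lambda>_. 0) x = 0" "q (\<lambda>_. 0) = 1" for x by (simp_all add: T_def q_def)
  have c0: "(\<integral>x. w x * cos (s * X j x) \<partial>M) = W * exp (- s\<^sup>2 / 2)" for s
    using c[of s "\<lambda>_. 0"] by (simp add: T0)
  have s0: "(\<integral>x. w x * sin (s * X j x) \<partial>M) = 0" for s
    using sn[of s "\<lambda>_. 0"] by (simp add: T0)
  have cT: "(\<integral>x. w x * cos (T t x) \<partial>M) = W * q t" "(\<integral>x. w x * sin (T t x) \<partial>M) = 0" for t
    using c[of 0 t] sn[of 0 t] by simp_all
  have law_w: "(\<integral>x. w x * indicator (B j) (X j x) \<partial>M) = W * ?\<gamma>"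
    unfolding W_def by (rule weighted_normal_law[where C = C]) (auto simp: w c0 s0 W_def[symmetric])
  have law_cos: "(\<integral>x. w x * indicator (B j) (X j x) * cos (T t x) \<partial>M) = W * ?\<gamma> * q t" for t
  proof -
    \<comment> \<open>The added 1 keeps the weight nonnegative; its contribution is known from
      \<open>law_w\<close> and is subtracted at the end.\<close>
    let ?u = "\<lambda>x. w x * (1 + cos (T t x))"
    have int_u: "(\<integral>x. ?u x \<partial>M) = W + W * q t"
      using int_w int[of "\<lambda>x. cos (T t x)"] by (simp add: distrib_left cT W_def)
    have "(\<integral>x. ?u x * indicator (B j) (X j x) \<partial>M) = (\<integral>x. ?u x \<partial>M) * ?\<gamma>"
    proof (rule weighted_normal_law[where C = "2 * C"])
      have cb: "0 \<le> 1 + cos (T t x)" "1 + cos (T t x) \<le> 2" for x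
        using cos_ge_minus_one[of "T t x"] cos_le_one[of "T t x"] by linarith+
      show "0 \<le> ?u x" for x using w(1) cb by simp
      show "?u x \<le> 2 * C" for x
        using mult_mono[OF w(2)[of x] cb(2)[of x]] cb w(1)[of x] w(2)[of x] by (simp add: mult.commute)
      fix s
      \<comment> \<open>The product formulas turn \<open>cos (T t x) * cos (s * X j x)\<close> into
        cosines of linear combinations, whose integrals are given.\<close>
      have "(\<integral>x. ?u x * cos (s * X j x) \<partial>M) =
          (\<integral>x. w x * cos (s * X j x) + (w x * cos (s * X j x + T t x) + w x * cos (s * X j x - T t x)) / 2 \<partial>M)"
        by (intro Bochner_Integration.integral_cong refl) (simp add: cos_add cos_diff sin_add sin_diff algebra_simps)
      also have "\<dots> = W * exp (- s\<^sup>2 / 2) + (W * (exp (- s\<^sup>2 / 2) * q t) + W * (exp (- s\<^sup>2 / 2) * q t)) / 2"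
        by (simp add: int c c' c0)
      finally show "(\<integral>x. ?u x * cos (s * X j x) \<partial>M) = (\<integral>x. ?u x \<partial>M) * exp (- s\<^sup>2 / 2)"
        unfolding int_u by (simp add: algebra_simps)
      have "(\<integral>x. ?u x * sin (s * X j x) \<partial>M) =
          (\<integral>x. w x * sin (s * X j x) + (w x * sin (s * X j x + T t x) + w x * sin (s * X j x - T t x)) / 2 \<partial>M)"
        by (intro Bochner_Integration.integral_cong refl) (simp add: cos_add cos_diff sin_add sin_diff algebra_simps)
      also have "\<dots> = 0" by (simp add: int sn sn' s0)
      finally show "(\<integral>x. ?u x * sin (s * X j x) \<partial>M) = 0" .
    qed measurable
    moreover have "(\<integral>x. ?u x * indicator (B j) (X j x) \<partial>M) =
        (\<integral>x. w x * indicator (B j) (X j x) + w x * (indicator (B j) (X j x) * cos (T t x)) \<partial>M)"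
      by (intro Bochner_Integration.integral_cong refl) (simp add: algebra_simps)
    moreover have "integrable M (\<lambda>x. w x * indicator (B j) (X j x))"
      "integrable M (\<lambda>x. w x * (indicator (B j) (X j x) * cos (T t x)))"
      by (intro int; simp add: indicator_def)+
    then have "(\<integral>x. w x * indicator (B j) (X j x) + w x * (indicator (B j) (X j x) * cos (T t x)) \<partial>M) =
        W * ?\<gamma> + (\<integral>x. w x * (indicator (B j) (X j x) * cos (T t x)) \<partial>M)"
      by (simp only: Bochner_Integration.integral_add law_w)
    ultimately show ?thesis unfolding int_u by (simp add: algebra_simps)
  qed
  have law_sin: "(\<integral>x. w x * indicator (B j) (X j x) * sin (T t x) \<partial>M) = 0" for t
  proof -
    let ?u = "\<lambda>x. w x * (1 + sin (T t x))"
    have int_u: "(\<integral>x. ?u x \<partial>M) = W"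
      using int_w int[of "\<lambda>x. sin (T t x)"] by (simp add: distrib_left cT W_def)
    have "(\<integral>x. ?u x * indicator (B j) (X j x) \<partial>M) = (\<integral>x. ?u x \<partial>M) * ?\<gamma>"
    proof (rule weighted_normal_law[where C = "2 * C"])
      have cb: "0 \<le> 1 + sin (T t x)" "1 + sin (T t x) \<le> 2" for x
        using sin_ge_minus_one[of "T t x"] sin_le_one[of "T t x"] by linarith+
      show "0 \<le> ?u x" for x using w(1) cb by simp
      show "?u x \<le> 2 * C" for x
        using mult_mono[OF w(2)[of x] cb(2)[of x]] cb w(1)[of x] w(2)[of x] by (simp add: mult.commute)
      fix s
      have "(\<integral>x. ?u x * cos (s * X j x) \<partial>M) =
          (\<integral>x. w x * cos (s * X j x) + (w x * sin (s * X j x + T t x) - w x * sin (s * X j x - T t x)) / 2 \<partial>M)"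
        by (intro Bochner_Integration.integral_cong refl) (simp add: cos_add cos_diff sin_add sin_diff algebra_simps)
      also have "\<dots> = W * exp (- s\<^sup>2 / 2)"
        by (simp add: int c0 sn sn')
      finally show "(\<integral>x. ?u x * cos (s * X j x) \<partial>M) = (\<integral>x. ?u x \<partial>M) * exp (- s\<^sup>2 / 2)"
        unfolding int_u by simp
      have "(\<integral>x. ?u x * sin (s * X j x) \<partial>M) =
          (\<integral>x. w x * sin (s * X j x) + (w x * cos (s * X j x - T t x) - w x * cos (s * X j x + T t x)) / 2 \<partial>M)"
        by (intro Bochner_Integration.integral_cong refl) (simp add: cos_add cos_diff sin_add sin_diff algebra_simps)
      also have "\<dots> = 0" by (simp add: int c c' s0)
      finally show "(\<integral>x. ?u x * sin (s * X j x) \<partial>M) = 0" .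
    qed measurable
    moreover have "(\<integral>x. ?u x * indicator (B j) (X j x) \<partial>M) =
        (\<integral>x. w x * indicator (B j) (X j x) + w x * (indicator (B j) (X j x) * sin (T t x)) \<partial>M)"
      by (intro Bochner_Integration.integral_cong refl) (simp add: algebra_simps)
    moreover have "integrable M (\<lambda>x. w x * indicator (B j) (X j x))"
      "integrable M (\<lambda>x. w x * (indicator (B j) (X j x) * sin (T t x)))"
      by (intro int; simp add: indicator_def)+
    then have "(\<integral>x. w x * indicator (B j) (X j x) + w x * (indicator (B j) (X j x) * sin (T t x)) \<partial>M) =
        W * ?\<gamma> + (\<integral>x. w x * (indicator (B j) (X j x) * sin (T t x)) \<partial>M)"
      by (simp only: Bochner_Integration.integral_add law_w)
    ultimately show ?thesis unfolding int_u by (simp add: algebra_simps)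
  qed
  have "(\<integral>x. (w x * indicator (B j) (X j x)) * (\<Prod>i\<in>J. indicator (B i) (X i x)) \<partial>M) =
      (\<integral>x. w x * indicator (B j) (X j x) \<partial>M) * (\<Prod>i\<in>J. measure (gauss 1) (B i))"
  proof (rule insert.IH)
    show "0 \<le> w x * indicator (B j) (X j x)" for x using w(1) by (simp add: indicator_def)
    show "w x * indicator (B j) (X j x) \<le> C" for x using w(1)[of x] w(2)[of x] by (simp add: indicator_def)
    show "(\<integral>x. w x * indicator (B j) (X j x) * cos (\<Sum>i\<in>J. t i * X i x) \<partial>M) =
      (\<integral>x. w x * indicator (B j) (X j x) \<partial>M) * exp (- (\<Sum>i\<in>J. (t i)\<^sup>2) / 2)" for t
      using law_cos[of t] unfolding law_w T_def q_def .
    show "(\<integral>x. w x * indicator (B j) (X j x) * sin (\<Sum>i\<in>J. t i * X i x) \<partial>M) = 0" for t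
      using law_sin[of t] unfolding T_def .
  qed measurable
  then show ?case using insert.hyps by (simp add: law_w W_def ac_simps)
qed simp

text \<open>\<open>sgn\<close> normalises nonzero vectors and fixes 0. A vector that depends
  linearly on its predecessors therefore yields 0, and the input need not be thinned out
  beforehand.\<close>

fun gram_schmidt :: "(nat \<Rightarrow> 'a::real_inner) \<Rightarrow> nat \<Rightarrow> 'a" where
  "gram_schmidt H k = sgn (H k - (\<Sum>i<k. inner (H k) (gram_schmidt H i) *\<^sub>R gram_schmidt H i))"

declare gram_schmidt.simps [simp del]

lemma gram_schmidt_self: "inner (gram_schmidt H k) (gram_schmidt H k) = (if gram_schmidt H k = 0 then 0 else 1)"
proof -
  have "norm (gram_schmidt H k) = (if gram_schmidt H k = 0 then 0 else 1)"
    unfolding gram_schmidt.simps[of H k] by (simp add: norm_sgn sgn_zero_iff)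
  then show ?thesis by (simp add: dot_square_norm)
qed

lemma gram_schmidt_orthogonal_less: "j < k \<Longrightarrow> inner (gram_schmidt H j) (gram_schmidt H k) = 0"
proof (induction k arbitrary: j rule: less_induct)
  case (less k)
  let ?e = "gram_schmidt H"
  have orth: "inner (?e j) (?e i) = (if i = j \<and> ?e j \<noteq> 0 then 1 else 0)" if "i < k" for i
    using less.IH[of i j] less.IH[of j i] that less.prems gram_schmidt_self[of H j]
    by (cases i j rule: linorder_cases) (auto simp: inner_commute)
  have "inner (?e j) (\<Sum>i<k. inner (H k) (?e i) *\<^sub>R ?e i) = (\<Sum>i<k. inner (H k) (?e i) * inner (?e j) (?e i))"
    by (simp add: inner_sum_right)
  also have "\<dots> = (\<Sum>i<k. if i = j then inner (H k) (?e j) else 0)"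
    by (intro sum.cong) (auto simp: orth)
  also have "\<dots> = inner (H k) (?e j)" using less.prems by simp
  finally have "inner (?e j) (H k - (\<Sum>i<k. inner (H k) (?e i) *\<^sub>R ?e i)) = 0"
    by (simp add: inner_diff_right inner_commute)
  then show ?case by (subst gram_schmidt.simps[of H k]) (simp add: sgn_div_norm)
qed

lemma gram_schmidt_orthogonal: "j \<noteq> k \<Longrightarrow> inner (gram_schmidt H j) (gram_schmidt H k) = 0"
  using gram_schmidt_orthogonal_less[of j k H] gram_schmidt_orthogonal_less[of k j H]
  by (cases j k rule: linorder_cases) (auto simp: inner_commute)

lemma gram_schmidt_span: "H k \<in> span (range (gram_schmidt H))"
proof -
  let ?r = "H k - (\<Sum>i<k. inner (H k) (gram_schmidt H i) *\<^sub>R gram_schmidt H i)"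
  have "x = norm x *\<^sub>R sgn x" for x :: 'a by (cases "x = 0") (simp_all add: sgn_div_norm)
  from this[of ?r] have "?r = norm ?r *\<^sub>R gram_schmidt H k" by (simp only: gram_schmidt.simps[of H k])
  then have "H k = norm ?r *\<^sub>R gram_schmidt H k + (\<Sum>i<k. inner (H k) (gram_schmidt H i) *\<^sub>R gram_schmidt H i)"
    by (simp add: algebra_simps)
  also have "\<dots> \<in> span (range (gram_schmidt H))"
    by (intro span_add span_scale span_sum span_base) auto
  finally show ?thesis .
qed

text \<open>Ensures later that orthonormalised representers of functionals are again representers of
  functionals.\<close>

lemma gram_schmidt_in_subspace:
  assumes "subspace V" "\<And>k. H k \<in> V"
  shows "gram_schmidt H k \<in> V"
proof (induction k rule: less_induct)
  case (less k)
  then have "H k - (\<Sum>i<k. inner (H k) (gram_schmidt H i) *\<^sub>R gram_schmidt H i) \<in> V"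
    by (intro subspace_diff subspace_sum subspace_scale assms) auto
  then show ?case unfolding gram_schmidt.simps[of H k] sgn_div_norm by (intro subspace_scale assms)
qed

text \<open>Completeness is stated as triviality of the orthogonal complement, the form in which
  separation by functionals delivers it.\<close>

locale orthonormal_sequence =
  fixes b :: "nat \<Rightarrow> 'h::{real_inner,complete_space}"
  assumes orthonormal: "inner (b i) (b j) = (if i = j then 1 else 0)"
    and complete: "(\<And>n. inner (b n) h = 0) \<Longrightarrow> h = 0"
begin

lemma norm_sum_square:
  assumes "finite I" shows "(norm (\<Sum>i\<in>I. c i *\<^sub>R b i))\<^sup>2 = (\<Sum>i\<in>I. (c i)\<^sup>2)"
proof -
  have "(norm (\<Sum>i\<in>I. c i *\<^sub>R b i))\<^sup>2 = (\<Sum>i\<in>I. (norm (c i *\<^sub>R b i))\<^sup>2)"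
    using assms by (intro norm_sum_Pythagorean) (auto simp: pairwise_def orthogonal_def orthonormal)
  also have "norm (b i) = 1" for i using orthonormal[of i i] by (simp add: norm_eq_1)
  then have "(\<Sum>i\<in>I. (norm (c i *\<^sub>R b i))\<^sup>2) = (\<Sum>i\<in>I. (c i)\<^sup>2)" by simp
  finally show ?thesis .
qed

text \<open>Riesz-Fischer: by Pythagoras the partial sums in the Hilbert space are Cauchy as soon as
  those of the squared coefficients are, and continuity of the inner product recovers the
  coefficients.\<close>

lemma series_converges:
  assumes s: "summable (\<lambda>n. (c n)\<^sup>2)"
  shows "\<exists>h. (\<lambda>n. \<Sum>i<n. c i *\<^sub>R b i) \<longlonglongrightarrow> h \<and> (\<forall>n. inner (b n) h = c n)"
proof -
  have "Cauchy (\<lambda>n. \<Sum>i<n. c i *\<^sub>R b i)"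
  proof (rule metric_CauchyI)
    fix e :: real assume e: "e > 0"
    have "Cauchy (\<lambda>n. \<Sum>i<n. (c i)\<^sup>2)" using s by (simp add: summable_iff_convergent convergent_Cauchy)
    then obtain N where N: "\<forall>m\<ge>N. \<forall>n\<ge>N. dist (\<Sum>i<m. (c i)\<^sup>2) (\<Sum>i<n. (c i)\<^sup>2) < e\<^sup>2"
      using metric_CauchyD[of _ "e\<^sup>2"] e by (meson zero_less_power)
    have less: "norm ((\<Sum>i<n. c i *\<^sub>R b i) - (\<Sum>i<m. c i *\<^sub>R b i)) < e" if "m \<ge> N" "n \<ge> m" for m n
    proof -
      have "(\<Sum>i<n. c i *\<^sub>R b i) - (\<Sum>i<m. c i *\<^sub>R b i) = (\<Sum>i\<in>{m..<n}. c i *\<^sub>R b i)"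
        using sum_diff_nat_ivl[of 0 m n "\<lambda>i. c i *\<^sub>R b i"] that by (simp add: atLeast0LessThan)
      then have "(norm ((\<Sum>i<n. c i *\<^sub>R b i) - (\<Sum>i<m. c i *\<^sub>R b i)))\<^sup>2 = (\<Sum>i\<in>{m..<n}. (c i)\<^sup>2)"
        by (simp add: norm_sum_square)
      also have "\<dots> = (\<Sum>i<n. (c i)\<^sup>2) - (\<Sum>i<m. (c i)\<^sup>2)"
        using sum_diff_nat_ivl[of 0 m n "\<lambda>i. (c i)\<^sup>2"] that by (simp add: atLeast0LessThan)
      also have "\<dots> < e\<^sup>2" using N[rule_format, of n m] that by (simp add: dist_real_def)
      finally show ?thesis using e by (intro power2_less_imp_less[of _ e]) auto
    qed
    have "dist (\<Sum>i<m. c i *\<^sub>R b i) (\<Sum>i<n. c i *\<^sub>R b i) < e" if "m \<ge> N" "n \<ge> N" for m n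
      using less[of m n] less[of n m] that by (cases "m \<le> n") (auto simp: dist_norm norm_minus_commute)
    then show "\<exists>N. \<forall>m\<ge>N. \<forall>n\<ge>N. dist (\<Sum>i<m. c i *\<^sub>R b i) (\<Sum>i<n. c i *\<^sub>R b i) < e" by blast
  qed
  then obtain h where h: "(\<lambda>n. \<Sum>i<n. c i *\<^sub>R b i) \<longlonglongrightarrow> h"
    using Cauchy_convergent_iff convergent_def by blast
  have "inner (b n) h = c n" for n
  proof -
    have "(\<lambda>k. inner (b n) (\<Sum>i<k. c i *\<^sub>R b i)) \<longlonglongrightarrow> inner (b n) h" by (intro tendsto_intros h)
    moreover have "eventually (\<lambda>k. inner (b n) (\<Sum>i<k. c i *\<^sub>R b i) = c n) sequentially"
      using eventually_gt_at_top[of n]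
      by eventually_elim (simp add: inner_sum_right orthonormal if_distrib[where f = "\<lambda>t. _ * t"] cong: if_cong)
    then have "(\<lambda>k. inner (b n) (\<Sum>i<k. c i *\<^sub>R b i)) \<longlonglongrightarrow> c n" by (rule tendsto_eventually)
    ultimately show ?thesis by (rule LIMSEQ_unique)
  qed
  then show ?thesis using h by blast
qed

text \<open>Bessel's inequality makes the expansion converge. Its sum has the same coefficients as
  \<open>h\<close> and equals \<open>h\<close> by completeness.\<close>

lemma parseval: "(\<lambda>n. (inner (b n) h)\<^sup>2) sums (norm h)\<^sup>2"
proof -
  have bessel: "(\<Sum>i<n. (inner (b i) h)\<^sup>2) \<le> (norm h)\<^sup>2" for n
  proof -
    let ?p = "\<Sum>i<n. inner (b i) h *\<^sub>R b i"
    have "inner h ?p = (\<Sum>i<n. (inner (b i) h)\<^sup>2)"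
      by (simp add: inner_sum_right power2_eq_square inner_commute)
    moreover have "inner ?p ?p = (\<Sum>i<n. (inner (b i) h)\<^sup>2)"
      by (simp add: norm_sum_square power2_norm_eq_inner[symmetric])
    moreover have "0 \<le> inner (h - ?p) (h - ?p)" by simp
    ultimately show ?thesis
      by (simp add: inner_diff_left inner_diff_right inner_commute[of ?p h] power2_norm_eq_inner)
  qed
  have s: "summable (\<lambda>n. (inner (b n) h)\<^sup>2)"
    by (rule summableI_nonneg_bounded[OF _ bessel]) auto
  from series_converges[OF s]
  obtain h' where h': "(\<lambda>n. \<Sum>i<n. inner (b i) h *\<^sub>R b i) \<longlonglongrightarrow> h'" "\<And>n. inner (b n) h' = inner (b n) h"
    by blast
  have "h - h' = 0" by (rule complete) (simp add: inner_diff_right h'(2))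
  then have "(\<lambda>n. \<Sum>i<n. inner (b i) h *\<^sub>R b i) \<longlonglongrightarrow> h" using h'(1) by simp
  then have "(\<lambda>n. (norm (\<Sum>i<n. inner (b i) h *\<^sub>R b i))\<^sup>2) \<longlonglongrightarrow> (norm h)\<^sup>2" by (intro tendsto_intros)
  then show ?thesis by (simp add: norm_sum_square sums_def)
qed

end

section \<open>Abstract Wiener spaces\<close>

lemma cauchy_schwarz_integral:
  fixes f g :: "'a \<Rightarrow> real"
  assumes [measurable]: "f \<in> borel_measurable M" "g \<in> borel_measurable M"
    and f: "integrable M (\<lambda>x. (f x)\<^sup>2)" and g: "integrable M (\<lambda>x. (g x)\<^sup>2)"
  shows "integrable M (\<lambda>x. f x * g x)"
    and "\<bar>\<integral>x. f x * g x \<partial>M\<bar> \<le> sqrt (\<integral>x. (f x)\<^sup>2 \<partial>M) * sqrt (\<integral>x. (g x)\<^sup>2 \<partial>M)"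
proof -
  show fg: "integrable M (\<lambda>x. f x * g x)"
  proof (rule Bochner_Integration.integrable_bound)
    show "integrable M (\<lambda>x. (f x)\<^sup>2 + (g x)\<^sup>2)" using f g by simp
    have "\<bar>a * b\<bar> \<le> a\<^sup>2 + b\<^sup>2" for a b :: real
    proof -
      have "0 \<le> (\<bar>a\<bar> - \<bar>b\<bar>)\<^sup>2" by simp
      then have "2 * \<bar>a * b\<bar> \<le> a\<^sup>2 + b\<^sup>2" unfolding power2_diff by (simp add: abs_mult)
      then show ?thesis using abs_ge_zero[of "a * b"] by linarith
    qed
    then show "AE x in M. norm (f x * g x) \<le> norm ((f x)\<^sup>2 + (g x)\<^sup>2)" by (auto intro: order_trans[OF _ abs_ge_self])
  qed measurable
  define A where "A = (\<integral>x. (f x)\<^sup>2 \<partial>M)"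
  define B where "B = (\<integral>x. (g x)\<^sup>2 \<partial>M)"
  define C where "C = (\<integral>x. f x * g x \<partial>M)"
  have AB: "A \<ge> 0" "B \<ge> 0" by (simp_all add: A_def B_def)
  have quad: "0 \<le> A + 2 * t * C + t\<^sup>2 * B" for t
  proof -
    have "0 \<le> (\<integral>x. (f x + t * g x)\<^sup>2 \<partial>M)" by simp
    also have "(\<integral>x. (f x + t * g x)\<^sup>2 \<partial>M) = (\<integral>x. ((f x)\<^sup>2 + (2 * t) * (f x * g x)) + t\<^sup>2 * (g x)\<^sup>2 \<partial>M)"
      by (intro Bochner_Integration.integral_cong refl) (simp add: power2_eq_square algebra_simps)
    also have "\<dots> = A + 2 * t * C + t\<^sup>2 * B"
      using f g fg by (simp add: A_def B_def C_def)
    finally show ?thesis .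
  qed
  have "C\<^sup>2 \<le> A * B"
  proof (cases "B = 0")
    case True
    have "C = 0"
    proof (rule ccontr)
      assume "C \<noteq> 0"
      \<comment> \<open>With \<open>B = 0\<close> the quadratic is affine in \<open>t\<close>, and
        at this \<open>t\<close> its value is -1.\<close>
      then show False using quad[of "- (A + 1) / (2 * C)"] True AB by (simp add: field_simps)
    qed
    then show ?thesis using True by simp
  next
    case False
    then have "B > 0" using AB by simp
    then show ?thesis using quad[of "- C / B"] by (simp add: power2_eq_square field_simps)
  qed
  then have "sqrt (C\<^sup>2) \<le> sqrt (A * B)" by (rule real_sqrt_le_mono)
  then show "\<bar>\<integral>x. f x * g x \<partial>M\<bar> \<le> sqrt (\<integral>x. (f x)\<^sup>2 \<partial>M) * sqrt (\<integral>x. (g x)\<^sup>2 \<partial>M)"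
    by (simp add: A_def B_def C_def real_sqrt_mult)
qed

locale wiener_space =
  fixes \<iota> :: "'h::{real_inner,complete_space,second_countable_topology} \<Rightarrow>
              'w::{banach,second_countable_topology}"
    and \<mu> :: "'w measure"
  assumes aws: "abstract_wiener_space \<iota> \<mu>"
begin

lemma
  shows bl_\<iota>: "bounded_linear \<iota>" and inj_\<iota>: "inj \<iota>" and dense_\<iota>: "closure (range \<iota>) = UNIV"
    and gaussian: "centred_gaussian \<mu>" and cm_space: "cameron_martin_space \<mu> = range \<iota>"
    and cm_norm: "cameron_martin_norm \<mu> (\<iota> h) = ereal (norm h)"
  using aws by (auto simp: abstract_wiener_space_def)

interpretation \<iota>: bounded_linear \<iota> by (rule bl_\<iota>)

lemma sets_\<mu>[measurable_cong]: "sets \<mu> = sets borel"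
  using gaussian by (simp add: centred_gaussian_def)

lemma space_\<mu>[simp]: "space \<mu> = UNIV"
  using sets_eq_imp_space_eq[OF sets_\<mu>] by simp

sublocale \<mu>: prob_space \<mu>
  using gaussian by (simp add: centred_gaussian_def)

lemma measurable_functional:
  fixes l :: "'w \<Rightarrow> real"
  assumes "bounded_linear l" shows "l \<in> borel_measurable \<mu>"
  using linear_continuous_on[OF assms, of UNIV] sets_\<mu>
  by (metis borel_measurable_continuous_onI measurable_cong_sets)

text \<open>For continuous linear functionals this second moment is the variance, their laws being
  centred.\<close>

definition var :: "('w \<Rightarrow> real) \<Rightarrow> real" where "var l = (\<integral>x. (l x)\<^sup>2 \<partial>\<mu>)"

lemma var_nonneg: "0 \<le> var l"
  by (simp add: var_def)

lemma var_scale: "var (\<lambda>x. c * l x) = c\<^sup>2 * var l"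
  by (simp add: var_def power_mult_distrib)

lemma functional_law:
  assumes l: "bounded_linear l"
  shows "integrable \<mu> (\<lambda>x. (l x)\<^sup>2)"
    and "var l > 0 \<Longrightarrow> distr \<mu> borel l = gauss (sqrt (var l))"
proof -
  note [measurable] = measurable_functional[OF l]
  have D: "centred_gaussian_law (distr \<mu> borel l)" using gaussian l by (simp add: centred_gaussian_def)
  have int_eq: "integrable \<mu> (\<lambda>x. (l x)\<^sup>2) \<longleftrightarrow> integrable (distr \<mu> borel l) (\<lambda>t. t\<^sup>2)"
    by (subst integrable_distr_eq) auto
  have var_eq: "var l = (\<integral>t. t\<^sup>2 \<partial>distr \<mu> borel l)" unfolding var_def by (subst integral_distr) auto
  have "integrable \<mu> (\<lambda>x. (l x)\<^sup>2) \<and> (var l > 0 \<longrightarrow> distr \<mu> borel l = gauss (sqrt (var l)))"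
  proof (cases "distr \<mu> borel l = return borel 0")
    case True
    have "var l = 0" unfolding var_eq True by (subst integral_return) auto
    moreover have "integrable (return borel (0::real)) (\<lambda>t. t\<^sup>2)"
    proof (rule integrableI_bounded)
      show "(\<integral>\<^sup>+t. ennreal (norm (t\<^sup>2)) \<partial>return borel (0::real)) < \<infinity>" by (subst nn_integral_return) auto
    qed simp
    ultimately show ?thesis unfolding int_eq True by simp
  next
    case False
    then obtain s where s: "s > 0" "distr \<mu> borel l = gauss s" using D by (auto simp: centred_gaussian_law_def)
    have b: "has_bochner_integral lborel (\<lambda>x. normal_density 0 s x * x\<^sup>2) (s\<^sup>2)"
      using normal_moment_even[OF s(1), of 0 1] by (simp add: field_simps power2_eq_square)
    have "integrable (gauss s) (\<lambda>t. t\<^sup>2)"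
      using b by (subst integrable_density) (auto simp: has_bochner_integral_iff)
    moreover have "(\<integral>t. t\<^sup>2 \<partial>gauss s) = s\<^sup>2"
      using b by (subst integral_density) (auto simp: has_bochner_integral_iff)
    ultimately show ?thesis unfolding int_eq using s by (simp add: var_eq real_sqrt_abs)
  qed
  then show "integrable \<mu> (\<lambda>x. (l x)\<^sup>2)" "var l > 0 \<Longrightarrow> distr \<mu> borel l = gauss (sqrt (var l))" by auto
qed

lemma functional_le_norm:
  assumes l: "bounded_linear l" and v: "var l \<le> 1"
  shows "l (\<iota> h) \<le> norm h"
proof -
  have "ereal (l (\<iota> h)) \<le> cameron_martin_norm \<mu> (\<iota> h)"
    unfolding cameron_martin_norm_def using l v by (intro SUP_upper) (simp add: var_def)
  then show ?thesis by (simp add: cm_norm)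
qed

text \<open>Rescaling to variance 1 reduces to \<open>functional_le_norm\<close>. If the variance is
  0, all multiples of \<open>l\<close> are admissible, and \<open>l\<close> must vanish at
  \<open>\<iota> h\<close>.\<close>

lemma functional_le_sqrt_var:
  assumes l: "bounded_linear l"
  shows "\<bar>l (\<iota> h)\<bar> \<le> sqrt (var l) * norm h"
proof -
  have scaled: "c * l (\<iota> h) \<le> norm h" if "c\<^sup>2 * var l \<le> 1" for c
    using functional_le_norm[OF bounded_linear_const_mult[OF l, of c]] that by (simp add: var_scale)
  show ?thesis
  proof (cases "var l = 0")
    case True
    have "l (\<iota> h) = 0"
    proof (rule ccontr)
      assume "l (\<iota> h) \<noteq> 0"
      then show False using scaled[of "(norm h + 1) / l (\<iota> h)"] True by simp
    qed
    then show ?thesis using True by simp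
  next
    case False
    then have v: "var l > 0" using var_nonneg[of l] by simp
    have "l (\<iota> h) / sqrt (var l) \<le> norm h" "- l (\<iota> h) / sqrt (var l) \<le> norm h"
      using scaled[of "1 / sqrt (var l)"] scaled[of "- 1 / sqrt (var l)"] v by (simp_all add: power_divide)
    then show ?thesis using v by (simp add: abs_le_iff field_simps)
  qed
qed

text \<open>The converse of \<open>functional_le_norm\<close> and the source of every Cameron-Martin
  vector constructed below: a bound on all functionals of variance at most 1 yields both membership
  in the range and the norm estimate.\<close>

lemma in_range_if_bounded:
  assumes C: "\<And>l. bounded_linear l \<Longrightarrow> var l \<le> 1 \<Longrightarrow> l w \<le> C"
  shows "\<exists>h. w = \<iota> h \<and> norm h \<le> C"
proof -
  have le: "cameron_martin_norm \<mu> w \<le> ereal C"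
    unfolding cameron_martin_norm_def using C by (intro SUP_least) (simp add: var_def)
  then have "w \<in> cameron_martin_space \<mu>" by (auto simp: cameron_martin_space_def)
  then obtain h where h: "w = \<iota> h" using cm_space by auto
  then show ?thesis using le by (auto simp: cm_norm)
qed

text \<open>A vector annihilated by all functionals has Cameron-Martin norm at most 0, so point
  separation follows from the identification of the Cameron-Martin space, without
  Hahn-Banach.\<close>

lemma functionals_separate:
  assumes "\<And>l :: 'w \<Rightarrow> real. bounded_linear l \<Longrightarrow> l w = 0"
  shows "w = 0"
proof -
  have "\<exists>h. w = \<iota> h \<and> norm h \<le> 0" by (rule in_range_if_bounded) (simp add: assms)
  then show ?thesis by (auto simp: \<iota>.zero)
qed

lemma functional_eq_if_eq_on_range:
  fixes k l :: "'w \<Rightarrow> real"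
  assumes "bounded_linear k" "bounded_linear l" "\<And>h. k (\<iota> h) = l (\<iota> h)"
  shows "k = l"
proof
  fix w
  have "closed {w. k w = l w}"
    using assms(1,2) by (intro closed_Collect_eq linear_continuous_on)
  then have "closure (range \<iota>) \<subseteq> {w. k w = l w}" using assms(3) by (intro closure_minimal) auto
  then show "k w = l w" using dense_\<iota> by auto
qed

text \<open>Formally the vector is the integral of \<open>k x *\<^sub>R x\<close>, whose
  integrability would need a moment bound on the norm of \<open>W\<close>. Truncation to balls gives
  \<open>w n\<close>; by Cauchy-Schwarz their Cameron-Martin distances are governed by tails of the
  integral of \<open>(k x)\<^sup>2\<close>, so their preimages converge in the Hilbert
  space.\<close>

lemma exists_representer:
  assumes k: "bounded_linear k"
  shows "\<exists>h. norm h \<le> sqrt (var k) \<and> (\<forall>l. bounded_linear l \<longrightarrow> l (\<iota> h) = (\<integral>x. l x * k x \<partial>\<mu>))"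
proof -
  note [measurable] = measurable_functional[OF k]
  note cs = cauchy_schwarz_integral[OF measurable_functional measurable_functional
      functional_law(1) functional_law(1)]
  have idm[measurable]: "(\<lambda>x. x) \<in> \<mu> \<rightarrow>\<^sub>M borel" by (simp add: measurable_ident_sets sets_\<mu>)
  obtain K where K: "\<And>x. norm (k x) \<le> norm x * K" "K > 0" using bounded_linear.pos_bounded[OF k] by blast
  define c :: "nat \<Rightarrow> 'w \<Rightarrow> real" where "c n = indicator (cball 0 (real n))" for n
  have [measurable]: "c n \<in> borel_measurable \<mu>" for n
    unfolding c_def by (intro borel_measurable_indicator) (simp add: sets_\<mu>)
  have c01: "c n x = 0 \<or> c n x = 1" for n x by (simp add: c_def indicator_def)
  have c_le: "norm (c n x * t) \<le> norm t" for n x and t :: real by (simp add: c_def indicator_def)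
  define w where "w n = (\<integral>x. (c n x * k x) *\<^sub>R x \<partial>\<mu>)" for n
  have int_w: "integrable \<mu> (\<lambda>x. (c n x * k x) *\<^sub>R x)" for n
  proof (rule \<mu>.integrable_const_bound)
    have "norm ((c n x * k x) *\<^sub>R x) \<le> (real n * K) * real n" for x
    proof (cases "x \<in> cball 0 (real n)")
      case True
      then have "norm x \<le> real n" by simp
      then have "norm (k x) * norm x \<le> (real n * K) * real n"
        using K by (intro mult_mono order_trans[OF K(1)] mult_right_mono) auto
      then show ?thesis using True by (simp add: c_def)
    qed (use K in \<open>simp add: c_def\<close>)
    then show "AE x in \<mu>. norm ((c n x * k x) *\<^sub>R x) \<le> (real n * K) * real n" by simp
  qed measurable
  have lw: "l (w n) = (\<integral>x. c n x * (l x * k x) \<partial>\<mu>)" if l: "bounded_linear l" for l n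
  proof -
    have "l (w n) = (\<integral>x. l ((c n x * k x) *\<^sub>R x) \<partial>\<mu>)"
      unfolding w_def by (rule integral_bounded_linear[OF l int_w, symmetric])
    moreover have "l ((c n x * k x) *\<^sub>R x) = c n x * (l x * k x)" for x
      using linear_scale[OF bounded_linear.linear[OF l]] by (simp add: ac_simps)
    ultimately show ?thesis by simp
  qed
  have sq_k: "integrable \<mu> (\<lambda>x. (k x)\<^sup>2)" by (rule functional_law(1)[OF k])
  \<comment> \<open>The second moment of \<open>k\<close> outside the ball of radius
    \<open>n\<close>, which tends to 0 and bounds the squared Cameron-Martin norm of
    \<open>w m - w n\<close> for \<open>m \<ge> n\<close>.\<close>
  define r where "r n = (\<integral>x. (1 - c n x) * (k x)\<^sup>2 \<partial>\<mu>)" for n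
  have dom: "(\<lambda>n. \<integral>x. c n x * f x \<partial>\<mu>) \<longlonglongrightarrow> (\<integral>x. f x \<partial>\<mu>)"
    if f: "integrable \<mu> f" and [measurable]: "f \<in> borel_measurable \<mu>" for f :: "'w \<Rightarrow> real"
  proof (rule integral_dominated_convergence)
    show "integrable \<mu> (\<lambda>x. norm (f x))" using f by simp
    show "AE x in \<mu>. norm (c n x * f x) \<le> norm (f x)" for n
      by (intro AE_I2 c_le)
    have "eventually (\<lambda>n. c n x * f x = f x) sequentially" for x
    proof -
      obtain N where N: "norm x \<le> real N" using real_arch_simple by blast
      show ?thesis unfolding eventually_sequentially
        using N by (intro exI[of _ N]) (auto simp: c_def indicator_def)
    qed
    then show "AE x in \<mu>. (\<lambda>n. c n x * f x) \<longlonglongrightarrow> f x" by (intro AE_I2 tendsto_eventually)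
  qed measurable
  have int_c: "integrable \<mu> (\<lambda>x. c n x * f x)" if "integrable \<mu> f" for f :: "'w \<Rightarrow> real" and n
  proof (rule Bochner_Integration.integrable_bound[OF that])
    show "AE x in \<mu>. norm (c n x * f x) \<le> norm (f x)"
      by (intro AE_I2 c_le)
  qed (use that in measurable)
  have r_eq: "r n = var k - (\<integral>x. c n x * (k x)\<^sup>2 \<partial>\<mu>)" for n
    using sq_k int_c[OF sq_k] by (simp add: r_def var_def left_diff_distrib)
  have "(\<lambda>n. var k - (\<integral>x. c n x * (k x)\<^sup>2 \<partial>\<mu>)) \<longlonglongrightarrow> var k - (\<integral>x. (k x)\<^sup>2 \<partial>\<mu>)"
    by (intro tendsto_intros dom sq_k) measurable
  then have r0: "r \<longlonglongrightarrow> 0" unfolding r_eq[abs_def] by (simp add: var_def)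
  have bound: "l (w m - w n) \<le> sqrt (r n)" if l: "bounded_linear l" "var l \<le> 1" and "n \<le> m" for l m n
  proof -
    note [measurable] = measurable_functional[OF l(1)]
    have mono: "c n x \<le> c m x" for x using \<open>n \<le> m\<close> by (auto simp: c_def indicator_def)
    have d01: "(c m x - c n x)\<^sup>2 \<le> 1 - c n x" for x
      using mono[of x] c01[of n x] c01[of m x] by auto
    have sq_l: "integrable \<mu> (\<lambda>x. (l x)\<^sup>2)" by (rule functional_law(1)[OF l(1)])
    have int1: "integrable \<mu> (\<lambda>x. (1 - c n x) * (k x)\<^sup>2)"
      using sq_k int_c[OF sq_k] by (simp add: left_diff_distrib)
    have int2: "integrable \<mu> (\<lambda>x. ((c m x - c n x) * k x)\<^sup>2)"
    proof (rule Bochner_Integration.integrable_bound[OF int1])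
      show "AE x in \<mu>. norm (((c m x - c n x) * k x)\<^sup>2) \<le> norm ((1 - c n x) * (k x)\<^sup>2)"
        using d01 by (intro AE_I2) (auto simp: power_mult_distrib intro!: mult_right_mono order_trans[OF _ abs_ge_self])
    qed measurable
    have "(\<integral>x. ((c m x - c n x) * k x)\<^sup>2 \<partial>\<mu>) \<le> r n"
      unfolding r_def using d01 by (intro integral_mono int1 int2) (auto simp: power_mult_distrib intro!: mult_right_mono)
    then have sr: "sqrt (\<integral>x. ((c m x - c n x) * k x)\<^sup>2 \<partial>\<mu>) \<le> sqrt (r n)" by (rule real_sqrt_le_mono)
    have "integrable \<mu> (\<lambda>x. l x * k x)" by (rule cs(1)[OF l(1) k l(1) k])
    then have "l (w m - w n) = (\<integral>x. c m x * (l x * k x) - c n x * (l x * k x) \<partial>\<mu>)"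
      using linear_diff[OF bounded_linear.linear[OF l(1)]] int_c by (simp add: lw l(1))
    also have "\<dots> = (\<integral>x. l x * ((c m x - c n x) * k x) \<partial>\<mu>)"
      by (intro Bochner_Integration.integral_cong refl) (simp add: algebra_simps)
    also have "\<dots> \<le> sqrt (var l) * sqrt (\<integral>x. ((c m x - c n x) * k x)\<^sup>2 \<partial>\<mu>)"
      unfolding var_def
      by (rule order_trans[OF abs_ge_self cauchy_schwarz_integral(2)[OF _ _ sq_l int2]]) measurable
    also have "\<dots> \<le> 1 * sqrt (r n)"
      using l(2) sr by (intro mult_mono) (auto simp: real_sqrt_le_1_iff)
    finally show ?thesis by simp
  qed
  have w0: "w 0 = 0"
  proof -
    have "(c 0 x * k x) *\<^sub>R x = 0" for x by (auto simp: c_def indicator_def)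
    then show ?thesis unfolding w_def by (simp only: integral_zero)
  qed
  \<comment> \<open>Comparison with \<open>w 0 = 0\<close> shows that each \<open>w n\<close> itself
    lies in the range of \<open>\<iota>\<close>.\<close>
  have "\<exists>g. w n = \<iota> g \<and> norm g \<le> sqrt (r 0)" for n
  proof (rule in_range_if_bounded)
    show "l (w n) \<le> sqrt (r 0)" if "bounded_linear l" "var l \<le> 1" for l
      using bound[OF that, of 0 n] w0 by simp
  qed
  then obtain g where g: "\<And>n. w n = \<iota> (g n)" by metis
  have dg: "norm (g m - g n) \<le> sqrt (r n)" if nm: "n \<le> m" for m n
  proof -
    have "\<exists>h. w m - w n = \<iota> h \<and> norm h \<le> sqrt (r n)"
      by (rule in_range_if_bounded) (rule bound[OF _ _ nm])
    then obtain h where h: "w m - w n = \<iota> h" "norm h \<le> sqrt (r n)" by blast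
    then have "h = g m - g n" using injD[OF inj_\<iota>] by (metis g \<iota>.diff)
    then show ?thesis using h by simp
  qed
  have "Cauchy g"
  proof (rule metric_CauchyI)
    fix e :: real assume e: "e > 0"
    have "(\<lambda>n. sqrt (r n)) \<longlonglongrightarrow> sqrt 0" by (intro tendsto_intros r0)
    then have "eventually (\<lambda>n. sqrt (r n) < e) sequentially" using order_tendstoD(2)[of _ "sqrt 0" _ e] e by simp
    then obtain N where N: "\<And>n. n \<ge> N \<Longrightarrow> sqrt (r n) < e" by (auto simp: eventually_sequentially)
    have "dist (g m) (g n) < e" if "m \<ge> N" "n \<ge> N" for m n
      using dg[of m n] dg[of n m] N[OF that(1)] N[OF that(2)]
      by (cases "m \<le> n") (auto simp: dist_norm norm_minus_commute)
    then show "\<exists>N. \<forall>m\<ge>N. \<forall>n\<ge>N. dist (g m) (g n) < e" by blast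
  qed
  then obtain h where h: "g \<longlonglongrightarrow> h" using Cauchy_convergent_iff convergent_def by blast
  have lh: "l (\<iota> h) = (\<integral>x. l x * k x \<partial>\<mu>)" if l: "bounded_linear l" for l
  proof -
    note [measurable] = measurable_functional[OF l]
    have "(\<lambda>n. l (\<iota> (g n))) \<longlonglongrightarrow> l (\<iota> h)"
      by (intro bounded_linear.tendsto[OF l] \<iota>.tendsto h)
    moreover have "(\<lambda>n. l (\<iota> (g n))) \<longlonglongrightarrow> (\<integral>x. l x * k x \<partial>\<mu>)"
      unfolding g[symmetric] lw[OF l]
      by (rule dom[OF cs(1)[OF l k l k]]) measurable
    ultimately show ?thesis by (rule LIMSEQ_unique)
  qed
  have "\<exists>h'. \<iota> h = \<iota> h' \<and> norm h' \<le> sqrt (var k)"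
  proof (rule in_range_if_bounded)
    fix l assume l: "bounded_linear l" "var l \<le> 1"
    have "l (\<iota> h) \<le> sqrt (var l) * sqrt (var k)"
      unfolding lh[OF l(1)] var_def by (rule order_trans[OF abs_ge_self cs(2)[OF l(1) k l(1) k]])
    also have "\<dots> \<le> 1 * sqrt (var k)" using l(2) var_nonneg[of k] by (intro mult_right_mono) (auto simp: real_sqrt_le_1_iff)
    finally show "l (\<iota> h) \<le> sqrt (var k)" by simp
  qed
  then have "norm h \<le> sqrt (var k)" using injD[OF inj_\<iota>] by metis
  then show ?thesis using lh by blast
qed

definition rep :: "('w \<Rightarrow> real) \<Rightarrow> 'h" where
  "rep k = (SOME h. norm h \<le> sqrt (var k) \<and> (\<forall>l. bounded_linear l \<longrightarrow> l (\<iota> h) = (\<integral>x. l x * k x \<partial>\<mu>)))"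

lemma
  assumes "bounded_linear k"
  shows norm_rep_le: "norm (rep k) \<le> sqrt (var k)"
    and functional_rep: "bounded_linear l \<Longrightarrow> l (\<iota> (rep k)) = (\<integral>x. l x * k x \<partial>\<mu>)"
  using someI_ex[OF exists_representer[OF assms]] by (auto simp: rep_def)

text \<open>The functional \<open>\<phi> = k \<circ> \<iota>\<close> attains its norm at \<open>rep k\<close>, hence vanishes on the orthogonal complement of \<open>rep k\<close>.\<close>

lemma inner_rep:
  assumes k: "bounded_linear k"
  shows "inner (rep k) h = k (\<iota> h)"
proof -
  define a where "a = sqrt (var k)"
  define \<phi> where "\<phi> h = k (\<iota> h)" for h
  have lin: "\<phi> (x + t *\<^sub>R y) = \<phi> x + t * \<phi> y" for x y t
    using linear_add[OF bounded_linear.linear[OF k]] linear_scale[OF bounded_linear.linear[OF k]]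
    by (simp add: \<phi>_def \<iota>.add \<iota>.scaleR)
  have le: "\<bar>\<phi> x\<bar> \<le> a * norm x" for x unfolding \<phi>_def a_def by (rule functional_le_sqrt_var[OF k])
  have a: "a \<ge> 0" by (simp add: a_def var_nonneg)
  have \<phi>_rep: "\<phi> (rep k) = a\<^sup>2"
    using functional_rep[OF k k] var_nonneg[of k] by (simp add: \<phi>_def a_def var_def power2_eq_square)
  have na: "norm (rep k) = a"
  proof (cases "a = 0")
    case True then show ?thesis using norm_rep_le[OF k] by (simp add: a_def)
  next
    case False
    have "a * a \<le> a * norm (rep k)" using le[of "rep k"] \<phi>_rep by (simp add: power2_eq_square)
    then have "a \<le> norm (rep k)" using False a by simp
    then show ?thesis using norm_rep_le[OF k] by (simp add: a_def)
  qed
  show ?thesis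
  proof (cases "a = 0")
    case True
    then show ?thesis using le[of h] na by (simp add: \<phi>_def)
  next
    case False
    then have a: "a > 0" using a by simp
    \<comment> \<open>The component of \<open>h\<close> orthogonal to \<open>rep k\<close>. If
      \<open>\<phi> g\<close> were nonzero, moving from \<open>rep k\<close> along \<open>g\<close>
      would raise \<open>\<phi>\<close> to first order but the norm only to second order.\<close>
    define g where "g = h + (- inner (rep k) h / a\<^sup>2) *\<^sub>R rep k"
    have rr: "inner (rep k) (rep k) = a\<^sup>2" using na by (simp add: power2_norm_eq_inner[symmetric])
    have g0: "inner (rep k) g = 0" using a rr by (simp add: g_def inner_add_right inner_diff_right)
    have "\<phi> g = 0"
    proof (rule ccontr)
      assume ng: "\<phi> g \<noteq> 0"
      have quad: "2 * t * \<phi> g \<le> t\<^sup>2 * (norm g)\<^sup>2" for t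
      proof -
        have "(\<phi> (rep k + t *\<^sub>R g))\<^sup>2 \<le> (a * norm (rep k + t *\<^sub>R g))\<^sup>2"
          using le[of "rep k + t *\<^sub>R g"] by (metis abs_le_square_iff abs_of_nonneg abs_ge_zero order_trans)
        also have "(a * norm (rep k + t *\<^sub>R g))\<^sup>2 = a\<^sup>2 * (a\<^sup>2 + t\<^sup>2 * (norm g)\<^sup>2)"
          unfolding power_mult_distrib power2_norm_eq_inner
          using g0 rr by (simp add: inner_add_left inner_add_right inner_commute[of g "rep k"] power2_eq_square)
        finally have "(a\<^sup>2 + t * \<phi> g)\<^sup>2 \<le> a\<^sup>2 * (a\<^sup>2 + t\<^sup>2 * (norm g)\<^sup>2)" by (simp add: lin \<phi>_rep)
        moreover have "0 \<le> (t * \<phi> g)\<^sup>2" by simp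
        ultimately have "a\<^sup>2 * (2 * t * \<phi> g) \<le> a\<^sup>2 * (t\<^sup>2 * (norm g)\<^sup>2)"
          by (simp add: power2_sum power2_eq_square algebra_simps)
        then show ?thesis using a by (simp add: mult_le_cancel_left_pos)
      qed
      \<comment> \<open>Small enough for the linear term to be at least twice the quadratic one; the
        added 1 avoids division by zero.\<close>
      define t where "t = \<phi> g / ((norm g)\<^sup>2 + 1)"
      have d: "(norm g)\<^sup>2 + 1 > 0" by (simp add: add_nonneg_pos)
      have "2 * t * \<phi> g = 2 * (\<phi> g)\<^sup>2 / ((norm g)\<^sup>2 + 1)" by (simp add: t_def power2_eq_square)
      moreover have "t\<^sup>2 * (norm g)\<^sup>2 \<le> (\<phi> g)\<^sup>2 / ((norm g)\<^sup>2 + 1)"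
      proof -
        have "t\<^sup>2 * (norm g)\<^sup>2 \<le> t\<^sup>2 * ((norm g)\<^sup>2 + 1)" by (intro mult_left_mono) auto
        also have "\<dots> = (\<phi> g)\<^sup>2 / ((norm g)\<^sup>2 + 1)" using d by (simp add: t_def power_divide power2_eq_square)
        finally show ?thesis .
      qed
      moreover have "(\<phi> g)\<^sup>2 / ((norm g)\<^sup>2 + 1) > 0" using ng d by simp
      ultimately show False using quad[of t] by linarith
    qed
    moreover have "\<phi> g = \<phi> h + (- inner (rep k) h / a\<^sup>2) * \<phi> (rep k)" unfolding g_def by (rule lin)
    ultimately have "\<phi> h = (inner (rep k) h / a\<^sup>2) * a\<^sup>2" by (simp add: \<phi>_rep)
    then show ?thesis using a by (simp add: \<phi>_def)
  qed
qed

lemma inner_rep_rep: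
  assumes "bounded_linear k" "bounded_linear l"
  shows "inner (rep k) (rep l) = (\<integral>x. k x * l x \<partial>\<mu>)"
  using inner_rep[OF assms(1), of "rep l"] functional_rep[OF assms(2,1)] by simp

lemma rep_eqI:
  assumes "bounded_linear k" "\<And>h. inner v h = k (\<iota> h)"
  shows "rep k = v"
proof -
  have "inner (rep k - v) (rep k - v) = 0" using assms inner_rep[OF assms(1)] by (simp add: inner_diff_left)
  then show ?thesis by simp
qed

lemma inj_rep:
  assumes "bounded_linear k" "bounded_linear l" "rep k = rep l"
  shows "k = l"
  using functional_eq_if_eq_on_range[OF assms(1,2)] inner_rep[OF assms(1)] inner_rep[OF assms(2)] assms(3) by metis

text \<open>Used in two ways: with \<open>u = 0\<close> it is the space of all representers, and
  with arbitrary \<open>u\<close> it lets vanishing at \<open>u\<close> spread from a spanning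
  family to its whole span.\<close>

lemma subspace_rep: "subspace {rep k |k. bounded_linear k \<and> k u = 0}"
proof (rule subspaceI)
  have "rep (\<lambda>_. 0) = 0" by (rule rep_eqI) (auto intro: bounded_linear_zero)
  then show "0 \<in> {rep k |k. bounded_linear k \<and> k u = 0}"
    using bounded_linear_zero by force
  fix x y c assume "x \<in> {rep k |k. bounded_linear k \<and> k u = 0}"
  then obtain k where k: "x = rep k" "bounded_linear k" "k u = 0" by auto
  have "rep (\<lambda>w. c * k w) = c *\<^sub>R x"
    using k by (intro rep_eqI bounded_linear_const_mult) (auto simp: inner_rep)
  then show "c *\<^sub>R x \<in> {rep k |k. bounded_linear k \<and> k u = 0}"
    using k bounded_linear_const_mult[OF k(2), of c] by force
  assume "y \<in> {rep k |k. bounded_linear k \<and> k u = 0}"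
  then obtain l where l: "y = rep l" "bounded_linear l" "l u = 0" by auto
  have "rep (\<lambda>w. k w + l w) = x + y"
    using k l by (intro rep_eqI bounded_linear_add) (auto simp: inner_rep inner_add_left)
  then show "x + y \<in> {rep k |k. bounded_linear k \<and> k u = 0}"
    using k l bounded_linear_add[OF k(2) l(2)] by force
qed

text \<open>The open sets where some functional is nonzero cover everything but 0. By Lindelof
  countably many of them do, and one functional is chosen for each.\<close>

lemma countable_separating:
  "\<exists>l :: nat \<Rightarrow> 'w \<Rightarrow> real. (\<forall>n. bounded_linear (l n)) \<and> (\<forall>w. (\<forall>n. l n w = 0) \<longrightarrow> w = 0)"
proof -
  define U where "U l = {w. l w \<noteq> 0}" for l :: "'w \<Rightarrow> real"
  let ?F = "U ` {l. bounded_linear l}"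
  have "open S" if "S \<in> ?F" for S
    using that by (auto simp: U_def intro!: open_Collect_neq linear_continuous_on continuous_on_const)
  then obtain F' where F': "F' \<subseteq> ?F" "countable F'" "\<Union>F' = \<Union>?F"
    using Lindelof[of ?F] by metis
  \<comment> \<open>The zero functional only keeps \<open>G\<close> nonempty, so that it can be
    enumerated.\<close>
  define G where "G = insert (\<lambda>_. 0) (inv_into {l. bounded_linear l} U ` F')"
  have G: "countable G" "G \<noteq> {}" using F'(2) by (auto simp: G_def)
  have "bounded_linear l" if "l \<in> G" for l
    using that F'(1) inv_into_into[of _ U "{l. bounded_linear l}"] by (auto simp: G_def bounded_linear_zero)
  moreover have "w = 0" if z: "\<And>l. l \<in> G \<Longrightarrow> l w = 0" for w
  proof (rule functionals_separate, rule ccontr)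
    fix l :: "'w \<Rightarrow> real" assume l: "bounded_linear l" "l w \<noteq> 0"
    then have "w \<in> \<Union>?F" by (auto simp: U_def)
    then obtain S where S: "S \<in> F'" "w \<in> S" using F'(3) by auto
    then have "S \<in> ?F" using F'(1) by blast
    then have "U (inv_into {l. bounded_linear l} U S) = S" by (rule f_inv_into_f)
    then show False using S z[of "inv_into {l. bounded_linear l} U S"] by (auto simp: U_def G_def)
  qed
  ultimately show ?thesis
    using G range_from_nat_into[OF G(2,1)] from_nat_into[OF G(2)]
    by (intro exI[of _ "from_nat_into G"]) (metis from_nat_into_surj[OF G(1)])
qed

end

section \<open>The Wiener space as an extended metric measure space\<close>

context wiener_space
begin

interpretation \<iota>: bounded_linear \<iota> by (rule bl_\<iota>)

definition d\<^sub>H :: "'w \<Rightarrow> 'w \<Rightarrow> ennreal" where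
  "d\<^sub>H v w = (if v - w \<in> range \<iota> then ennreal (norm (inv \<iota> (v - w))) else \<infinity>)"

lemma wiener_emm_eq: "wiener_emm \<iota> \<mu> = \<lparr>emm_top = euclidean, emm_dist = d\<^sub>H, emm_meas = \<mu>\<rparr>"
  by (simp add: wiener_emm_def d\<^sub>H_def[abs_def])

lemma d\<^sub>H_\<iota>: "v - w = \<iota> h \<Longrightarrow> d\<^sub>H v w = ennreal (norm h)"
  by (simp add: d\<^sub>H_def inv_f_f[OF inj_\<iota>])

lemma d\<^sub>H_finiteE:
  assumes "d\<^sub>H v w \<noteq> \<infinity>"
  obtains h where "v - w = \<iota> h" "d\<^sub>H v w = ennreal (norm h)"
proof -
  have "v - w \<in> range \<iota>" using assms by (auto simp: d\<^sub>H_def split: if_splits)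
  then obtain h where "v - w = \<iota> h" by blast
  then show ?thesis using that d\<^sub>H_\<iota> by blast
qed

text \<open>The dual description of the distance as a supremum of continuous functions on
  \<open>W \<times> W\<close>; lower semicontinuity is read off from it.\<close>

lemma d\<^sub>H_le_iff:
  assumes "C \<ge> 0"
  shows "d\<^sub>H v w \<le> ennreal C \<longleftrightarrow> (\<forall>l. bounded_linear l \<and> var l \<le> 1 \<longrightarrow> l (v - w) \<le> C)"
proof
  assume le: "d\<^sub>H v w \<le> ennreal C"
  then have "d\<^sub>H v w \<noteq> \<infinity>" by (auto simp: top_unique)
  then obtain h where h: "v - w = \<iota> h" "d\<^sub>H v w = ennreal (norm h)" by (rule d\<^sub>H_finiteE)
  then have "norm h \<le> C" using le assms by simp
  then show "\<forall>l. bounded_linear l \<and> var l \<le> 1 \<longrightarrow> l (v - w) \<le> C"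
    using functional_le_norm h(1) order_trans by metis
next
  assume "\<forall>l. bounded_linear l \<and> var l \<le> 1 \<longrightarrow> l (v - w) \<le> C"
  then have "\<exists>h. v - w = \<iota> h \<and> norm h \<le> C" by (intro in_range_if_bounded) blast
  then show "d\<^sub>H v w \<le> ennreal C" using d\<^sub>H_\<iota> by (auto intro: ennreal_leI)
qed

lemma ext_distance_d\<^sub>H: "ext_distance_on UNIV d\<^sub>H"
  unfolding ext_distance_on_def
proof (intro conjI ballI)
  have le: "d\<^sub>H v w \<le> d\<^sub>H w v" for v w
  proof (cases "d\<^sub>H w v = \<infinity>")
    case False
    then obtain h where h: "w - v = \<iota> h" "d\<^sub>H w v = ennreal (norm h)" by (rule d\<^sub>H_finiteE)
    then have "v - w = \<iota> (- h)" by (metis \<iota>.neg minus_diff_eq)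
    then show ?thesis using h d\<^sub>H_\<iota> by fastforce
  qed simp
  fix x y z :: 'w
  show "d\<^sub>H x y = d\<^sub>H y x" by (intro antisym le)
  show "d\<^sub>H x y = 0 \<longleftrightarrow> x = y"
  proof
    assume z: "d\<^sub>H x y = 0"
    then have "d\<^sub>H x y \<noteq> \<infinity>" by simp
    then obtain h where "x - y = \<iota> h" "d\<^sub>H x y = ennreal (norm h)" by (rule d\<^sub>H_finiteE)
    then show "x = y" using z by (simp add: \<iota>.zero)
  next
    assume "x = y"
    then show "d\<^sub>H x y = 0" using d\<^sub>H_\<iota>[of x y 0] by (simp add: \<iota>.zero)
  qed
  show "d\<^sub>H x z \<le> d\<^sub>H x y + d\<^sub>H y z"
  proof (cases "d\<^sub>H x y = \<infinity> \<or> d\<^sub>H y z = \<infinity>")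
    case False
    then obtain g h where gh: "x - y = \<iota> g" "d\<^sub>H x y = ennreal (norm g)" "y - z = \<iota> h" "d\<^sub>H y z = ennreal (norm h)"
      by (metis d\<^sub>H_finiteE)
    have "x - z = \<iota> (g + h)" using gh by (simp add: \<iota>.add[symmetric] flip: gh(1,3)) (simp add: \<iota>.add gh(1,3)[symmetric])
    then have "d\<^sub>H x z = ennreal (norm (g + h))" by (rule d\<^sub>H_\<iota>)
    also have "\<dots> \<le> ennreal (norm g + norm h)" by (intro ennreal_leI norm_triangle_ineq)
    finally show ?thesis by (simp add: gh)
  qed auto
qed

text \<open>A Cauchy sequence eventually stays in one translate of the Cameron-Martin space, where
  \<open>d\<^sub>H\<close> is the Hilbert norm of differences.\<close>

lemma ext_complete_d\<^sub>H: "ext_complete_on UNIV d\<^sub>H"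
  unfolding ext_complete_on_def
proof (intro allI impI)
  fix s :: "nat \<Rightarrow> 'w"
  assume "range s \<subseteq> UNIV \<and> (\<forall>\<epsilon>>0. \<exists>N. \<forall>i\<ge>N. \<forall>j\<ge>N. d\<^sub>H (s i) (s j) < \<epsilon>)"
  then have C: "\<And>\<epsilon>. \<epsilon> > 0 \<Longrightarrow> \<exists>N. \<forall>i\<ge>N. \<forall>j\<ge>N. d\<^sub>H (s i) (s j) < ennreal \<epsilon>" by simp
  obtain N0 where N0: "\<forall>i\<ge>N0. \<forall>j\<ge>N0. d\<^sub>H (s i) (s j) < ennreal 1" using C[of 1] by auto
  have "\<exists>h. i \<ge> N0 \<longrightarrow> s i - s N0 = \<iota> h" for i
  proof (cases "i \<ge> N0")
    case True
    then have "d\<^sub>H (s i) (s N0) \<noteq> \<infinity>" using N0[rule_format, of i N0] by auto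
    then show ?thesis by (metis d\<^sub>H_finiteE)
  qed simp
  then obtain g where g: "\<And>i. i \<ge> N0 \<Longrightarrow> s i - s N0 = \<iota> (g i)" by metis
  have d: "d\<^sub>H (s i) (s j) = ennreal (norm (g i - g j))" if "i \<ge> N0" "j \<ge> N0" for i j
  proof (rule d\<^sub>H_\<iota>)
    have "s i - s j = (s i - s N0) - (s j - s N0)" by simp
    then show "s i - s j = \<iota> (g i - g j)" by (simp only: g that \<iota>.diff)
  qed
  have "Cauchy g"
  proof (rule metric_CauchyI)
    fix e :: real assume "e > 0"
    then obtain N where N: "\<forall>i\<ge>N. \<forall>j\<ge>N. d\<^sub>H (s i) (s j) < ennreal e" using C by blast
    have "dist (g i) (g j) < e" if "i \<ge> max N N0" "j \<ge> max N N0" for i j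
    proof -
      have "ennreal (norm (g i - g j)) < ennreal e" using N[rule_format, of i j] d[of i j] that by simp
      then show ?thesis by (simp add: dist_norm ennreal_less_iff)
    qed
    then show "\<exists>N. \<forall>i\<ge>N. \<forall>j\<ge>N. dist (g i) (g j) < e" by blast
  qed
  then obtain h where h: "g \<longlonglongrightarrow> h" using Cauchy_convergent_iff convergent_def by blast
  have "(\<lambda>i. d\<^sub>H (s i) (s N0 + \<iota> h)) \<longlonglongrightarrow> 0"
  proof (rule ennreal_tendsto_0I)
    fix e :: real assume "e > 0"
    then obtain N where N: "\<forall>i\<ge>N. dist (g i) h < e" using h by (auto simp: lim_sequentially)
    have "d\<^sub>H (s i) (s N0 + \<iota> h) \<le> ennreal e" if "i \<ge> max N N0" for i
    proof -
      have "s i - (s N0 + \<iota> h) = \<iota> (g i - h)" using g[of i] that by (simp add: \<iota>.diff algebra_simps)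
      then have "d\<^sub>H (s i) (s N0 + \<iota> h) = ennreal (norm (g i - h))" by (rule d\<^sub>H_\<iota>)
      moreover have "norm (g i - h) \<le> e" using N[rule_format, of i] that by (simp add: dist_norm)
      ultimately show ?thesis by (simp add: ennreal_leI)
    qed
    then show "\<exists>N. \<forall>i\<ge>N. d\<^sub>H (s i) (s N0 + \<iota> h) \<le> ennreal e" by blast
  qed
  then show "\<exists>x\<in>UNIV. (\<lambda>i. d\<^sub>H (s i) x) \<longlonglongrightarrow> 0" by blast
qed

lemma lsc_d\<^sub>H: "lsc_dist euclidean d\<^sub>H"
  unfolding lsc_dist_def
proof
  fix c
  have "open {z. c < d\<^sub>H (fst z) (snd z)}"
  proof (cases c)
    case (real C)
    have "{z. c < d\<^sub>H (fst z) (snd z)} = (\<Union>l\<in>{l. bounded_linear l \<and> var l \<le> 1}. {z. C < l (fst z - snd z)})"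
      using d\<^sub>H_le_iff[OF real(1)] by (auto simp: real(2) not_le[symmetric])
    moreover have "open {z :: 'w \<times> 'w. C < l (fst z - snd z)}" if "bounded_linear l" for l
      by (intro open_Collect_less continuous_on_const bounded_linear.continuous_on[OF that]
          continuous_on_diff continuous_on_fst continuous_on_snd continuous_on_id)
    ultimately show ?thesis by auto
  qed simp
  moreover have "{(x, y). x \<in> topspace euclidean \<and> y \<in> topspace euclidean \<and> c < d\<^sub>H x y} = {z. c < d\<^sub>H (fst z) (snd z)}"
    by auto
  ultimately show "openin (prod_topology euclidean euclidean)
      {(x, y). x \<in> topspace euclidean \<and> y \<in> topspace euclidean \<and> c < d\<^sub>H x y}"
    by simp
qed

lemma dist_topology_finer_d\<^sub>H: "dist_topology_finer euclidean d\<^sub>H"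
  unfolding dist_topology_finer_def
proof (intro allI impI ballI)
  fix U :: "'w set" and x assume "openin euclidean U" "x \<in> U"
  then obtain e where e: "e > 0" "ball x e \<subseteq> U" by (auto simp: open_contains_ball)
  obtain K where K: "K > 0" "\<And>h. norm (\<iota> h) \<le> norm h * K" using \<iota>.pos_bounded by blast
  have "y \<in> U" if "d\<^sub>H x y < ennreal (e / K)" for y
  proof -
    have "d\<^sub>H x y \<noteq> \<infinity>" using that by auto
    then obtain h where h: "x - y = \<iota> h" "d\<^sub>H x y = ennreal (norm h)" by (rule d\<^sub>H_finiteE)
    then have "norm h < e / K" using that by (simp add: ennreal_less_iff)
    then have "norm h * K < e" using K(1) by (simp add: field_simps)
    then have "norm (x - y) < e" using K(2)[of h] h by simp
    then show ?thesis using e by (auto simp: dist_norm)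
  qed
  then show "\<exists>\<epsilon>>0. \<forall>y\<in>topspace euclidean. d\<^sub>H x y < \<epsilon> \<longrightarrow> y \<in> U"
    using e K by (intro exI[of _ "ennreal (e / K)"]) auto
qed

lemma emm_space_wiener: "emm_space (wiener_emm \<iota> \<mu>)"
  unfolding emm_space_def wiener_emm_eq emm.simps
  using completely_metrizable_space_euclidean second_countable_euclidean lsc_d\<^sub>H dist_topology_finer_d\<^sub>H
    ext_complete_d\<^sub>H ext_distance_d\<^sub>H \<mu>.prob_space_axioms
  by (auto simp: borel_prob_on_def sets_\<mu> sets_borel_eq_sigma_sets)

text \<open>Gram-Schmidt on the representers of a countable separating family, with the zero vectors
  skipped by enumerating \<open>S\<close>. If \<open>S\<close> were finite, its vectors would span
  the whole Hilbert space, against infinite dimension.\<close>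

lemma orthonormal_functionals:
  assumes inf: "\<not> (\<exists>B :: 'h set. finite B \<and> span B = UNIV)"
  shows "\<exists>m :: nat \<Rightarrow> 'w \<Rightarrow> real. (\<forall>n. bounded_linear (m n)) \<and> orthonormal_sequence (\<lambda>n. rep (m n)) \<and>
    (\<forall>u. (\<forall>n. m n u = 0) \<longrightarrow> u = 0)"
proof -
  obtain l :: "nat \<Rightarrow> 'w \<Rightarrow> real" where l: "\<And>n. bounded_linear (l n)" "\<And>w. (\<And>n. l n w = 0) \<Longrightarrow> w = 0"
    using countable_separating by blast
  define H where "H n = rep (l n)" for n
  define e where "e = gram_schmidt H"
  define S where "S = {k. e k \<noteq> 0}"
  have H_span: "H k \<in> span (e ` S)" for k
  proof -
    have "H k \<in> span (range e)" unfolding e_def by (rule gram_schmidt_span)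
    also have "range e \<subseteq> insert 0 (e ` S)" by (auto simp: S_def)
    then have "span (range e) \<subseteq> span (e ` S)" by (metis span_insert_0 span_mono)
    finally show ?thesis .
  qed
  have orth_0: "h = 0" if "\<And>k. k \<in> S \<Longrightarrow> inner (e k) h = 0" for h
  proof -
    have "subspace {x. inner x h = 0}" by (rule subspaceI) (auto simp: inner_add_left)
    moreover have "e ` S \<subseteq> {x. inner x h = 0}" using that by auto
    ultimately have "span (e ` S) \<subseteq> {x. inner x h = 0}" by (intro span_minimal)
    then have "inner (H k) h = 0" for k using H_span by blast
    then have "l k (\<iota> h) = 0" for k using inner_rep[OF l(1)] by (simp add: H_def)
    then have "\<iota> h = 0" by (rule l(2))
    then show ?thesis using injD[OF inj_\<iota>, of h 0] by (simp add: \<iota>.zero)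
  qed
  have "infinite S"
  proof
    assume fin: "finite S"
    have "h \<in> span (e ` S)" for h
    proof -
      let ?p = "\<Sum>k\<in>S. inner (e k) h *\<^sub>R e k"
      have "h - ?p = 0"
      proof (rule orth_0)
        fix j assume j: "j \<in> S"
        have "inner (e j) ?p = (\<Sum>k\<in>S. inner (e k) h * inner (e j) (e k))" by (simp add: inner_sum_right)
        also have "\<dots> = (\<Sum>k\<in>S. if k = j then inner (e j) h else 0)"
          using j gram_schmidt_orthogonal[of j _ H] gram_schmidt_self[of H j]
          by (intro sum.cong refl) (auto simp: e_def S_def)
        also have "\<dots> = inner (e j) h" using fin j by simp
        finally show "inner (e j) (h - ?p) = 0" by (simp add: inner_diff_right)
      qed
      then have "h = ?p" by simp
      also have "?p \<in> span (e ` S)" by (intro span_sum span_scale span_base) auto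
      finally show ?thesis .
    qed
    then have "span (e ` S) = UNIV" by auto
    then show False using inf fin by blast
  qed
  define b where "b n = e (enumerate S n)" for n
  have bS: "enumerate S n \<in> S" for n using \<open>infinite S\<close> by (rule enumerate_in_set)
  have "b n \<in> {rep k |k. bounded_linear k \<and> k 0 = 0}" for n
    unfolding b_def e_def
  proof (rule gram_schmidt_in_subspace[OF subspace_rep])
    show "H k \<in> {rep k |k. bounded_linear k \<and> k 0 = 0}" for k
      using l(1)[of k] linear_0[OF bounded_linear.linear[OF l(1)[of k]]] by (auto simp: H_def)
  qed
  then have "\<exists>m. bounded_linear m \<and> b n = rep m" for n by blast
  then obtain m where m: "\<And>n. bounded_linear (m n)" "\<And>n. b n = rep (m n)" by metis
  have range_S: "\<exists>n. enumerate S n = k" if "k \<in> S" for k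
  proof -
    have "k \<in> range (enumerate S)" using that by (simp add: range_enumerate[OF \<open>infinite S\<close>])
    then show ?thesis by (rule rangeE) (intro exI, rule sym)
  qed
  have "orthonormal_sequence b"
  proof
    show "inner (b i) (b j) = (if i = j then 1 else 0)" for i j
    proof (cases "i = j")
      case True
      then show ?thesis using bS[of j] gram_schmidt_self[of H "enumerate S j"] by (simp add: b_def e_def S_def)
    next
      case False
      then have "enumerate S i \<noteq> enumerate S j"
        using strict_mono_enumerate[OF \<open>infinite S\<close>] strict_mono_eq by blast
      then show ?thesis using False by (simp add: b_def e_def gram_schmidt_orthogonal)
    qed
    show "h = 0" if "\<And>n. inner (b n) h = 0" for h
      using that range_S by (intro orth_0) (metis b_def)
  qed
  moreover have "u = 0" if u: "\<And>n. m n u = 0" for u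
  proof (rule l(2))
    fix k
    let ?V = "{rep k |k. bounded_linear k \<and> k u = 0}"
    have "e ` S \<subseteq> ?V"
    proof
      fix x assume "x \<in> e ` S"
      then obtain n where "x = b n" using range_S by (auto simp: b_def)
      then show "x \<in> ?V" using m u by auto
    qed
    then have "span (e ` S) \<subseteq> ?V" by (intro span_minimal subspace_rep)
    then obtain k' where "H k = rep k'" "bounded_linear k'" "k' u = 0" using H_span[of k] by blast
    moreover from this have "l k = k'" using inj_rep[OF l(1)] by (simp add: H_def)
    ultimately show "l k u = 0" by simp
  qed
  moreover have "b = (\<lambda>n. rep (m n))" using m(2) by auto
  ultimately show ?thesis using m(1) by (intro exI[of _ m]) simp
qed

end

section \<open>The coordinate isomorphism of a Wiener space with the standard Gaussian sequence
  space\<close>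

locale wiener_coordinates = wiener_space \<iota> \<mu>
  for \<iota> :: "'h::{real_inner,complete_space,second_countable_topology} \<Rightarrow>
              'w::{banach,second_countable_topology}"
    and \<mu> :: "'w measure" +
  fixes m :: "nat \<Rightarrow> 'w \<Rightarrow> real"
  assumes bl_m: "\<And>n. bounded_linear (m n)"
    and onb: "orthonormal_sequence (\<lambda>n. rep (m n))"
    and sep_m: "\<And>u. (\<And>n. m n u = 0) \<Longrightarrow> u = 0"
begin

interpretation \<iota>: bounded_linear \<iota> by (rule bl_\<iota>)

sublocale B: orthonormal_sequence "\<lambda>n. rep (m n)" by (rule onb)

sublocale S: gauss_seq "\<lambda>_. 1" by unfold_locales simp

definition F :: "'w \<Rightarrow> nat \<Rightarrow> real" where "F w = (\<lambda>n. m n w)"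

lemma m_diff: "m n v - m n w = m n (v - w)"
  using linear_diff[OF bounded_linear.linear[OF bl_m]] by simp

lemma m_\<iota>: "m n (\<iota> h) = inner (rep (m n)) h"
  by (rule inner_rep[OF bl_m, symmetric])

text \<open>Parseval covers finite distances. Conversely, if the coordinates of \<open>v - w\<close>
  were square-summable, Riesz-Fischer would give a Cameron-Martin vector with the same coordinates,
  equal to \<open>v - w\<close> by separation; thus infinite distances match too.\<close>

lemma F_isometry: "l2_dist (F v) (F w) = d\<^sub>H v w"
proof (cases "v - w \<in> range \<iota>")
  case True
  then obtain h where h: "v - w = \<iota> h" by blast
  have "(\<lambda>n. (F v n - F w n)\<^sup>2) sums (norm h)\<^sup>2"
    using B.parseval[of h] by (simp add: F_def m_diff h m_\<iota>)
  then show ?thesis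
    using d\<^sub>H_\<iota>[OF h] by (simp add: l2_dist_def sums_iff)
next
  case False
  have "\<not> summable (\<lambda>n. (F v n - F w n)\<^sup>2)"
  proof
    assume "summable (\<lambda>n. (F v n - F w n)\<^sup>2)"
    then have "summable (\<lambda>n. (m n (v - w))\<^sup>2)" by (simp add: F_def m_diff)
    from B.series_converges[OF this] obtain h where h: "\<And>n. inner (rep (m n)) h = m n (v - w)" by blast
    have "m n (v - w - \<iota> h) = 0" for n using m_diff[of n "v - w" "\<iota> h"] h[of n] by (simp add: m_\<iota>)
    then have "v - w - \<iota> h = 0" by (rule sep_m)
    then show False using False by auto
  qed
  then show ?thesis using False by (simp add: l2_dist_def d\<^sub>H_def)
qed

lemma combination:
  assumes "finite J"
  shows "bounded_linear (\<lambda>w. \<Sum>j\<in>J. t j * m j w)" "var (\<lambda>w. \<Sum>j\<in>J. t j * m j w) = (\<Sum>j\<in>J. (t j)\<^sup>2)"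
proof -
  show bl: "bounded_linear (\<lambda>w. \<Sum>j\<in>J. t j * m j w)"
    by (intro bounded_linear_sum bounded_linear_const_mult bl_m)
  have "rep (\<lambda>w. \<Sum>j\<in>J. t j * m j w) = (\<Sum>j\<in>J. t j *\<^sub>R rep (m j))"
    by (rule rep_eqI[OF bl]) (simp add: inner_sum_left m_\<iota>)
  then have "inner (rep (\<lambda>w. \<Sum>j\<in>J. t j * m j w)) (rep (\<lambda>w. \<Sum>j\<in>J. t j * m j w)) = (\<Sum>j\<in>J. (t j)\<^sup>2)"
    using B.norm_sum_square[OF assms, of t] by (simp add: power2_norm_eq_inner)
  then show "var (\<lambda>w. \<Sum>j\<in>J. t j * m j w) = (\<Sum>j\<in>J. (t j)\<^sup>2)"
    by (simp add: inner_rep_rep[OF bl bl] var_def power2_eq_square)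
qed

text \<open>A functional of positive variance is a multiple of one with the standard normal law.
  Variance 0 is treated apart, since the functional is then almost everywhere 0 and has no
  density.\<close>

lemma characteristic_function:
  assumes l: "bounded_linear l"
  shows "(\<integral>x. cos (l x) \<partial>\<mu>) = exp (- var l / 2)" "(\<integral>x. sin (l x) \<partial>\<mu>) = 0"
proof -
  note [measurable] = measurable_functional[OF l]
  have "(\<integral>x. cos (l x) \<partial>\<mu>) = exp (- var l / 2) \<and> (\<integral>x. sin (l x) \<partial>\<mu>) = 0"
  proof (cases "var l = 0")
    case True
    then have "AE x in \<mu>. (l x)\<^sup>2 = 0"
      using integral_nonneg_eq_0_iff_AE[OF functional_law(1)[OF l]] by (simp add: var_def)
    then have "AE x in \<mu>. l x = 0" by simp
    then have "AE x in \<mu>. cos (l x) = 1" "AE x in \<mu>. sin (l x) = 0" by (auto elim: eventually_mono)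
    then have "(\<integral>x. cos (l x) \<partial>\<mu>) = (\<integral>x. 1 \<partial>\<mu>)" "(\<integral>x. sin (l x) \<partial>\<mu>) = (\<integral>x. 0 \<partial>\<mu>)"
      by (intro integral_cong_AE; simp)+
    then show ?thesis using True \<mu>.prob_space by simp
  next
    case False
    define s where "s = sqrt (var l)"
    have s: "s > 0" "s\<^sup>2 = var l" using False var_nonneg[of l] by (auto simp: s_def)
    define k where "k = (\<lambda>x. (1 / s) * l x)"
    have blk: "bounded_linear k" unfolding k_def by (rule bounded_linear_const_mult[OF l])
    have vk: "var k = 1" unfolding k_def var_scale using s False by (simp add: power_divide)
    have law: "distr \<mu> borel k = gauss 1" using functional_law(2)[OF blk] vk by simp
    note [measurable] = measurable_functional[OF blk]
    have lk: "l x = s * k x" for x using s by (simp add: k_def)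
    have "char (gauss 1) s = (CLINT x|\<mu>. iexp (s * k x))"
      unfolding law[symmetric] char_def by (subst integral_distr) auto
    also have "\<dots> = (CLINT x|\<mu>. complex_of_real (cos (l x)) + \<i> * complex_of_real (sin (l x)))"
      by (simp only: exp_Euler cos_of_real sin_of_real lk)
    also have "\<dots> = complex_of_real (\<integral>x. cos (l x) \<partial>\<mu>) + \<i> * complex_of_real (\<integral>x. sin (l x) \<partial>\<mu>)"
      by (subst Bochner_Integration.integral_add) (auto intro!: \<mu>.integrable_const_bound[of _ 1] simp: norm_mult)
    finally have "complex_of_real (\<integral>x. cos (l x) \<partial>\<mu>) + \<i> * complex_of_real (\<integral>x. sin (l x) \<partial>\<mu>) =
        complex_of_real (exp (- s\<^sup>2 / 2))" by (simp add: char_std_normal_distribution)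
    from arg_cong[OF this, of Re] arg_cong[OF this, of Im] show ?thesis by (simp add: s(2))
  qed
  then show "(\<integral>x. cos (l x) \<partial>\<mu>) = exp (- var l / 2)" "(\<integral>x. sin (l x) \<partial>\<mu>) = 0" by auto
qed

lemma measurable_F[measurable]: "F \<in> \<mu> \<rightarrow>\<^sub>M S.P"
  unfolding S.P_def
proof (rule measurable_PiM_single')
  show "(\<lambda>w. F w n) \<in> \<mu> \<rightarrow>\<^sub>M gauss 1" for n using measurable_functional[OF bl_m[of n]] by (simp add: F_def)
qed (auto simp: space_PiM)

text \<open>A combination of the \<open>m j\<close> is again a functional, with variance the sum of
  the squared coefficients by orthonormality. Its characteristic function therefore factorises, and
  \<open>weighted_joint_normal_law\<close> with weight 1 gives the measure of cylinders.\<close>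

lemma distr_F: "distr \<mu> S.P F = S.P"
proof -
  have "distr \<mu> S.P F = PiM UNIV (\<lambda>_::nat. gauss 1)"
  proof (rule S.G.PiM_eq)
    show "sets (distr \<mu> S.P F) = sets (PiM UNIV (\<lambda>_::nat. gauss 1))" by (simp add: S.P_def)
    fix J :: "nat set" and E assume J: "finite J" "J \<subseteq> UNIV" "\<And>j. j \<in> J \<Longrightarrow> E j \<in> sets (gauss 1)"
    let ?X = "prod_emb UNIV (\<lambda>_. gauss 1) J (Pi\<^sub>E J E)"
    \<comment> \<open>Extended by \<open>UNIV\<close> outside \<open>J\<close> because the joint law
      lemma asks for a Borel set at every index.\<close>
    define E' where "E' j = (if j \<in> J then E j else UNIV)" for j
    have E': "E' j \<in> sets borel" for j using J by (auto simp: E'_def)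
    have mm: "m j \<in> borel_measurable \<mu>" for j by (rule measurable_functional[OF bl_m])
    have one: "(\<integral>x. (1 :: real) \<partial>\<mu>) = 1" using \<mu>.prob_space by simp
    have "(\<integral>x. 1 * (\<Prod>j\<in>J. indicator (E' j) (m j x)) \<partial>\<mu>) = (\<integral>x. (1::real) \<partial>\<mu>) * (\<Prod>j\<in>J. measure (gauss 1) (E' j))"
    proof (rule \<mu>.weighted_joint_normal_law[OF J(1) mm E', where C = 1])
      show "(\<integral>x. 1 * cos (\<Sum>j\<in>J. t j * m j x) \<partial>\<mu>) = (\<integral>x. 1 \<partial>\<mu>) * exp (- (\<Sum>j\<in>J. (t j)\<^sup>2) / 2)" for t
        using characteristic_function(1)[OF combination(1)[OF J(1), of t]] combination(2)[OF J(1), of t]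
        by (simp add: one \<mu>.prob_space[simplified])
      show "(\<integral>x. 1 * sin (\<Sum>j\<in>J. t j * m j x) \<partial>\<mu>) = 0" for t
        using characteristic_function(2)[OF combination(1)[OF J(1), of t]] by simp
    qed auto
    then have 1: "(\<integral>x. (\<Prod>j\<in>J. indicator (E' j) (m j x)) \<partial>\<mu>) = (\<Prod>j\<in>J. measure (gauss 1) (E' j))" by (simp add: one \<mu>.prob_space[simplified])
    have X: "?X \<in> sets S.P" unfolding S.P_def using J by (intro sets_PiM_I) auto
    have "F -` ?X \<inter> space \<mu> = {w. \<forall>j\<in>J. m j w \<in> E' j}"
      by (auto simp: prod_emb_def PiE_iff F_def E'_def)
    then have "measure \<mu> (F -` ?X \<inter> space \<mu>) = (\<integral>x. indicator {w. \<forall>j\<in>J. m j w \<in> E' j} x \<partial>\<mu>)"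
      by simp
    also have "\<dots> = (\<integral>x. (\<Prod>j\<in>J. indicator (E' j) (m j x)) \<partial>\<mu>)"
      using J(1) by (intro Bochner_Integration.integral_cong refl) (auto simp: indicator_def prod_eq_1_iff intro!: prod_zero[symmetric])
    finally have "measure \<mu> (F -` ?X \<inter> space \<mu>) = (\<Prod>j\<in>J. measure (gauss 1) (E' j))" using 1 by simp
    moreover have "emeasure (distr \<mu> S.P F) ?X = emeasure \<mu> (F -` ?X \<inter> space \<mu>)"
      by (rule emeasure_distr[OF measurable_F X])
    moreover have "(\<Prod>j\<in>J. measure (gauss 1) (E' j)) = (\<Prod>j\<in>J. measure (gauss 1) (E j))"
      by (intro prod.cong) (auto simp: E'_def)
    ultimately have "emeasure (distr \<mu> S.P F) ?X = ennreal (\<Prod>j\<in>J. measure (gauss 1) (E j))"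
      by (simp add: \<mu>.emeasure_eq_measure)
    also have "\<dots> = (\<Prod>j\<in>J. emeasure (gauss 1) (E j))"
      using prob_space.finite_measure[OF prob_space_gauss[of 1]]
      by (subst prod_ennreal[symmetric]) (auto simp: finite_measure.emeasure_eq_measure)
    finally show "emeasure (distr \<mu> S.P F) ?X = (\<Prod>j\<in>J. emeasure (gauss 1) (E j))" .
  qed
  then show ?thesis by (simp add: S.P_def)
qed

lemma iso_gaussian: "emm_iso (wiener_emm \<iota> \<mu>) (gaussian_R_infinity (\<lambda>_. 1))"
  unfolding emm_iso_def
proof (intro exI conjI)
  have meas: "emm_meas (wiener_emm \<iota> \<mu>) = \<mu>" by (simp add: wiener_emm_eq)
  show "F \<in> completion (emm_meas (wiener_emm \<iota> \<mu>)) \<rightarrow>\<^sub>M emm_meas (gaussian_R_infinity (\<lambda>_. 1))"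
    unfolding meas S.emm_meas_eq by (rule measurable_completion[OF measurable_F])
  show "distr (completion (emm_meas (wiener_emm \<iota> \<mu>))) (emm_meas (gaussian_R_infinity (\<lambda>_. 1))) F =
      emm_meas (gaussian_R_infinity (\<lambda>_. 1))"
    unfolding meas S.emm_meas_eq by (simp add: distr_completion[OF measurable_F] distr_F)
  have "UNIV \<in> sets \<mu>" using sets.top[of \<mu>] by simp
  then show "\<exists>A\<in>sets (completion (emm_meas (wiener_emm \<iota> \<mu>))). emeasure (completion (emm_meas (wiener_emm \<iota> \<mu>))) A = 1 \<and>
      (\<forall>x\<in>A. \<forall>y\<in>A. emm_dist (gaussian_R_infinity (\<lambda>_. 1)) (F x) (F y) = emm_dist (wiener_emm \<iota> \<mu>) x y)"
    unfolding meas using \<mu>.emeasure_space_1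
    by (intro bexI[of _ UNIV]) (auto simp: wiener_emm_eq gaussian_R_infinity_def F_isometry)
qed

text \<open>The functionals \<open>m n\<close> are 1-Lipschitz because \<open>F\<close> is
  isometric, and they are pairwise separated because \<open>F\<close> transports
  \<open>\<mu>\<close> to the Gaussian product, where \<open>coordinates_separated\<close> applies
  with standard deviation 1 and threshold 1/2.\<close>

lemma not_concentrated: "\<not> concentrated (wiener_emm \<iota> \<mu>)"
proof (rule not_concentratedI)
  have meas: "emm_meas (wiener_emm \<iota> \<mu>) = \<mu>" by (simp add: wiener_emm_eq)
  have top: "UNIV \<in> sets \<mu>" "emeasure \<mu> UNIV = 1" using sets.top[of \<mu>] \<mu>.emeasure_space_1 by simp_all
  show "prob_space (emm_meas (wiener_emm \<iota> \<mu>))" unfolding meas by (rule \<mu>.prob_space_axioms)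
  show "m n \<in> ae_Lip1 (wiener_emm \<iota> \<mu>)" for n
  proof -
    have "ennreal \<bar>m n v - m n w\<bar> \<le> d\<^sub>H v w" for v w
      using coordinate_le_l2_dist[of "F v" n "F w"] unfolding F_isometry by (simp add: F_def)
    then show ?thesis using top measurable_functional[OF bl_m[of n]]
      by (auto simp: ae_Lip1_def wiener_emm_eq intro!: bexI[of _ UNIV])
  qed
  show "(1/2 :: real) > 0" by simp
  fix a b :: nat and c :: real assume "a \<noteq> b"
  then have le: "S.P.prob {x. \<bar>x a - (x b + c)\<bar> \<le> 1/2} \<le> 1/2" by (rule S.coordinates_separated) auto
  have A: "{x \<in> space S.P. \<bar>x a - (x b + c)\<bar> \<le> 1/2} \<in> sets S.P" by measurable
  have "S.P.prob {x. \<bar>x a - (x b + c)\<bar> \<le> 1/2} = measure \<mu> (F -` {x \<in> space S.P. \<bar>x a - (x b + c)\<bar> \<le> 1/2} \<inter> space \<mu>)"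
    using measure_distr[OF measurable_F A] distr_F by simp
  also have "F -` {x \<in> space S.P. \<bar>x a - (x b + c)\<bar> \<le> 1/2} \<inter> space \<mu> = {w \<in> space \<mu>. \<bar>m a w - (m b w + c)\<bar> \<le> 1/2}"
    by (auto simp: F_def)
  finally have le': "\<mu>.prob {w \<in> space \<mu>. \<bar>m a w - (m b w + c)\<bar> \<le> 1/2} \<le> 1/2" using le by simp
  note [measurable] = measurable_functional[OF bl_m]
  have A': "{w \<in> space \<mu>. \<bar>m a w - (m b w + c)\<bar> \<le> 1/2} \<in> sets \<mu>" by measurable
  have "1/2 \<le> \<mu>.prob (space \<mu> - {w \<in> space \<mu>. \<bar>m a w - (m b w + c)\<bar> \<le> 1/2})"
    using \<mu>.prob_compl[OF A'] le' by linarith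
  also have "space \<mu> - {w \<in> space \<mu>. \<bar>m a w - (m b w + c)\<bar> \<le> 1/2} = {w \<in> space \<mu>. 1/2 < \<bar>m a w - (m b w + c)\<bar>}"
    by auto
  finally show "1/2 \<le> measure (emm_meas (wiener_emm \<iota> \<mu>))
      {w \<in> space (emm_meas (wiener_emm \<iota> \<mu>)). 1/2 < \<bar>m a w - (m b w + c)\<bar>}" unfolding meas .
qed

end

text \<open>Infinite dimension is expressed by the absence of a finite spanning set, and divergence
  of the series of variances by its value in \<open>ennreal\<close>.\<close>

theorem corollary1p6:
  fixes \<sigma> :: "nat \<Rightarrow> real"
    and \<iota> :: "'h::{real_inner,complete_space,second_countable_topology} \<Rightarrow>
              'w::{banach,second_countable_topology}"
    and \<mu> :: "'w measure"
  assumes \<sigma>_pos: "\<And>n. 0 < \<sigma> n"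
  shows "emm_space (gaussian_R_infinity \<sigma>) \<and>
    (in_X_conc (gaussian_R_infinity \<sigma>) \<longleftrightarrow> \<sigma> \<longlonglongrightarrow> 0) \<and>
    (in_boundary_X_conc (gaussian_R_infinity \<sigma>) \<longleftrightarrow>
       \<sigma> \<longlonglongrightarrow> 0 \<and> (\<Sum>n. ennreal ((\<sigma> n)\<^sup>2)) = \<infinity>) \<and>
    (abstract_wiener_space \<iota> \<mu> \<and> \<not> (\<exists>B :: 'h set. finite B \<and> span B = UNIV) \<longrightarrow>
       emm_space (wiener_emm \<iota> \<mu>) \<and>
       emm_iso (wiener_emm \<iota> \<mu>) (gaussian_R_infinity (\<lambda>_. 1)) \<and>
       \<not> concentrated (wiener_emm \<iota> \<mu>))"
proof (intro conjI impI)
  interpret gauss_seq \<sigma> by unfold_locales (rule \<sigma>_pos)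
  show "emm_space (gaussian_R_infinity \<sigma>)" by (rule emm_space_gaussian)
  show "in_X_conc (gaussian_R_infinity \<sigma>) \<longleftrightarrow> \<sigma> \<longlonglongrightarrow> 0" by (rule in_X_conc_iff)
  show "in_boundary_X_conc (gaussian_R_infinity \<sigma>) \<longleftrightarrow> \<sigma> \<longlonglongrightarrow> 0 \<and> (\<Sum>n. ennreal ((\<sigma> n)\<^sup>2)) = \<infinity>"
    by (rule in_boundary_X_conc_iff)
next
  assume W: "abstract_wiener_space \<iota> \<mu> \<and> \<not> (\<exists>B :: 'h set. finite B \<and> span B = UNIV)"
  then interpret wiener_space \<iota> \<mu> by unfold_locales blast
  show "emm_space (wiener_emm \<iota> \<mu>)" by (rule emm_space_wiener)
  obtain m where m: "\<forall>n. bounded_linear (m n)" "orthonormal_sequence (\<lambda>n. rep (m n))"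
    "\<forall>u. (\<forall>n. m n u = 0) \<longrightarrow> u = 0" using orthonormal_functionals W by blast
  interpret wiener_coordinates \<iota> \<mu> m by (intro wiener_coordinates.intro wiener_coordinates_axioms.intro wiener_space_axioms) (use m in auto)
  show "emm_iso (wiener_emm \<iota> \<mu>) (gaussian_R_infinity (\<lambda>_. 1))" by (rule iso_gaussian)
  show "\<not> concentrated (wiener_emm \<iota> \<mu>)" by (rule not_concentrated)
qed

end
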